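(* Let $\mathcal E$ be a complex separable Hilbert space, let $m\geqslant2$ and let $\pmb\mu=(\mu_1,\ldots,\mu_{m-1})$ be an $(m-1)$-tuple of $\mathcal B(\mathcal E)$-valued semi-spectral measures on the unit circle $\mathbb T$. Let $f\in\mathcal H_{\pmb\mu}(\mathcal E)$. Then the $r$-dilation $f_r$, $f_r(z)=f(rz)$ for $0<r<1$, converges to $f$ in $\mathcal H_{\pmb\mu}(\mathcal E)$ as $r\to1$, that is, $\|f_r-f\|_{\pmb\mu}\to0$ as $r\to1$. Consequently, the set of all $\mathcal E$-valued polynomials is dense in $\mathcal H_{\pmb\mu}(\mathcal E)$.
   Context: $\mathbb D$ is the open unit disc, $dA$ its normalized Lebesgue area measure, and $\mathcal O(\mathbb D,\mathcal E)$ the space of $\mathcal E$-valued holomorphic functions on $\mathbb D$. A $\mathcal B(\mathcal E)$-valued semi-spectral measure on $\mathbb T$ is a finitely additive set function $\mu$ from the Borel $\sigma$-algebra of $\mathbb T$ into the positive operators in $\mathcal B(\mathcal E)$ such that $\mu_{x,y}(\cdot):=\langle\mu(\cdot)x,y\rangle$ is a regular complex Borel measure for all $x,y\in\mathcal E$. Its Poisson integral is $P_\mu(z)=\int_{\mathbb T}\frac{1-|z|^2}{|z-\zeta|^2}d\mu(\zeta)$, $z\in\mathbb D$. For $n\ge1$ and $f\in\mathcal O(\mathbb D,\mathcal E)$, $$D_{\mu,n}(f):=\frac1{n!(n-1)!}\int_{\mathbb D}\langle P_\mu(z)f^{(n)}(z),f^{(n)}(z)\rangle(1-|z|^2)^{n-1}dA(z),$$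 and $\mathcal H_{\mu,n}(\mathcal E):=\{f\in\mathcal O(\mathbb D,\mathcal E):D_{\mu,n}(f)<\infty\}$. $H^2(\mathcal E)$ is the Hardy space of functions $\sum_{j\ge0}a_jz^j$, $a_j\in\mathcal E$, with $\|f\|^2_{H^2(\mathcal E)}=\sum_j\|a_j\|^2<\infty$. $\mathcal H_{\pmb\mu}(\mathcal E):=\bigcap_{j=1}^{m-1}\mathcal H_{\mu_j,j}(\mathcal E)\cap H^2(\mathcal E)$, a Hilbert space with norm $\|f\|^2_{\pmb\mu}=\|f\|^2_{H^2(\mathcal E)}+\sum_{j=1}^{m-1}D_{\mu_j,j}(f)$. *)

theory Defs
  imports "HOL-Analysis.Analysis"
begin

section \<open>Complex Hilbert spaces\<close>

text \<open>
  A complex Hilbert space is a real Hilbert space together with a complex scalar multiplication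
  extending the real one and a complex inner product whose real part is the real inner product;
  hence the norm, metric and topology are those of the complex inner product.
  The complex inner product is linear in its first argument.
\<close>

class complex_inner_space = real_inner +
  fixes scaleC :: "complex \<Rightarrow> 'a \<Rightarrow> 'a" (infixr "*\<^sub>C" 75)
    and cinner :: "'a \<Rightarrow> 'a \<Rightarrow> complex"
  assumes scaleC_add_right: "c *\<^sub>C (x + y) = c *\<^sub>C x + c *\<^sub>C y"
    and scaleC_add_left: "(c + d) *\<^sub>C x = c *\<^sub>C x + d *\<^sub>C x"
    and scaleC_scaleC: "c *\<^sub>C d *\<^sub>C x = (c * d) *\<^sub>C x"
    and scaleC_of_real: "complex_of_real r *\<^sub>C x = r *\<^sub>R x"
    and cinner_commute: "cinner x y = cnj (cinner y x)"
    and cinner_add_left: "cinner (x + y) z = cinner x z + cinner y z"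
    and cinner_scaleC_left: "cinner (c *\<^sub>C x) y = c * cinner x y"
    and Re_cinner: "Re (cinner x y) = inner x y"

class complex_hilbert_space = complex_inner_space + banach

text \<open>
  Elements of \<open>\<B>(\<E>)\<close> are the bounded real-linear maps (type \<open>blinfun\<close>) which are complex-linear.
\<close>

definition complex_linear :: "('e::complex_inner_space \<Rightarrow>\<^sub>L 'e) \<Rightarrow> bool" where
  "complex_linear T \<longleftrightarrow> (\<forall>c x. blinfun_apply T (c *\<^sub>C x) = c *\<^sub>C blinfun_apply T x)"

definition positive_operator :: "('e::complex_inner_space \<Rightarrow>\<^sub>L 'e) \<Rightarrow> bool" where
  "positive_operator T \<longleftrightarrow>
     complex_linear T \<and> (\<forall>x. cinner (blinfun_apply T x) x \<in> \<real>\<^sub>\<ge>\<^sub>0)"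

section \<open>Complex measures\<close>

definition complex_measure :: "'a measure \<Rightarrow> ('a set \<Rightarrow> complex) \<Rightarrow> bool" where
  "complex_measure M \<nu> \<longleftrightarrow>
     (\<forall>A::nat \<Rightarrow> 'a set. range A \<subseteq> sets M \<longrightarrow> disjoint_family A \<longrightarrow>
        (\<lambda>i. \<nu> (A i)) sums \<nu> (\<Union>i. A i))"

definition total_variation :: "'a measure \<Rightarrow> ('a set \<Rightarrow> complex) \<Rightarrow> 'a set \<Rightarrow> ennreal" where
  "total_variation M \<nu> E =
     (SUP A\<in>{A::nat \<Rightarrow> 'a set. range A \<subseteq> sets M \<and> disjoint_family A \<and> (\<Union>i. A i) = E}.
        \<Sum>i. ennreal (cmod (\<nu> (A i))))"

text \<open>
  Integration against a complex measure goes through the Jordan decompositions of its real and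
  imaginary parts. The positive (upper) variation of a real measure \<open>\<nu>\<close> on \<open>E\<close> is the supremum of
  \<open>\<nu> B\<close> over measurable \<open>B \<subseteq> E\<close>; negative values, which \<open>ennreal\<close> truncates to 0, do not affect
  it because \<open>B = {}\<close> is allowed.
\<close>

definition positive_variation :: "'a measure \<Rightarrow> ('a set \<Rightarrow> real) \<Rightarrow> 'a measure" where
  "positive_variation M \<nu> =
     measure_of (space M) (sets M) (\<lambda>E. SUP B\<in>{B \<in> sets M. B \<subseteq> E}. ennreal (\<nu> B))"

definition signed_integral ::
    "'a measure \<Rightarrow> ('a set \<Rightarrow> real) \<Rightarrow> ('a \<Rightarrow> complex) \<Rightarrow> complex" where
  "signed_integral M \<nu> g =
     (\<integral>x. g x \<partial>positive_variation M \<nu>) - (\<integral>x. g x \<partial>positive_variation M (\<lambda>A. - \<nu> A))"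

definition complex_measure_integral ::
    "'a measure \<Rightarrow> ('a set \<Rightarrow> complex) \<Rightarrow> ('a \<Rightarrow> complex) \<Rightarrow> complex" where
  "complex_measure_integral M \<nu> g =
     signed_integral M (\<lambda>A. Re (\<nu> A)) g + \<i> * signed_integral M (\<lambda>A. Im (\<nu> A)) g"

section \<open>Semi-spectral measures on the unit circle and their Poisson integrals\<close>

definition circle_borel :: "complex measure" where
  "circle_borel = restrict_space borel (sphere 0 1)"

definition regular_complex_borel_measure :: "(complex set \<Rightarrow> complex) \<Rightarrow> bool" where
  "regular_complex_borel_measure \<nu> \<longleftrightarrow>
     complex_measure circle_borel \<nu> \<and>
     (\<forall>E\<in>sets circle_borel.
        total_variation circle_borel \<nu> E =
          (INF U\<in>{U. openin (top_of_set (sphere 0 1)) U \<and> E \<subseteq> U}.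
             total_variation circle_borel \<nu> U) \<and>
        total_variation circle_borel \<nu> E =
          (SUP K\<in>{K. compact K \<and> K \<subseteq> E}. total_variation circle_borel \<nu> K))"

text \<open>Only the values of \<open>\<mu>\<close> on Borel subsets of the circle are relevant.\<close>

definition semi_spectral_measure :: "(complex set \<Rightarrow> ('e::complex_inner_space \<Rightarrow>\<^sub>L 'e)) \<Rightarrow> bool"
  where
  "semi_spectral_measure \<mu> \<longleftrightarrow>
     additive (sets circle_borel) \<mu> \<and>
     (\<forall>A\<in>sets circle_borel. positive_operator (\<mu> A)) \<and>
     (\<forall>x y. regular_complex_borel_measure (\<lambda>A. cinner (blinfun_apply (\<mu> A) x) y))"

text \<open>
  The operator-valued integral is understood weakly: \<open>P\<^sub>\<mu>(z)\<close> is the bounded operator whose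
  sesquilinear form at \<open>(x, y)\<close> is the integral of the Poisson kernel against \<open>\<mu>\<^sub>x\<^sub>,\<^sub>y\<close>.
\<close>

definition poisson_integral ::
    "(complex set \<Rightarrow> ('e::complex_inner_space \<Rightarrow>\<^sub>L 'e)) \<Rightarrow> complex \<Rightarrow> ('e \<Rightarrow>\<^sub>L 'e)" where
  "poisson_integral \<mu> z =
     (THE T. complex_linear T \<and>
        (\<forall>x y. cinner (blinfun_apply T x) y =
           complex_measure_integral circle_borel (\<lambda>A. cinner (blinfun_apply (\<mu> A) x) y)
             (\<lambda>\<zeta>. complex_of_real ((1 - (cmod z)\<^sup>2) / (cmod (z - \<zeta>))\<^sup>2))))"

section \<open>Holomorphic functions on the unit disc\<close>

text \<open>
  Functions on the disc are represented by total functions whose values outside the open unit ball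
  are irrelevant.
\<close>

definition has_complex_derivative_at ::
    "(complex \<Rightarrow> 'e::complex_inner_space) \<Rightarrow> 'e \<Rightarrow> complex \<Rightarrow> bool" where
  "has_complex_derivative_at f v z \<longleftrightarrow> (f has_derivative (\<lambda>h. h *\<^sub>C v)) (at z)"

definition complex_derivative ::
    "(complex \<Rightarrow> 'e::complex_inner_space) \<Rightarrow> complex \<Rightarrow> 'e" where
  "complex_derivative f z = (THE v. has_complex_derivative_at f v z)"

definition holomorphic_on_disc :: "(complex \<Rightarrow> 'e::complex_inner_space) \<Rightarrow> bool" where
  "holomorphic_on_disc f \<longleftrightarrow> (\<forall>z\<in>ball 0 1. \<exists>v. has_complex_derivative_at f v z)"

definition disc_area :: "complex measure" where
  "disc_area = scale_measure (ennreal (1 / pi)) (restrict_space lborel (ball 0 1))"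

section \<open>The function spaces\<close>

text \<open>
  For semi-spectral \<open>\<mu>\<close> the form below is real and nonnegative, so that taking real parts and
  passing to \<open>ennreal\<close> loses nothing.
\<close>

definition weighted_dirichlet ::
    "(complex set \<Rightarrow> ('e::complex_inner_space \<Rightarrow>\<^sub>L 'e)) \<Rightarrow> nat \<Rightarrow> (complex \<Rightarrow> 'e) \<Rightarrow> ennreal" where
  "weighted_dirichlet \<mu> n f =
     ennreal (1 / (fact n * fact (n - 1))) *
     (\<integral>\<^sup>+z. ennreal
        (Re (cinner (blinfun_apply (poisson_integral \<mu> z) ((complex_derivative ^^ n) f z))
                    ((complex_derivative ^^ n) f z))
         * (1 - (cmod z)\<^sup>2) ^ (n - 1)) \<partial>disc_area)"

definition dirichlet_space ::
    "(complex set \<Rightarrow> ('e::complex_inner_space \<Rightarrow>\<^sub>L 'e)) \<Rightarrow> nat \<Rightarrow> (complex \<Rightarrow> 'e) set" where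
  "dirichlet_space \<mu> n = {f. holomorphic_on_disc f \<and> weighted_dirichlet \<mu> n f < \<infinity>}"

definition has_power_series :: "(complex \<Rightarrow> 'e::complex_inner_space) \<Rightarrow> (nat \<Rightarrow> 'e) \<Rightarrow> bool" where
  "has_power_series f a \<longleftrightarrow> (\<forall>z\<in>ball 0 1. (\<lambda>j. z ^ j *\<^sub>C a j) sums f z)"

definition hardy_space :: "(complex \<Rightarrow> 'e::complex_inner_space) set" where
  "hardy_space = {f. \<exists>a. has_power_series f a \<and> summable (\<lambda>j. (norm (a j))\<^sup>2)}"

definition hardy_norm_sq :: "(complex \<Rightarrow> 'e::complex_inner_space) \<Rightarrow> real" where
  "hardy_norm_sq f = (\<Sum>j. (norm ((THE a. has_power_series f a) j))\<^sup>2)"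

text \<open>The tuple \<open>(\<mu>\<^sub>1, \<dots>, \<mu>\<^sub>m\<^sub>-\<^sub>1)\<close> is a family of which only the indices \<open>1, \<dots>, m - 1\<close> are used.\<close>

definition H_space ::
    "nat \<Rightarrow> (nat \<Rightarrow> complex set \<Rightarrow> ('e::complex_inner_space \<Rightarrow>\<^sub>L 'e)) \<Rightarrow> (complex \<Rightarrow> 'e) set" where
  "H_space m \<mu> = (\<Inter>j\<in>{1..m - 1}. dirichlet_space (\<mu> j) j) \<inter> hardy_space"

text \<open>Meaningful only on \<open>H_space m \<mu>\<close>, since \<open>enn2real \<infinity> = 0\<close>.\<close>

definition H_norm ::
    "nat \<Rightarrow> (nat \<Rightarrow> complex set \<Rightarrow> ('e::complex_inner_space \<Rightarrow>\<^sub>L 'e)) \<Rightarrow> (complex \<Rightarrow> 'e) \<Rightarrow> real" where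
  "H_norm m \<mu> f =
     sqrt (hardy_norm_sq f + (\<Sum>j = 1..m - 1. enn2real (weighted_dirichlet (\<mu> j) j f)))"

definition dilation :: "real \<Rightarrow> (complex \<Rightarrow> 'e) \<Rightarrow> complex \<Rightarrow> 'e" where
  "dilation r f z = f (complex_of_real r * z)"

definition vector_polynomials :: "(complex \<Rightarrow> 'e::complex_inner_space) set" where
  "vector_polynomials = {p. \<exists>N a. p = (\<lambda>z. \<Sum>k\<le>N. z ^ k *\<^sub>C a k)}"

end

theory Submission
  imports Defs "HOL-Complex_Analysis.Cauchy_Integral_Formula"
begin

text \<open>
  Fix \<open>n\<close> and write \<open>q\<^sub>z(x) = \<langle>P\<^sub>\<mu>(z)x, x\<rangle>\<close>, which is the classical Poisson integral of the positive scalar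
  measure \<open>\<mu>\<^sub>x\<^sub>,\<^sub>x\<close>. Everything rests on one inequality, which compares a function with its dilation
  under a harmonic weight: for holomorphic \<open>h\<close>, \<open>r = \<rho>\<^sup>2 < 1\<close> and a nonnegative radial weight \<open>\<omega>\<close>,
  \<open>\<integral> q\<^sub>z(h(rz)) \<omega>(z) dA \<le> \<integral> q\<^sub>\<rho>\<^sub>z(h(\<rho>z)) \<omega>(z) dA\<close> (\<open>dilation_inequality\<close>).
  A pointwise comparison of \<open>P\<^sub>\<mu>(z)\<close> with \<open>P\<^sub>\<mu>(rz)\<close> is too weak when \<open>n = 1\<close>. Instead, both dilations
  are written as averages over rotations \<open>\<xi>\<close> of the circle against the Poisson kernel of radius \<open>\<rho>\<close>:
  since \<open>q\<^sub>z\<close> is a positive quadratic form, \<open>q\<^sub>z \<circ> h\<close> is subharmonic, so that \<open>q\<^sub>z(h(rz))\<close> is at most the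
  average of \<open>q\<^sub>z(h(\<rho>\<xi>z))\<close> (\<open>qform_subharmonic\<close>). Rotating the plane by the conjugate of \<open>\<xi>\<close> moves the
  average from \<open>h\<close> to the weight, and the average of the harmonic function \<open>z \<mapsto> q\<^sub>z(x)\<close> over rotations
  is \<open>q\<^sub>\<rho>\<^sub>z(x)\<close> (\<open>qform_poisson_average\<close>). Thus half of the dilation is handed from \<open>h\<close> to \<open>P\<^sub>\<mu>\<close>.

  The inequality has two consequences. The substitution \<open>w = \<rho>z\<close>, together with the monotonicity of
  \<open>(1 - |z|\<^sup>2)\<^sup>n\<^sup>-\<^sup>1\<close>, gives \<open>D\<^sub>\<mu>\<^sub>,\<^sub>n(f\<^sub>r) \<le> r\<^sup>2\<^sup>n\<^sup>-\<^sup>1 D\<^sub>\<mu>\<^sub>,\<^sub>n(f) \<le> D\<^sub>\<mu>\<^sub>,\<^sub>n(f)\<close> for \<open>n \<ge> 1\<close>. As \<open>P\<^sub>\<mu>(\<rho>z)\<close> is bounded in norm,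
  \<open>D\<^sub>\<mu>\<^sub>,\<^sub>n(f\<^sub>r)\<close> is also controlled by the maximum of the \<open>n\<close>-th derivative of \<open>f\<close> on the disc of radius \<open>\<rho>\<close>.

  The first consequence yields convergence of the dilations: the \<open>n\<close>-th derivatives of \<open>f\<^sub>r\<close> converge
  pointwise and their energies do not exceed that of \<open>f\<close>, so the parallelogram identity and Fatou's
  lemma force the energy of the difference to \<open>0\<close> (\<open>energy_tendsto_0\<close>). In \<open>H\<^sup>2\<close> the convergence
  is read off from the Taylor coefficients. The second consequence yields density: the dilated Taylor
  polynomials of \<open>f\<close> are polynomials, and they converge to \<open>f\<^sub>r\<close> because the derivatives of the Taylor
  remainders tend to \<open>0\<close> uniformly on smaller discs.

  Every function of the space lies in \<open>H\<^sup>2\<close>, hence is the sum of its power series on the disc, and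
  its derivatives are obtained termwise.
\<close>

section \<open>Complex inner product spaces\<close>

lemma scaleC_zero_left [simp]: "0 *\<^sub>C x = (0::'e::complex_inner_space)"
  using scaleC_of_real[of 0 x] by simp

lemma scaleC_one [simp]: "1 *\<^sub>C x = (x::'e::complex_inner_space)"
  using scaleC_of_real[of 1 x] by simp

lemma scaleC_scaleR: "c *\<^sub>C (r *\<^sub>R x) = r *\<^sub>R (c *\<^sub>C (x::'e::complex_inner_space))"
  by (metis scaleC_of_real scaleC_scaleC mult.commute)

lemma scaleR_scaleC: "(r *\<^sub>R c) *\<^sub>C x = r *\<^sub>R (c *\<^sub>C (x::'e::complex_inner_space))"
  by (metis scaleC_of_real scaleC_scaleC scaleR_conv_of_real)

lemma cinner_self: "cinner x x = of_real ((norm (x::'e::complex_inner_space))\<^sup>2)"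
proof -
  have "cinner x x = of_real (Re (cinner x x))"
    using cinner_commute[of x x] by (simp add: complex_eq_iff)
  then show ?thesis by (simp add: Re_cinner power2_norm_eq_inner)
qed

lemma cinner_scaleC_right: "cinner x (c *\<^sub>C y) = cnj c * cinner x (y::'e::complex_inner_space)"
  by (metis cinner_commute cinner_scaleC_left complex_cnj_mult)

lemma cinner_add_right: "cinner x (y + z) = cinner x y + cinner x (z::'e::complex_inner_space)"
  by (metis cinner_commute cinner_add_left complex_cnj_add)

lemma norm_scaleC [simp]: "norm (c *\<^sub>C x) = cmod c * norm (x::'e::complex_inner_space)"
proof -
  have "complex_of_real ((norm (c *\<^sub>C x))\<^sup>2) = of_real ((cmod c * norm x)\<^sup>2)"
    unfolding cinner_self[symmetric] cinner_scaleC_left cinner_scaleC_right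
    by (simp add: cinner_self power_mult_distrib complex_norm_square mult.commute[of "cnj c"])
      (simp add: complex_norm_square[symmetric])
  then have "(norm (c *\<^sub>C x))\<^sup>2 = (cmod c * norm x)\<^sup>2" by (simp only: of_real_eq_iff)
  then show ?thesis by (simp add: power2_eq_iff_nonneg)
qed

lemma bounded_bilinear_scaleC: "bounded_bilinear ((*\<^sub>C) :: complex \<Rightarrow> 'e::complex_inner_space \<Rightarrow> 'e)"
  by standard
    (auto simp: scaleC_add_left scaleC_add_right scaleC_scaleR scaleR_scaleC intro!: exI[of _ 1])

lemma Im_cinner: "Im (cinner x y) = inner ((- \<i>) *\<^sub>C x) (y::'e::complex_inner_space)"
  by (simp add: Re_cinner[symmetric] cinner_scaleC_left)

text \<open>
  The imaginary part of the complex inner product is again a real inner product, so continuity and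
  boundedness of \<^const>\<open>cinner\<close> reduce to the real case.
\<close>

lemma cinner_eq: "cinner x y = of_real (inner x y) + \<i> * of_real (inner ((- \<i>) *\<^sub>C x) (y::'e::complex_inner_space))"
  by (simp add: complex_eq_iff Im_cinner[symmetric] Re_cinner)

lemma cmod_cinner_le: "cmod (cinner x y) \<le> 2 * norm x * norm (y::'e::complex_inner_space)"
proof -
  have "cmod (cinner x y) \<le> \<bar>inner x y\<bar> + \<bar>inner ((- \<i>) *\<^sub>C x) y\<bar>"
    unfolding cinner_eq by (rule order_trans[OF norm_triangle_ineq]) (simp add: norm_mult)
  also have "\<dots> \<le> norm x * norm y + norm ((- \<i>) *\<^sub>C x) * norm y"
    by (intro add_mono Cauchy_Schwarz_ineq2)
  finally show ?thesis by simp
qed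

lemma bounded_bilinear_cinner: "bounded_bilinear (cinner :: 'e::complex_inner_space \<Rightarrow> 'e \<Rightarrow> complex)"
proof
  show "cinner (r *\<^sub>R a) b = r *\<^sub>R cinner a b" for r and a b :: 'e
    by (metis cinner_scaleC_left scaleC_of_real scaleR_conv_of_real)
  show "cinner a (r *\<^sub>R b) = r *\<^sub>R cinner a b" for r and a b :: 'e
    by (metis cinner_scaleC_right scaleC_of_real scaleR_conv_of_real complex_cnj_complex_of_real)
  show "\<exists>K. \<forall>a b. norm (cinner a b) \<le> norm a * norm (b::'e) * K"
    using cmod_cinner_le by (intro exI[of _ 2]) (auto simp: mult_ac)
qed (auto simp: cinner_add_left cinner_add_right)

interpretation scaleC: bounded_bilinear "(*\<^sub>C) :: complex \<Rightarrow> 'e::complex_inner_space \<Rightarrow> 'e"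
  by (rule bounded_bilinear_scaleC)

interpretation cinner: bounded_bilinear "cinner :: 'e::complex_inner_space \<Rightarrow> 'e \<Rightarrow> complex"
  by (rule bounded_bilinear_cinner)

lemma cinner_eqI: 
  assumes "\<And>y. cinner a y = cinner b (y::'e::complex_inner_space)" shows "a = b"
proof -
  have "cinner (a - b) (a - b) = 0" by (simp add: cinner.diff_left assms)
  then show ?thesis by (simp add: cinner_self)
qed

section \<open>Quadratic forms of operators\<close>

definition qform :: "('e::complex_inner_space \<Rightarrow>\<^sub>L 'e) \<Rightarrow> 'e \<Rightarrow> real" where
  "qform T x = Re (cinner (blinfun_apply T x) x)"

definition hermitian :: "('e::complex_inner_space \<Rightarrow>\<^sub>L 'e) \<Rightarrow> bool" where
  "hermitian T \<longleftrightarrow> complex_linear T \<and> (\<forall>x. cinner (blinfun_apply T x) x \<in> \<real>)"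

lemma positive_imp_hermitian: "positive_operator T \<Longrightarrow> hermitian T"
  by (auto simp: positive_operator_def hermitian_def nonneg_Reals_subset_Reals[THEN subsetD])

lemma qform_nonneg: "positive_operator T \<Longrightarrow> 0 \<le> qform T x"
  by (auto simp: positive_operator_def qform_def complex_nonneg_Reals_iff)

lemma hermitian_cinner: "hermitian T \<Longrightarrow> cinner (blinfun_apply T x) x = of_real (qform T x)"
  by (auto simp: hermitian_def qform_def complex_is_Real_iff complex_eq_iff)

lemma positive_operatorI:
  "hermitian T \<Longrightarrow> (\<And>x. 0 \<le> qform T x) \<Longrightarrow> positive_operator T"
  by (auto simp: positive_operator_def hermitian_cinner) (simp add: hermitian_def)

text \<open>
  Expanding the real number \<open>\<langle>T(x + iy), x + iy\<rangle>\<close>: real values on the diagonal already force symmetry,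
  because the scalars are complex.
\<close>

lemma hermitian_symmetric:
  assumes "hermitian T"
  shows "Re (cinner (blinfun_apply T x) y) = Re (cinner (blinfun_apply T y) x)"
proof -
  let ?B = "\<lambda>x y. cinner (blinfun_apply T x) y"
  have lin: "blinfun_apply T (c *\<^sub>C u) = c *\<^sub>C blinfun_apply T u" for c u
    using assms by (auto simp: hermitian_def complex_linear_def)
  have real: "Im (?B u u) = 0" for u
    using assms by (auto simp: hermitian_def complex_is_Real_iff)
  have "?B (x + \<i> *\<^sub>C y) (x + \<i> *\<^sub>C y) = ?B x x + ?B y y + (- \<i> * ?B x y + \<i> * ?B y x)"
    by (simp add: blinfun.add_right lin cinner_add_left cinner_add_right cinner_scaleC_left
        cinner_scaleC_right algebra_simps)
  then show ?thesis using real[of x] real[of y] real[of "x + \<i> *\<^sub>C y"] by simp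
qed

lemma qform_add:
  assumes "hermitian T"
  shows "qform T (x + y) = qform T x + qform T y + 2 * Re (cinner (blinfun_apply T x) y)"
  using hermitian_symmetric[OF assms, of x y]
  by (simp add: qform_def blinfun.add_right cinner_add_left cinner_add_right)

lemma qform_minus: "qform T (- x) = qform T x"
  by (simp add: qform_def blinfun.minus_right cinner.minus_left cinner.minus_right)

lemma qform_diff:
  assumes "hermitian T"
  shows "qform T (x - y) = qform T x + qform T y - 2 * Re (cinner (blinfun_apply T x) y)"
  using qform_add[OF assms, of x "- y"] by (simp add: qform_minus cinner.minus_right)

lemma qform_parallelogram:
  assumes "hermitian T"
  shows "qform T (x + y) + qform T (x - y) = 2 * qform T x + 2 * qform T y"
  using assms by (simp add: qform_add qform_diff)

lemma qform_scaleR: "qform T (r *\<^sub>R x) = r\<^sup>2 * qform T x"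
  by (simp add: qform_def blinfun.scaleR_right cinner.scaleR_left cinner.scaleR_right power2_eq_square)

text \<open>
  A positive quadratic form lies above its tangent at \<open>x\<close>. Since the tangent is linear in \<open>y\<close>, this
  turns averages of holomorphic functions into lower bounds for averages of the form.
\<close>

lemma qform_ge_tangent:
  assumes "positive_operator T"
  shows "2 * Re (cinner (blinfun_apply T y) x) - qform T x \<le> qform T y"
  using qform_diff[OF positive_imp_hermitian[OF assms], of y x] qform_nonneg[OF assms, of "y - x"]
  by simp

lemma qform_diff_left: "qform (S - T) x = qform S x - qform T x"
  by (simp add: qform_def blinfun.diff_left cinner.diff_left)

lemma qform_scaleR_left: "qform (r *\<^sub>R T) x = r * qform T x"
  by (simp add: qform_def blinfun.scaleR_left cinner.scaleR_left)

lemma qform_le_norm: "\<bar>qform T x\<bar> \<le> norm T * (norm x)\<^sup>2"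
proof -
  have "\<bar>qform T x\<bar> \<le> norm (blinfun_apply T x) * norm x"
    unfolding qform_def Re_cinner by (rule Cauchy_Schwarz_ineq2)
  also have "\<dots> \<le> (norm T * norm x) * norm x"
    by (intro mult_right_mono norm_blinfun) auto
  finally show ?thesis by (simp add: power2_eq_square mult_ac)
qed

lemma hermitian_0: "hermitian 0"
  by (simp add: hermitian_def complex_linear_def scaleC.zero_right cinner.zero_left)

lemma hermitian_add: "hermitian S \<Longrightarrow> hermitian T \<Longrightarrow> hermitian (S + T)"
  by (simp add: hermitian_def complex_linear_def blinfun.add_left scaleC_add_right cinner_add_left)

lemma hermitian_diff: "hermitian S \<Longrightarrow> hermitian T \<Longrightarrow> hermitian (S - T)"
  by (simp add: hermitian_def complex_linear_def blinfun.diff_left scaleC.diff_right cinner.diff_left)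

lemma hermitian_scaleR: "hermitian S \<Longrightarrow> hermitian (r *\<^sub>R S)"
  by (simp add: hermitian_def complex_linear_def blinfun.scaleR_left scaleC_scaleR cinner.scaleR_left
      scaleR_conv_of_real)

lemma hermitian_sum: "(\<And>i. i \<in> I \<Longrightarrow> hermitian (S i)) \<Longrightarrow> hermitian (sum S I)"
  by (induction I rule: infinite_finite_induct) (auto intro: hermitian_0 hermitian_add)

lemma qform_sum: "qform (sum S I) x = (\<Sum>i\<in>I. qform (S i) x)"
  by (simp add: qform_def blinfun.sum_left cinner.sum_left)

text \<open>
  The norm of a Hermitian operator is at most its numerical radius: polarize, and test against the multiple
  of \<open>Sx\<close> that has the length of \<open>x\<close>. All estimates on Poisson integrals are made on the diagonal and
  become norm estimates in this way.
\<close>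

lemma hermitian_norm_le:
  assumes "hermitian S" "\<And>x. \<bar>qform S x\<bar> \<le> e * (norm x)\<^sup>2" "0 \<le> e"
  shows "norm S \<le> e"
proof (rule norm_blinfun_bound[OF \<open>0 \<le> e\<close>])
  fix x
  have polar: "2 * Re (cinner (blinfun_apply S u) v) \<le> e * ((norm u)\<^sup>2 + (norm v)\<^sup>2)" for u v
  proof -
    have "4 * Re (cinner (blinfun_apply S u) v) = qform S (u + v) - qform S (u - v)"
      using assms(1) by (simp add: qform_add qform_diff)
    also have "\<dots> \<le> e * (norm (u + v))\<^sup>2 + e * (norm (u - v))\<^sup>2"
      using assms(2)[of "u + v"] assms(2)[of "u - v"] by linarith
    also have "\<dots> = e * (2 * ((norm u)\<^sup>2 + (norm v)\<^sup>2))"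
      by (simp add: power2_norm_eq_inner inner_add_left inner_add_right
          inner_diff_left inner_diff_right algebra_simps)
    finally show ?thesis by (simp add: algebra_simps)
  qed
  show "norm (blinfun_apply S x) \<le> e * norm x"
  proof (cases "x = 0 \<or> blinfun_apply S x = 0")
    case True then show ?thesis using \<open>0 \<le> e\<close> by auto
  next
    case False
    define y where "y = (norm x / norm (blinfun_apply S x)) *\<^sub>R blinfun_apply S x"
    have ny: "norm y = norm x" using False by (simp add: y_def)
    have "Re (cinner (blinfun_apply S x) y) = norm x * norm (blinfun_apply S x)"
      using False by (simp add: y_def cinner.scaleR_right Re_cinner power2_norm_eq_inner[symmetric]
          power2_eq_square)
    then have "norm x * norm (blinfun_apply S x) \<le> norm x * (e * norm x)"
      using polar[of x y] ny by (simp add: power2_eq_square mult.left_commute)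
    then show ?thesis using False by simp
  qed
qed

text \<open>
  Halving the vectors absorbs the usual factor \<open>1/4\<close>, so that the real and imaginary parts of
  \<open>\<langle>\<mu>(\<cdot>)x, y\<rangle>\<close> become plain differences of two of the positive measures \<open>\<langle>\<mu>(\<cdot>)v, v\<rangle>\<close>.
\<close>

lemma hermitian_cinner_polarization:
  assumes "hermitian T"
  shows "cinner (blinfun_apply T x) y =
    of_real (qform T ((1/2) *\<^sub>R (x + y)) - qform T ((1/2) *\<^sub>R (x - y))) +
    \<i> * of_real (qform T ((1/2) *\<^sub>R (x + \<i> *\<^sub>C y)) - qform T ((1/2) *\<^sub>R (x - \<i> *\<^sub>C y)))"
proof -
  have "Re (cinner (blinfun_apply T x) y) =
      qform T ((1/2) *\<^sub>R (x + y)) - qform T ((1/2) *\<^sub>R (x - y))" for y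
    unfolding qform_scaleR by (simp add: assms qform_add qform_diff power2_eq_square field_simps)
  from this[of y] this[of "\<i> *\<^sub>C y"] show ?thesis
    by (simp add: complex_eq_iff cinner_scaleC_right)
qed

section \<open>Integration against a difference of finite measures\<close>

lemma nn_integral_add_measure_eq:
  assumes sets: "sets B = sets A" "sets C = sets A" "sets D = sets A"
    and eq: "\<And>E. E \<in> sets A \<Longrightarrow> emeasure A E + emeasure B E = emeasure C E + emeasure D E"
    and f: "f \<in> borel_measurable A"
  shows "(\<integral>\<^sup>+x. f x \<partial>A) + (\<integral>\<^sup>+x. f x \<partial>B) = (\<integral>\<^sup>+x. f x \<partial>C) + (\<integral>\<^sup>+x. f x \<partial>D)"
  using f
proof (induction rule: borel_measurable_induct)
  case (cong f g)
  have "space B = space A" "space C = space A" "space D = space A"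
    using sets by (auto dest: sets_eq_imp_space_eq)
  then have "(\<integral>\<^sup>+x. f x \<partial>M) = (\<integral>\<^sup>+x. g x \<partial>M)" if "M \<in> {A, B, C, D}" for M
    using that cong(3) by (intro nn_integral_cong) auto
  then show ?case using cong(4) by simp
next
  case (set E)
  then show ?case using eq[OF set] by (simp add: sets)
next
  case (mult u c)
  have "u \<in> borel_measurable B" "u \<in> borel_measurable C" "u \<in> borel_measurable D"
    using mult(2) by (simp_all add: measurable_cong_sets[OF sets(1) refl] measurable_cong_sets[OF sets(2) refl]
        measurable_cong_sets[OF sets(3) refl])
  then show ?case using mult(2,4) by (simp add: nn_integral_cmult distrib_left[symmetric])
next
  case (add u v)
  have m: "w \<in> borel_measurable B" "w \<in> borel_measurable C" "w \<in> borel_measurable D"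
    if "w \<in> borel_measurable A" for w :: "'a \<Rightarrow> ennreal"
    using that by (simp_all add: measurable_cong_sets[OF sets(1) refl] measurable_cong_sets[OF sets(2) refl]
        measurable_cong_sets[OF sets(3) refl])
  have uv: "u \<in> borel_measurable A" "v \<in> borel_measurable A"
    and IH: "(\<integral>\<^sup>+x. u x \<partial>A) + (\<integral>\<^sup>+x. u x \<partial>B) = (\<integral>\<^sup>+x. u x \<partial>C) + (\<integral>\<^sup>+x. u x \<partial>D)"
      "(\<integral>\<^sup>+x. v x \<partial>A) + (\<integral>\<^sup>+x. v x \<partial>B) = (\<integral>\<^sup>+x. v x \<partial>C) + (\<integral>\<^sup>+x. v x \<partial>D)"
    using add by blast+
  have split: "(\<integral>\<^sup>+x. v x + u x \<partial>K) + (\<integral>\<^sup>+x. v x + u x \<partial>K') =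
      ((\<integral>\<^sup>+x. v x \<partial>K) + (\<integral>\<^sup>+x. v x \<partial>K')) + ((\<integral>\<^sup>+x. u x \<partial>K) + (\<integral>\<^sup>+x. u x \<partial>K'))"
    if "K \<in> {A, B, C, D}" "K' \<in> {A, B, C, D}" for K K'
    using that uv m[OF uv(1)] m[OF uv(2)] by (auto simp: nn_integral_add ac_simps)
  show ?case by (simp only: split IH insert_iff simp_thms)
next
  case (seq U)
  have m: "U i \<in> borel_measurable B" "U i \<in> borel_measurable C" "U i \<in> borel_measurable D" for i
    using seq(1)[of i] by (simp_all add: measurable_cong_sets[OF sets(1) refl] measurable_cong_sets[OF sets(2) refl]
        measurable_cong_sets[OF sets(3) refl])
  have inc: "incseq (\<lambda>i. \<integral>\<^sup>+x. U i x \<partial>M)" for M :: "'a measure"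
    using seq(3) by (intro incseq_SucI nn_integral_mono) (auto simp: incseq_Suc_iff le_fun_def)
  have SUP: "(\<integral>\<^sup>+x. (SUP i. U i x) \<partial>M) = (SUP i. \<integral>\<^sup>+x. U i x \<partial>M)"
    if "\<And>i. U i \<in> borel_measurable M" for M
    using seq(3) that by (rule nn_integral_monotone_convergence_SUP)
  have eq: "(Sup (range U)) = (\<lambda>x. SUP i. U i x)" by (auto simp: image_comp)
  have IH: "(\<integral>\<^sup>+x. U i x \<partial>A) + (\<integral>\<^sup>+x. U i x \<partial>B) = (\<integral>\<^sup>+x. U i x \<partial>C) + (\<integral>\<^sup>+x. U i x \<partial>D)" for i
    using seq by blast
  show ?case
    unfolding eq by (simp add: SUP seq(1) m ennreal_SUP_add[symmetric] inc IH)
qed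

text \<open>
  On a Hahn decomposition \<open>Y\<close> for \<open>M - N\<close>, the supremum defining the positive variation on \<open>E\<close> is
  attained at \<open>E \<inter> Y\<close>.
\<close>

lemma positive_variation_diff:
  fixes M N L :: "'a measure"
  assumes fin: "finite_measure M" "finite_measure N" and sM: "sets M = sets L" and sN: "sets N = sets L"
    and Y: "Y \<in> sets L"
    and pos: "\<And>X. X \<in> sets L \<Longrightarrow> X \<subseteq> Y \<Longrightarrow> measure N X \<le> measure M X"
    and neg: "\<And>X. X \<in> sets L \<Longrightarrow> X \<inter> Y = {} \<Longrightarrow> measure M X \<le> measure N X"
    and \<nu>: "\<And>A. A \<in> sets L \<Longrightarrow> \<nu> A = measure M A - measure N A"
    and E: "E \<in> sets L"
  shows "emeasure (positive_variation L \<nu>) E = ennreal (measure M (E \<inter> Y) - measure N (E \<inter> Y))"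
proof -
  interpret M: finite_measure M by fact
  interpret N: finite_measure N by fact
  define F where "F E = ennreal (measure M (E \<inter> Y) - measure N (E \<inter> Y))" for E
  have F: "(SUP B\<in>{B \<in> sets L. B \<subseteq> E}. ennreal (\<nu> B)) = F E" if E: "E \<in> sets L" for E
  proof (intro antisym SUP_least)
    fix B assume "B \<in> {B \<in> sets L. B \<subseteq> E}"
    then have B: "B \<in> sets L" "B \<subseteq> E" by auto
    have split: "measure K C = measure K (C \<inter> Y) + measure K (C - Y)"
      if "finite_measure K" "sets K = sets L" "C \<in> sets L" for K C
      using finite_measure.finite_measure_Union[OF that(1), of "C \<inter> Y" "C - Y"] that Y
      by (simp add: Int_Diff_disjoint Int_Diff_Un)
    have "measure M (B - Y) \<le> measure N (B - Y)" using B Y by (intro neg) auto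
    moreover have "measure N (E \<inter> Y - B) \<le> measure M (E \<inter> Y - B)" using E B Y by (intro pos) auto
    moreover have "measure K (E \<inter> Y) = measure K (B \<inter> Y) + measure K (E \<inter> Y - B)"
      if "finite_measure K" "sets K = sets L" for K
    proof -
      have "E \<inter> Y = (B \<inter> Y) \<union> (E \<inter> Y - B)" using B by auto
      then show ?thesis
        using finite_measure.finite_measure_Union[OF that(1), of "B \<inter> Y" "E \<inter> Y - B"] that Y E B by auto
    qed
    ultimately have "\<nu> B \<le> measure M (E \<inter> Y) - measure N (E \<inter> Y)"
      unfolding \<nu>[OF B(1)] using split[OF fin(1) sM B(1)] split[OF fin(2) sN B(1)] fin sM sN by fastforce
    then show "ennreal (\<nu> B) \<le> F E" unfolding F_def by (rule ennreal_leI)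
  next
    have "F E = ennreal (\<nu> (E \<inter> Y))" unfolding F_def using E Y by (simp add: \<nu>)
    also have "\<dots> \<le> (SUP B\<in>{B \<in> sets L. B \<subseteq> E}. ennreal (\<nu> B))"
      using E Y by (intro SUP_upper) auto
    finally show "F E \<le> \<dots>" .
  qed
  have "positive_variation L \<nu> = measure_of (space L) (sets L) F"
    unfolding positive_variation_def
    by (rule measure_of_eq) (auto simp: sets.space_closed F sets.sigma_sets_eq)
  moreover have "emeasure (measure_of (space L) (sets L) F) E = F E"
  proof (rule emeasure_measure_of_sigma[OF sets.sigma_algebra_axioms _ _ E])
    show "positive (sets L) F" by (simp add: positive_def F_def)
    show "countably_additive (sets L) F"
    proof (rule countably_additiveI)
      fix A :: "nat \<Rightarrow> 'a set"
      assume A: "range A \<subseteq> sets L" "disjoint_family A"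
      have A': "range (\<lambda>i. A i \<inter> Y) \<subseteq> sets L" "disjoint_family (\<lambda>i. A i \<inter> Y)"
        using A Y by (auto simp: disjoint_family_on_def)
      have "(\<lambda>i. measure M (A i \<inter> Y) - measure N (A i \<inter> Y)) sums
          (measure M (\<Union>i. A i \<inter> Y) - measure N (\<Union>i. A i \<inter> Y))"
        using A' by (intro sums_diff M.finite_measure_UNION N.finite_measure_UNION) (simp_all add: sM sN)
      then have "(\<Sum>i. F (A i)) = ennreal (measure M (\<Union>i. A i \<inter> Y) - measure N (\<Union>i. A i \<inter> Y))"
        unfolding F_def using A' by (intro suminf_ennreal_eq) (auto intro!: pos)
      then show "(\<Sum>i. F (A i)) = F (\<Union> (range A))" by (simp add: F_def)
    qed
  qed
  ultimately show ?thesis by (simp add: F_def)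
qed

lemma sets_positive_variation [simp]: "sets (positive_variation L \<nu>) = sets L"
  by (simp add: positive_variation_def sets_measure_of[OF sets.space_closed] sets.sigma_sets_eq)

lemma nn_integral_eq_integral_bounded:
  fixes g :: "'a \<Rightarrow> real"
  assumes "finite_measure M" "g \<in> borel_measurable M" "\<And>x. x \<in> space M \<Longrightarrow> 0 \<le> g x"
    "\<And>x. x \<in> space M \<Longrightarrow> g x \<le> G"
  shows "(\<integral>\<^sup>+x. ennreal (g x) \<partial>M) = ennreal (\<integral>x. g x \<partial>M)" "integrable M g"
proof -
  show "integrable M g"
    using assms by (intro finite_measure.integrable_const_bound[where B = G]) auto
  then show "(\<integral>\<^sup>+x. ennreal (g x) \<partial>M) = ennreal (\<integral>x. g x \<partial>M)"
    using assms by (intro nn_integral_eq_integral) auto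
qed

text \<open>
  The Jordan decomposition cancels against the given one: \<open>\<nu>\<^sup>+ + N = M + \<nu>\<^sup>-\<close> as measures, so the integrals
  agree as well. Boundedness keeps all four of them finite.
\<close>

lemma signed_integral_diff:
  fixes g :: "'a \<Rightarrow> real"
  assumes fin: "finite_measure M" "finite_measure N" and sM: "sets M = sets L" and sN: "sets N = sets L"
    and \<nu>: "\<And>A. A \<in> sets L \<Longrightarrow> \<nu> A = measure M A - measure N A"
    and g: "g \<in> borel_measurable L" "\<And>x. x \<in> space L \<Longrightarrow> 0 \<le> g x" "\<And>x. x \<in> space L \<Longrightarrow> g x \<le> G"
  shows "signed_integral L \<nu> (\<lambda>x. complex_of_real (g x)) = of_real ((\<integral>x. g x \<partial>M) - (\<integral>x. g x \<partial>N))"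
proof -
  interpret M: finite_measure M by fact
  interpret N: finite_measure N by fact
  have "sets N = sets M" using sM sN by simp
  from finite_unsigned_Hahn_decomposition[OF fin this] obtain Y where Y: "Y \<in> sets L"
    and pos': "\<forall>X\<in>sets L. X \<subseteq> Y \<longrightarrow> emeasure N X \<le> emeasure M X"
    and neg': "\<forall>X\<in>sets L. X \<inter> Y = {} \<longrightarrow> emeasure M X \<le> emeasure N X"
    unfolding sM by blast
  have pos: "measure N X \<le> measure M X" if "X \<in> sets L" "X \<subseteq> Y" for X
    using pos'[rule_format, OF that] by (simp add: M.emeasure_eq_measure N.emeasure_eq_measure)
  have neg: "measure M X \<le> measure N X" if "X \<in> sets L" "X \<inter> Y = {}" for X
    using neg'[rule_format, OF that] by (simp add: M.emeasure_eq_measure N.emeasure_eq_measure)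
  let ?V = "positive_variation L \<nu>" and ?W = "positive_variation L (\<lambda>A. - \<nu> A)"
  let ?Z = "space L - Y"
  have V: "emeasure ?V E = ennreal (measure M (E \<inter> Y) - measure N (E \<inter> Y))" if "E \<in> sets L" for E
    by (rule positive_variation_diff[OF fin sM sN Y]) (simp_all add: pos neg \<nu> that)
  have W: "emeasure ?W E = ennreal (measure N (E \<inter> ?Z) - measure M (E \<inter> ?Z))" if "E \<in> sets L" for E
  proof (rule positive_variation_diff[OF fin(2,1) sN sM])
    fix X assume "X \<in> sets L"
    then show "X \<subseteq> space L - Y \<Longrightarrow> measure M X \<le> measure N X"
      "X \<inter> (space L - Y) = {} \<Longrightarrow> measure N X \<le> measure M X"
      using sets.sets_into_space[of X L] by (auto intro!: pos neg)
  qed (use Y that \<nu> in auto)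
  have sp: "space ?V = space L" "space ?W = space L" "space M = space L" "space N = space L"
    using sets_eq_imp_space_eq[OF sM] sets_eq_imp_space_eq[OF sN]
      sets_eq_imp_space_eq[OF sets_positive_variation[of L \<nu>]]
      sets_eq_imp_space_eq[OF sets_positive_variation[of L "\<lambda>A. - \<nu> A"]] by auto
  have fV: "finite_measure ?V" using V[OF sets.top] by (intro finite_measureI) (simp add: sp)
  have fW: "finite_measure ?W" using W[OF sets.top] by (intro finite_measureI) (simp add: sp)
  have eq: "emeasure ?V E + emeasure N E = emeasure M E + emeasure ?W E" if E: "E \<in> sets L" for E
  proof -
    have split: "measure K E = measure K (E \<inter> Y) + measure K (E \<inter> ?Z)"
      if "finite_measure K" "sets K = sets L" for K
    proof -
      have "E = (E \<inter> Y) \<union> (E \<inter> ?Z)" using sets.sets_into_space[OF E] by auto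
      then show ?thesis
        using finite_measure.finite_measure_Union[OF that(1), of "E \<inter> Y" "E \<inter> ?Z"] that Y E by auto
    qed
    have le: "measure N (E \<inter> Y) \<le> measure M (E \<inter> Y)" "measure M (E \<inter> ?Z) \<le> measure N (E \<inter> ?Z)"
      using E Y by (auto intro!: pos neg)
    show ?thesis
      unfolding V[OF E] W[OF E] M.emeasure_eq_measure N.emeasure_eq_measure
      using le split[OF fin(1) sM] split[OF fin(2) sN] by (simp flip: ennreal_plus)
  qed
  have gm: "g \<in> borel_measurable ?V" "g \<in> borel_measurable ?W" "g \<in> borel_measurable M" "g \<in> borel_measurable N"
    using g(1) by (simp_all add: measurable_cong_sets[OF sM refl] measurable_cong_sets[OF sN refl]
        measurable_cong_sets[OF sets_positive_variation refl])
  note i = nn_integral_eq_integral_bounded[where g = g and G = G, OF fV gm(1)] nn_integral_eq_integral_bounded[where g = g and G = G, OF fW gm(2)]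
    nn_integral_eq_integral_bounded[where g = g and G = G, OF fin(1) gm(3)] nn_integral_eq_integral_bounded[where g = g and G = G, OF fin(2) gm(4)]
  have nn: "0 \<le> (\<integral>x. g x \<partial>K)" if "space K = space L" for K
    using g(2) that by (intro Bochner_Integration.integral_nonneg) auto
  have "(\<integral>\<^sup>+x. ennreal (g x) \<partial>?V) + (\<integral>\<^sup>+x. ennreal (g x) \<partial>N) = (\<integral>\<^sup>+x. ennreal (g x) \<partial>M) + (\<integral>\<^sup>+x. ennreal (g x) \<partial>?W)"
    using eq gm(1) by (intro nn_integral_add_measure_eq) (auto simp: sM sN)
  then have "(\<integral>x. g x \<partial>?V) + (\<integral>x. g x \<partial>N) = (\<integral>x. g x \<partial>M) + (\<integral>x. g x \<partial>?W)"
    using i g(2,3) nn[OF sp(1)] nn[OF sp(2)] nn[OF sp(3)] nn[OF sp(4)] by (simp add: sp flip: ennreal_plus)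
  then have "(\<integral>x. g x \<partial>?V) - (\<integral>x. g x \<partial>?W) = (\<integral>x. g x \<partial>M) - (\<integral>x. g x \<partial>N)" by simp
  then show ?thesis by (simp add: signed_integral_def flip: of_real_diff)
qed

section \<open>The Poisson integral as an operator\<close>

lemma space_circle_borel [simp]: "space circle_borel = sphere 0 1"
  by (simp add: circle_borel_def space_restrict_space)

text \<open>
  The diagonal measure \<open>\<mu>\<^sub>x\<^sub>,\<^sub>x\<close>. By polarization these positive measures determine \<open>\<mu>\<close>.
\<close>

definition scalar_measure :: "(complex set \<Rightarrow> ('e::complex_inner_space \<Rightarrow>\<^sub>L 'e)) \<Rightarrow> 'e \<Rightarrow> complex measure" where
  "scalar_measure \<mu> x = measure_of (space circle_borel) (sets circle_borel) (\<lambda>A. ennreal (qform (\<mu> A) x))"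

lemma sets_scalar_measure [simp]: "sets (scalar_measure \<mu> x) = sets circle_borel"
  by (simp only: scalar_measure_def sets_measure_of[OF sets.space_closed] sets.sigma_sets_eq)

lemma space_scalar_measure [simp]: "space (scalar_measure \<mu> x) = sphere 0 1"
  using sets_eq_imp_space_eq[OF sets_scalar_measure] by simp

locale semi_spectral =
  fixes \<mu> :: "complex set \<Rightarrow> ('e::complex_hilbert_space \<Rightarrow>\<^sub>L 'e)"
  assumes semi_spectral_measure: "semi_spectral_measure \<mu>"
begin

lemma positive: "A \<in> sets circle_borel \<Longrightarrow> positive_operator (\<mu> A)"
  using semi_spectral_measure by (auto simp: semi_spectral_measure_def)

lemma emeasure_scalar_measure:
  assumes "A \<in> sets circle_borel"
  shows "emeasure (scalar_measure \<mu> x) A = ennreal (qform (\<mu> A) x)"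
proof -
  have cm: "complex_measure circle_borel (\<lambda>A. cinner (blinfun_apply (\<mu> A) x) x)"
    using semi_spectral_measure
    by (auto simp: semi_spectral_measure_def regular_complex_borel_measure_def)
  have sums: "(\<lambda>i. qform (\<mu> (A i)) x) sums qform (\<mu> (\<Union>i. A i)) x"
    if "range A \<subseteq> sets circle_borel" "disjoint_family A" for A :: "nat \<Rightarrow> _"
    unfolding qform_def using cm that by (intro sums_Re) (auto simp: complex_measure_def)
  have "(\<lambda>i::nat. qform (\<mu> {}) x) sums qform (\<mu> {}) x"
    using sums[of "\<lambda>_. {}"] by (simp add: disjoint_family_on_def)
  then have 0: "qform (\<mu> {}) x = 0"
    using summable_const_iff[of "qform (\<mu> {}) x"] by (auto simp: sums_iff)
  show ?thesis
    unfolding scalar_measure_def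
  proof (rule emeasure_measure_of_sigma[OF sets.sigma_algebra_axioms _ _ assms])
    show "positive (sets circle_borel) (\<lambda>A. ennreal (qform (\<mu> A) x))"
      by (simp add: positive_def 0)
    show "countably_additive (sets circle_borel) (\<lambda>A. ennreal (qform (\<mu> A) x))"
    proof (rule countably_additiveI)
      fix A :: "nat \<Rightarrow> complex set"
      assume A: "range A \<subseteq> sets circle_borel" "disjoint_family A"
      show "(\<Sum>i. ennreal (qform (\<mu> (A i)) x)) = ennreal (qform (\<mu> (\<Union> (range A))) x)"
        using A by (intro suminf_ennreal_eq sums) (auto intro!: qform_nonneg positive)
    qed
  qed
qed

lemma measure_scalar_measure:
  "A \<in> sets circle_borel \<Longrightarrow> measure (scalar_measure \<mu> x) A = qform (\<mu> A) x"
  by (simp add: measure_def emeasure_scalar_measure qform_nonneg positive)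

lemma sphere_in_sets: "sphere 0 1 \<in> sets circle_borel"
  using sets.top[of circle_borel] by simp

lemma finite_scalar_measure: "finite_measure (scalar_measure \<mu> x)"
  by (rule finite_measureI) (simp add: emeasure_scalar_measure sphere_in_sets)

lemma total_mass_le: "measure (scalar_measure \<mu> x) (sphere 0 1) \<le> norm (\<mu> (sphere 0 1)) * (norm x)\<^sup>2"
  using qform_le_norm[of "\<mu> (sphere 0 1)" x] by (simp add: measure_scalar_measure sphere_in_sets)

lemma integral_scalar_measure_le:
  fixes g :: "complex \<Rightarrow> real"
  assumes "\<And>\<zeta>. \<zeta> \<in> sphere 0 1 \<Longrightarrow> \<bar>g \<zeta>\<bar> \<le> e" "g \<in> borel_measurable circle_borel" "0 \<le> e"
  shows "\<bar>\<integral>\<zeta>. g \<zeta> \<partial>scalar_measure \<mu> x\<bar> \<le> (e * norm (\<mu> (sphere 0 1))) * (norm x)\<^sup>2"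
proof -
  interpret finite_measure "scalar_measure \<mu> x" by (rule finite_scalar_measure)
  have gm: "g \<in> borel_measurable (scalar_measure \<mu> x)"
    using assms(2) by (simp add: measurable_cong_sets[OF sets_scalar_measure refl])
  have "\<bar>\<integral>\<zeta>. g \<zeta> \<partial>scalar_measure \<mu> x\<bar> \<le> (\<integral>\<zeta>. \<bar>g \<zeta>\<bar> \<partial>scalar_measure \<mu> x)"
    by (rule integral_abs_bound)
  also have "\<dots> \<le> (\<integral>\<zeta>. e \<partial>scalar_measure \<mu> x)"
    using assms gm by (intro integral_mono integrable_const_bound[where B = e]) auto
  also have "\<dots> \<le> e * (norm (\<mu> (sphere 0 1)) * (norm x)\<^sup>2)"
    using total_mass_le[of x] \<open>0 \<le> e\<close> by (simp add: mult_left_mono mult.commute[of _ e])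
  finally show ?thesis by (simp add: mult_ac)
qed

text \<open>
  The integral of \<open>g\<close> against \<open>\<mu>\<close> is a norm limit of integrals of step functions, which are finite
  linear combinations of values of \<open>\<mu>\<close>: step functions uniformly close to \<open>g\<close> give operators whose
  quadratic forms are close relative to \<open>\<parallel>x\<parallel>\<^sup>2\<close>, hence operators close in norm.
\<close>

lemma operator_integral_exists:
  fixes g :: "complex \<Rightarrow> real"
  assumes g: "g \<in> borel_measurable circle_borel"
    "\<And>\<zeta>. \<zeta> \<in> sphere 0 1 \<Longrightarrow> 0 \<le> g \<zeta>" "\<And>\<zeta>. \<zeta> \<in> sphere 0 1 \<Longrightarrow> g \<zeta> \<le> G"
  shows "\<exists>T. hermitian T \<and> (\<forall>x. qform T x = (\<integral>\<zeta>. g \<zeta> \<partial>scalar_measure \<mu> x))"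
proof -
  define m where "m = norm (\<mu> (sphere 0 1))"
  have m0: "0 \<le> m" by (simp add: m_def)
  \<comment> \<open>The \<open>k\<close>-th step function rounds \<open>g\<close> down to a multiple of \<open>1/(k+1)\<close>.\<close>
  define A where "A k i = {\<zeta> \<in> space circle_borel. \<lfloor>real (Suc k) * g \<zeta>\<rfloor> = int i}" for k i
  define I where "I k = {..nat \<lfloor>real (Suc k) * G\<rfloor>}" for k
  define T where "T k = (\<Sum>i\<in>I k. (real i / real (Suc k)) *\<^sub>R \<mu> (A k i))" for k
  define s where "s k \<zeta> = (\<Sum>i\<in>I k. (real i / real (Suc k)) * indicator (A k i) \<zeta>)" for k \<zeta>
  have A: "A k i \<in> sets circle_borel" for k i
    unfolding A_def using g(1) by measurable
  have A_space: "A k i \<inter> sphere 0 1 = A k i" for k i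
    by (auto simp: A_def)
  have s: "s k \<zeta> = of_int \<lfloor>real (Suc k) * g \<zeta>\<rfloor> / real (Suc k)" if "\<zeta> \<in> sphere 0 1" for k \<zeta>
  proof -
    define j where "j = nat \<lfloor>real (Suc k) * g \<zeta>\<rfloor>"
    have j: "int j = \<lfloor>real (Suc k) * g \<zeta>\<rfloor>" using g(2)[OF that] by (simp add: j_def)
    have jI: "j \<in> I k"
      unfolding I_def j_def using g(3)[OF that] by (auto intro!: nat_mono floor_mono mult_left_mono)
    have "s k \<zeta> = (\<Sum>i\<in>I k. if i = j then real j / real (Suc k) else 0)"
      unfolding s_def A_def using that j by (intro sum.cong) (auto simp: indicator_def)
    also have "\<dots> = real j / real (Suc k)" using jI by (simp add: I_def)
    finally show ?thesis using j by (metis of_int_of_nat_eq)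
  qed
  have sg: "\<bar>s k \<zeta> - g \<zeta>\<bar> \<le> 1 / real (Suc k)" if "\<zeta> \<in> sphere 0 1" for k \<zeta>
  proof -
    have "s k \<zeta> - g \<zeta> = (of_int \<lfloor>real (Suc k) * g \<zeta>\<rfloor> - real (Suc k) * g \<zeta>) / real (Suc k)"
      unfolding s[OF that] by (simp add: field_simps del: of_nat_Suc)
    moreover have "\<bar>of_int \<lfloor>real (Suc k) * g \<zeta>\<rfloor> - real (Suc k) * g \<zeta>\<bar> \<le> 1" by linarith
    ultimately show ?thesis
      by (simp only: abs_divide abs_of_nat) (simp add: divide_right_mono)
  qed
  have sm: "s k \<in> borel_measurable circle_borel" for k
    unfolding s_def using A by measurable
  have hT: "hermitian (T k)" for k
    unfolding T_def by (intro hermitian_sum hermitian_scaleR positive_imp_hermitian positive A)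
  have int: "integrable (scalar_measure \<mu> x) h"
    if "h \<in> borel_measurable circle_borel" "\<And>\<zeta>. \<zeta> \<in> sphere 0 1 \<Longrightarrow> \<bar>h \<zeta>\<bar> \<le> B" for h :: "complex \<Rightarrow> real" and B x
    using that by (intro finite_measure.integrable_const_bound[OF finite_scalar_measure, where B = B])
      (auto simp: measurable_cong_sets[OF sets_scalar_measure refl])
  have gi: "integrable (scalar_measure \<mu> x) g" for x
    using g by (intro int[where B = G]) auto
  have sb: "\<bar>s k \<zeta>\<bar> \<le> G + 1 / real (Suc k)" if "\<zeta> \<in> sphere 0 1" for k \<zeta>
    using sg[OF that, of k] g(2,3)[OF that] by linarith
  have si: "integrable (scalar_measure \<mu> x) (s k)" for x k
    using sm sb by (rule int)
  have qT: "qform (T k) x = (\<integral>\<zeta>. s k \<zeta> \<partial>scalar_measure \<mu> x)" for k x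
  proof -
    have "(\<integral>\<zeta>. s k \<zeta> \<partial>scalar_measure \<mu> x) =
        (\<Sum>i\<in>I k. (real i / real (Suc k)) * measure (scalar_measure \<mu> x) (A k i))"
      unfolding s_def using A finite_measure.emeasure_finite[OF finite_scalar_measure]
      by (subst Bochner_Integration.integral_sum) (auto simp: less_top A_space)
    then show ?thesis
      by (simp add: T_def qform_sum qform_scaleR_left measure_scalar_measure A)
  qed
  have close: "\<bar>qform (T k) x - (\<integral>\<zeta>. g \<zeta> \<partial>scalar_measure \<mu> x)\<bar> \<le> (1 / real (Suc k) * m) * (norm x)\<^sup>2" for k x
  proof -
    have "qform (T k) x - (\<integral>\<zeta>. g \<zeta> \<partial>scalar_measure \<mu> x) = (\<integral>\<zeta>. s k \<zeta> - g \<zeta> \<partial>scalar_measure \<mu> x)"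
      unfolding qT using si gi by simp
    also have "\<bar>\<dots>\<bar> \<le> (1 / real (Suc k) * m) * (norm x)\<^sup>2"
      unfolding m_def using sg sm g(1) by (intro integral_scalar_measure_le) auto
    finally show ?thesis .
  qed
  have diff: "norm (T k - T l) \<le> 1 / real (Suc k) * m + 1 / real (Suc l) * m" for k l
  proof (rule hermitian_norm_le[OF hermitian_diff[OF hT hT]])
    show "\<bar>qform (T k - T l) x\<bar> \<le> (1 / real (Suc k) * m + 1 / real (Suc l) * m) * (norm x)\<^sup>2" for x
      using close[of k x] close[of l x] unfolding qform_diff_left distrib_right by linarith
  qed (use m0 in auto)
  have "Cauchy T"
  proof (rule CauchyI)
    fix e :: real assume "0 < e"
    have "(\<lambda>k. 1 / real (Suc k) * m) \<longlonglongrightarrow> 0 * m"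
      by (intro tendsto_mult tendsto_const LIMSEQ_Suc lim_1_over_n)
    then have "eventually (\<lambda>k. 1 / real (Suc k) * m < e / 2) sequentially"
      using \<open>0 < e\<close> by (intro order_tendstoD) auto
    then obtain K where K: "\<And>k. k \<ge> K \<Longrightarrow> 1 / real (Suc k) * m < e / 2" by (auto simp: eventually_sequentially)
    have "norm (T k - T l) < e" if "k \<ge> K" "l \<ge> K" for k l
      using diff[of k l] K[OF that(1)] K[OF that(2)] by linarith
    then show "\<exists>K. \<forall>k\<ge>K. \<forall>l\<ge>K. norm (T k - T l) < e" by blast
  qed
  then obtain S where S: "T \<longlonglongrightarrow> S" by (auto simp: Cauchy_convergent_iff convergent_def)
  have Sx: "(\<lambda>k. blinfun_apply (T k) x) \<longlonglongrightarrow> blinfun_apply S x" for x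
    by (intro blinfun.tendsto S tendsto_const)
  have lin: "complex_linear S"
    unfolding complex_linear_def
  proof (intro allI)
    fix c x
    have "(\<lambda>k. c *\<^sub>C blinfun_apply (T k) x) \<longlonglongrightarrow> c *\<^sub>C blinfun_apply S x"
      by (intro scaleC.tendsto tendsto_const Sx)
    moreover have "c *\<^sub>C blinfun_apply (T k) x = blinfun_apply (T k) (c *\<^sub>C x)" for k
      using hT[of k] by (simp add: hermitian_def complex_linear_def)
    ultimately show "blinfun_apply S (c *\<^sub>C x) = c *\<^sub>C blinfun_apply S x"
      using LIMSEQ_unique[OF Sx[of "c *\<^sub>C x"]] by simp
  qed
  have q: "(\<lambda>k. cinner (blinfun_apply (T k) x) x) \<longlonglongrightarrow> cinner (blinfun_apply S x) x" for x
    by (intro cinner.tendsto tendsto_const Sx)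
  have "cinner (blinfun_apply S x) x \<in> \<real>" for x
    using closed_sequentially[OF closed_complex_Reals _ q] hT by (auto simp: hermitian_def)
  then have "hermitian S" using lin by (simp add: hermitian_def)
  moreover have "qform S x = (\<integral>\<zeta>. g \<zeta> \<partial>scalar_measure \<mu> x)" for x
  proof -
    have 1: "(\<lambda>k. qform (T k) x) \<longlonglongrightarrow> qform S x"
      unfolding qform_def by (intro tendsto_Re q)
    have "(\<lambda>k. (1 / real (Suc k) * m) * (norm x)\<^sup>2) \<longlonglongrightarrow> 0 * m * (norm x)\<^sup>2"
      by (intro tendsto_mult tendsto_const LIMSEQ_Suc lim_1_over_n)
    then have 0: "(\<lambda>k. (1 / real (Suc k) * m) * (norm x)\<^sup>2) \<longlonglongrightarrow> 0" by simp
    have "(\<lambda>k. qform (T k) x - (\<integral>\<zeta>. g \<zeta> \<partial>scalar_measure \<mu> x)) \<longlonglongrightarrow> 0"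
      by (rule Lim_null_comparison[OF _ 0]) (use close in auto)
    then have "(\<lambda>k. qform (T k) x) \<longlonglongrightarrow> (\<integral>\<zeta>. g \<zeta> \<partial>scalar_measure \<mu> x)"
      by (simp add: Lim_null[symmetric])
    then show ?thesis using 1 LIMSEQ_unique by blast
  qed
  ultimately show ?thesis by blast
qed

end

definition poisson_kernel :: "complex \<Rightarrow> complex \<Rightarrow> real" where
  "poisson_kernel z \<zeta> = (1 - (cmod z)\<^sup>2) / (cmod (z - \<zeta>))\<^sup>2"

lemma poisson_kernel_measurable [measurable]: "poisson_kernel z \<in> borel_measurable circle_borel"
  unfolding poisson_kernel_def circle_borel_def by (rule measurable_restrict_space1) measurable

lemma poisson_kernel_nonneg: "z \<in> ball 0 1 \<Longrightarrow> 0 \<le> poisson_kernel z \<zeta>"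
  by (auto simp: poisson_kernel_def power_le_one_iff intro!: divide_nonneg_nonneg)

lemma dist_circle: "z \<in> ball 0 1 \<Longrightarrow> \<zeta> \<in> sphere 0 1 \<Longrightarrow> 1 - cmod z \<le> cmod (z - \<zeta>)"
  using norm_triangle_ineq2[of \<zeta> z] by (simp add: norm_minus_commute)

lemma poisson_kernel_le:
  assumes "z \<in> ball 0 1" "\<zeta> \<in> sphere 0 1"
  shows "poisson_kernel z \<zeta> \<le> 2 / (1 - cmod z)"
proof -
  have z: "cmod z < 1" using assms by simp
  have "poisson_kernel z \<zeta> \<le> (1 - (cmod z)\<^sup>2) / (1 - cmod z)\<^sup>2"
    unfolding poisson_kernel_def using dist_circle[OF assms] z
    by (intro divide_left_mono power_mono mult_pos_pos) (auto simp: power_le_one_iff)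
  also have "\<dots> = (1 + cmod z) / (1 - cmod z)"
    using square_diff_square_factored[of 1 "cmod z"] z by (simp add: power2_eq_square)
  also have "\<dots> \<le> 2 / (1 - cmod z)" using z by (intro divide_right_mono) auto
  finally show ?thesis .
qed

text \<open>
  The Poisson kernel is harmonic in \<open>z\<close>, as the real part of the Herglotz kernel.
\<close>

lemma poisson_kernel_Re:
  assumes "z \<in> ball 0 1" "\<zeta> \<in> sphere 0 1"
  shows "poisson_kernel z \<zeta> = Re ((\<zeta> + z) / (\<zeta> - z))"
proof -
  have "Re ((\<zeta> + z) / (\<zeta> - z)) = Re ((\<zeta> + z) * cnj (\<zeta> - z)) / (cmod (\<zeta> - z))\<^sup>2"
    by (subst complex_div_cnj) (simp add: Re_divide_of_real flip: of_real_power)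
  also have "Re ((\<zeta> + z) * cnj (\<zeta> - z)) = (cmod \<zeta>)\<^sup>2 - (cmod z)\<^sup>2"
    unfolding cmod_power2 by (simp add: algebra_simps power2_eq_square)
  finally show ?thesis using assms by (simp add: poisson_kernel_def norm_minus_commute)
qed

lemma poisson_kernel_lipschitz:
  assumes "z \<in> ball 0 1" "w \<in> ball 0 1" "\<zeta> \<in> sphere 0 1"
  shows "\<bar>poisson_kernel z \<zeta> - poisson_kernel w \<zeta>\<bar> \<le> 2 * cmod (z - w) / ((1 - cmod z) * (1 - cmod w))"
proof -
  have ne: "\<zeta> \<noteq> z" "\<zeta> \<noteq> w" using assms by auto
  have lt: "cmod z < 1" "cmod w < 1" using assms by auto
  have "poisson_kernel z \<zeta> - poisson_kernel w \<zeta> = Re ((\<zeta> + z) / (\<zeta> - z) - (\<zeta> + w) / (\<zeta> - w))"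
    using assms by (simp add: poisson_kernel_Re)
  also have "(\<zeta> + z) / (\<zeta> - z) - (\<zeta> + w) / (\<zeta> - w) = 2 * \<zeta> * (z - w) / ((\<zeta> - z) * (\<zeta> - w))"
    using ne by (simp add: divide_simps) (simp add: algebra_simps)
  also have "\<bar>Re \<dots>\<bar> \<le> cmod (2 * \<zeta> * (z - w) / ((\<zeta> - z) * (\<zeta> - w)))" by (rule abs_Re_le_cmod)
  also have "\<dots> = 2 * cmod (z - w) / (cmod (z - \<zeta>) * cmod (w - \<zeta>))"
    using assms by (simp add: norm_mult norm_divide norm_minus_commute)
  also have "\<dots> \<le> 2 * cmod (z - w) / ((1 - cmod z) * (1 - cmod w))"
    using dist_circle[OF assms(1,3)] dist_circle[OF assms(2,3)] lt
    by (intro divide_left_mono mult_mono mult_pos_pos) auto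
  finally show ?thesis .
qed

context semi_spectral
begin

text \<open>
  Both sides of the defining identity of \<open>P\<^sub>\<mu>(z)\<close> are recovered from their diagonals by polarization,
  and on the diagonal the operator integral of the kernel has the required values.
\<close>

lemma poisson_integral:
  assumes z: "z \<in> ball 0 1"
  shows "hermitian (poisson_integral \<mu> z)"
    and "qform (poisson_integral \<mu> z) x = (\<integral>\<zeta>. poisson_kernel z \<zeta> \<partial>scalar_measure \<mu> x)"
proof -
  obtain T where T: "hermitian T" "\<And>x. qform T x = (\<integral>\<zeta>. poisson_kernel z \<zeta> \<partial>scalar_measure \<mu> x)"
    using operator_integral_exists[OF poisson_kernel_measurable poisson_kernel_nonneg[OF z] poisson_kernel_le[OF z]]
    by auto
  let ?P = "\<lambda>T. complex_linear T \<and>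
        (\<forall>x y. cinner (blinfun_apply T x) y =
           complex_measure_integral circle_borel (\<lambda>A. cinner (blinfun_apply (\<mu> A) x) y)
             (\<lambda>\<zeta>. complex_of_real (poisson_kernel z \<zeta>)))"
  have "?P T"
  proof (intro conjI allI)
    show "complex_linear T" using T(1) by (simp add: hermitian_def)
    fix x y
    have si: "signed_integral circle_borel \<nu> (\<lambda>\<zeta>. complex_of_real (poisson_kernel z \<zeta>)) =
        of_real (qform T a - qform T b)"
      if "\<And>A. A \<in> sets circle_borel \<Longrightarrow> \<nu> A = qform (\<mu> A) a - qform (\<mu> A) b" for \<nu> a b
      unfolding T(2)
      using poisson_kernel_nonneg[OF z] poisson_kernel_le[OF z] that
      by (intro signed_integral_diff[where G = "2 / (1 - cmod z)"])
        (auto intro!: finite_scalar_measure simp: measure_scalar_measure)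
    have R: "signed_integral circle_borel (\<lambda>A. Re (cinner (blinfun_apply (\<mu> A) x) y))
        (\<lambda>\<zeta>. complex_of_real (poisson_kernel z \<zeta>)) =
        of_real (qform T ((1/2) *\<^sub>R (x + y)) - qform T ((1/2) *\<^sub>R (x - y)))"
      by (rule si) (simp add: hermitian_cinner_polarization[OF positive_imp_hermitian[OF positive]])
    have I: "signed_integral circle_borel (\<lambda>A. Im (cinner (blinfun_apply (\<mu> A) x) y))
        (\<lambda>\<zeta>. complex_of_real (poisson_kernel z \<zeta>)) =
        of_real (qform T ((1/2) *\<^sub>R (x + \<i> *\<^sub>C y)) - qform T ((1/2) *\<^sub>R (x - \<i> *\<^sub>C y)))"
      by (rule si) (simp add: hermitian_cinner_polarization[OF positive_imp_hermitian[OF positive]])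
    show "cinner (blinfun_apply T x) y =
           complex_measure_integral circle_borel (\<lambda>A. cinner (blinfun_apply (\<mu> A) x) y)
             (\<lambda>\<zeta>. complex_of_real (poisson_kernel z \<zeta>))"
      unfolding complex_measure_integral_def R I by (rule hermitian_cinner_polarization[OF T(1)])
  qed
  moreover have "S = T" if "?P S" for S
  proof (rule blinfun_eqI)
    fix x show "blinfun_apply S x = blinfun_apply T x"
      using that \<open>?P T\<close> by (intro cinner_eqI) simp
  qed
  ultimately have "poisson_integral \<mu> z = T"
    unfolding poisson_integral_def poisson_kernel_def[symmetric] by (intro the_equality) blast+
  then show "hermitian (poisson_integral \<mu> z)"
    "qform (poisson_integral \<mu> z) x = (\<integral>\<zeta>. poisson_kernel z \<zeta> \<partial>scalar_measure \<mu> x)"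
    using T by auto
qed

lemma positive_poisson_integral:
  assumes "z \<in> ball 0 1" shows "positive_operator (poisson_integral \<mu> z)"
  using poisson_integral[OF assms] poisson_kernel_nonneg[OF assms]
  by (intro positive_operatorI) (auto intro!: Bochner_Integration.integral_nonneg)

lemma poisson_integral_nn:
  assumes "z \<in> ball 0 1"
  shows "ennreal (qform (poisson_integral \<mu> z) x) = (\<integral>\<^sup>+\<zeta>. ennreal (poisson_kernel z \<zeta>) \<partial>scalar_measure \<mu> x)"
  unfolding poisson_integral(2)[OF assms]
  using poisson_kernel_nonneg[OF assms] poisson_kernel_le[OF assms]
  by (subst nn_integral_eq_integral_bounded(1)[OF finite_scalar_measure, where G = "2 / (1 - cmod z)"])
    (auto simp: measurable_cong_sets[OF sets_scalar_measure refl])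

lemma norm_poisson_integral_le:
  assumes z: "z \<in> ball 0 1"
  shows "norm (poisson_integral \<mu> z) \<le> 2 / (1 - cmod z) * norm (\<mu> (sphere 0 1))"
proof (rule hermitian_norm_le[OF poisson_integral(1)[OF z]])
  show "\<bar>qform (poisson_integral \<mu> z) x\<bar> \<le> 2 / (1 - cmod z) * norm (\<mu> (sphere 0 1)) * (norm x)\<^sup>2" for x
    unfolding poisson_integral(2)[OF z]
    using poisson_kernel_nonneg[OF z] poisson_kernel_le[OF z] z by (intro integral_scalar_measure_le) auto
qed (use z in auto)

text \<open>
  Local Lipschitz continuity of \<open>P\<^sub>\<mu>\<close> in operator norm; it makes all integrands below jointly
  continuous, hence measurable.
\<close>

lemma norm_poisson_integral_diff_le:
  assumes z: "z \<in> ball 0 1" and w: "w \<in> ball 0 1"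
  shows "norm (poisson_integral \<mu> z - poisson_integral \<mu> w) \<le>
    2 * cmod (z - w) / ((1 - cmod z) * (1 - cmod w)) * norm (\<mu> (sphere 0 1))"
proof (rule hermitian_norm_le[OF hermitian_diff[OF poisson_integral(1)[OF z] poisson_integral(1)[OF w]]])
  fix x
  have i: "integrable (scalar_measure \<mu> x) (poisson_kernel z)" if "z \<in> ball 0 1" for z
    using poisson_kernel_nonneg[OF that] poisson_kernel_le[OF that]
    by (intro nn_integral_eq_integral_bounded(2)[OF finite_scalar_measure, where G = "2 / (1 - cmod z)"])
      (auto simp: measurable_cong_sets[OF sets_scalar_measure refl])
  have "qform (poisson_integral \<mu> z - poisson_integral \<mu> w) x =
      (\<integral>\<zeta>. poisson_kernel z \<zeta> - poisson_kernel w \<zeta> \<partial>scalar_measure \<mu> x)"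
    unfolding qform_diff_left poisson_integral(2)[OF z] poisson_integral(2)[OF w]
    using i[OF z] i[OF w] by simp
  then show "\<bar>qform (poisson_integral \<mu> z - poisson_integral \<mu> w) x\<bar> \<le>
    2 * cmod (z - w) / ((1 - cmod z) * (1 - cmod w)) * norm (\<mu> (sphere 0 1)) * (norm x)\<^sup>2"
    using poisson_kernel_lipschitz[OF z w] z w by (simp only:) (intro integral_scalar_measure_le; auto)
qed (use z w in \<open>auto intro!: divide_nonneg_nonneg mult_nonneg_nonneg\<close>)

lemma continuous_on_poisson_integral: "continuous_on (ball 0 1) (poisson_integral \<mu>)"
  unfolding continuous_on_def
proof
  fix z :: complex assume z: "z \<in> ball 0 1"
  have "((\<lambda>w. 2 * cmod (w - z) / ((1 - cmod w) * (1 - cmod z)) * norm (\<mu> (sphere 0 1))) \<longlongrightarrow>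
      2 * cmod (z - z) / ((1 - cmod z) * (1 - cmod z)) * norm (\<mu> (sphere 0 1))) (at z within ball 0 1)"
    using z by (intro tendsto_intros) auto
  then have 0: "((\<lambda>w. 2 * cmod (w - z) / ((1 - cmod w) * (1 - cmod z)) * norm (\<mu> (sphere 0 1))) \<longlongrightarrow> 0)
      (at z within ball 0 1)" by simp
  have "((\<lambda>w. poisson_integral \<mu> w - poisson_integral \<mu> z) \<longlongrightarrow> 0) (at z within ball 0 1)"
    by (rule Lim_null_comparison[OF _ 0])
      (use norm_poisson_integral_diff_le z in \<open>auto simp: eventually_at_filter\<close>)
  then show "(poisson_integral \<mu> \<longlongrightarrow> poisson_integral \<mu> z) (at z within ball 0 1)"
    by (simp add: Lim_null[symmetric])
qed

lemma continuous_on_qform_poisson: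
  assumes "continuous_on S u" "continuous_on S h" "\<And>s. s \<in> S \<Longrightarrow> u s \<in> ball 0 1"
  shows "continuous_on S (\<lambda>s. qform (poisson_integral \<mu> (u s)) (h s))"
proof -
  have "continuous_on S (\<lambda>s. poisson_integral \<mu> (u s))"
    using assms by (intro continuous_on_compose2[OF continuous_on_poisson_integral]) auto
  then show ?thesis
    unfolding qform_def using assms
    by (intro continuous_on_Re cinner.continuous_on blinfun.continuous_on)
qed

end

section \<open>Planar Lebesgue measure under rotations and dilations\<close>

lemma measurable_Complex [measurable]: "(\<lambda>p. Complex (fst p) (snd p)) \<in> borel_measurable (lborel \<Otimes>\<^sub>M lborel)"
  unfolding Complex_eq by measurable

text \<open>
  Identifies planar measure with the product measure, so that shears can be treated by Tonelli and
  the translation invariance of Lebesgue measure on the line.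
\<close>

lemma lborel_complex_eq_distr:
  "(lborel :: complex measure) = distr (lborel \<Otimes>\<^sub>M lborel) borel (\<lambda>p. Complex (fst p) (snd p))"
proof (rule lborel_eqI)
  fix l u :: complex
  assume "\<And>b. b \<in> Basis \<Longrightarrow> l \<bullet> b \<le> u \<bullet> b"
  from this[of 1] this[of \<i>] have le: "Re l \<le> Re u" "Im l \<le> Im u"
    by (auto simp: Basis_complex_def inner_complex_def)
  have "emeasure (distr (lborel \<Otimes>\<^sub>M lborel) borel (\<lambda>p. Complex (fst p) (snd p))) (box l u) =
      emeasure (lborel \<Otimes>\<^sub>M lborel) ({Re l<..<Re u} \<times> {Im l<..<Im u})"
    by (subst emeasure_distr)
       (auto intro!: arg_cong2[where f = emeasure] simp: space_pair_measure in_box_complex_iff)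
  also have "\<dots> = ennreal (Re u - Re l) * ennreal (Im u - Im l)"
    using le by (simp add: lborel.emeasure_pair_measure_Times)
  also have "\<dots> = (\<Prod>b\<in>Basis. (u - l) \<bullet> b)"
    using le by (simp add: Basis_complex_def inner_complex_def ennreal_mult)
  finally show "emeasure (distr (lborel \<Otimes>\<^sub>M lborel) borel (\<lambda>p. Complex (fst p) (snd p))) (box l u) =
    (\<Prod>b\<in>Basis. (u - l) \<bullet> b)" .
qed simp

lemma nn_integral_complex:
  assumes [measurable]: "f \<in> borel_measurable borel"
  shows "(\<integral>\<^sup>+z. f z \<partial>lborel) = (\<integral>\<^sup>+y. \<integral>\<^sup>+x. f (Complex x y) \<partial>lborel \<partial>lborel)"
    and "(\<integral>\<^sup>+z. f z \<partial>lborel) = (\<integral>\<^sup>+x. \<integral>\<^sup>+y. f (Complex x y) \<partial>lborel \<partial>lborel)"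
proof -
  have eq: "(\<integral>\<^sup>+z. f z \<partial>lborel) = (\<integral>\<^sup>+p. f (Complex (fst p) (snd p)) \<partial>(lborel \<Otimes>\<^sub>M lborel))"
    by (subst lborel_complex_eq_distr) (simp add: nn_integral_distr)
  show "(\<integral>\<^sup>+z. f z \<partial>lborel) = (\<integral>\<^sup>+y. \<integral>\<^sup>+x. f (Complex x y) \<partial>lborel \<partial>lborel)"
    unfolding eq by (subst lborel_pair.nn_integral_snd[symmetric]) auto
  show "(\<integral>\<^sup>+z. f z \<partial>lborel) = (\<integral>\<^sup>+x. \<integral>\<^sup>+y. f (Complex x y) \<partial>lborel \<partial>lborel)"
    unfolding eq by (subst lborel.nn_integral_fst[symmetric]) auto
qed

lemma borel_measurable_Complex_line:
  assumes [measurable]: "f \<in> borel_measurable borel"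
  shows "(\<lambda>x. f (Complex x y)) \<in> borel_measurable borel" "(\<lambda>x. f (Complex y x)) \<in> borel_measurable borel"
  unfolding Complex_eq by measurable

lemma nn_integral_shear_Im:
  assumes [measurable]: "f \<in> borel_measurable borel"
  shows "(\<integral>\<^sup>+z. f (z + of_real (t * Im z)) \<partial>lborel) = (\<integral>\<^sup>+z. f z \<partial>lborel)"
proof -
  have "(\<integral>\<^sup>+z. f (z + of_real (t * Im z)) \<partial>lborel) =
      (\<integral>\<^sup>+y. \<integral>\<^sup>+x. f (Complex x y + of_real (t * y)) \<partial>lborel \<partial>lborel)"
    by (subst nn_integral_complex(1)) simp_all
  also have "\<dots> = (\<integral>\<^sup>+y. \<integral>\<^sup>+x. f (Complex x y) \<partial>lborel \<partial>lborel)"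
  proof (rule nn_integral_cong)
    fix y
    have "Complex x y + of_real (t * y) = Complex (t * y + 1 * x) y" for x
      by (simp add: complex_eq_iff)
    then show "(\<integral>\<^sup>+x. f (Complex x y + of_real (t * y)) \<partial>lborel) = (\<integral>\<^sup>+x. f (Complex x y) \<partial>lborel)"
      using nn_integral_real_affine[OF borel_measurable_Complex_line(1)[OF assms], of 1 y "t * y"] by simp
  qed
  also have "\<dots> = (\<integral>\<^sup>+z. f z \<partial>lborel)" by (rule nn_integral_complex(1)[symmetric]) simp
  finally show ?thesis .
qed

lemma nn_integral_shear_Re:
  assumes [measurable]: "f \<in> borel_measurable borel"
  shows "(\<integral>\<^sup>+z. f (z + \<i> * of_real (t * Re z)) \<partial>lborel) = (\<integral>\<^sup>+z. f z \<partial>lborel)"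
proof -
  have "(\<integral>\<^sup>+z. f (z + \<i> * of_real (t * Re z)) \<partial>lborel) =
      (\<integral>\<^sup>+x. \<integral>\<^sup>+y. f (Complex x y + \<i> * of_real (t * x)) \<partial>lborel \<partial>lborel)"
    by (subst nn_integral_complex(2)) simp_all
  also have "\<dots> = (\<integral>\<^sup>+x. \<integral>\<^sup>+y. f (Complex x y) \<partial>lborel \<partial>lborel)"
  proof (rule nn_integral_cong)
    fix x
    have "Complex x y + \<i> * of_real (t * x) = Complex x (t * x + 1 * y)" for y
      by (simp add: complex_eq_iff)
    then show "(\<integral>\<^sup>+y. f (Complex x y + \<i> * of_real (t * x)) \<partial>lborel) = (\<integral>\<^sup>+y. f (Complex x y) \<partial>lborel)"
      using nn_integral_real_affine[OF borel_measurable_Complex_line(2)[OF assms], of 1 x "t * x"] by simp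
  qed
  also have "\<dots> = (\<integral>\<^sup>+z. f z \<partial>lborel)" by (rule nn_integral_complex(2)[symmetric]) simp
  finally show ?thesis .
qed

lemma nn_integral_dilation:
  fixes f :: "complex \<Rightarrow> ennreal"
  assumes [measurable]: "f \<in> borel_measurable borel" and c: "c \<noteq> 0"
  shows "(\<integral>\<^sup>+z. f z \<partial>lborel) = ennreal (c\<^sup>2) * (\<integral>\<^sup>+z. f (of_real c * z) \<partial>lborel)"
  by (subst lborel_affine[OF c, of 0])
    (simp add: nn_integral_density nn_integral_distr nn_integral_cmult scaleR_conv_of_real power2_eq_square
      abs_mult_self_eq flip: ennreal_mult')

text \<open>
  A rotation through an angle \<open>\<theta>\<close> that is not a multiple of \<open>\<pi>\<close> is a product of three shears
  \<open>A B A\<close>, with slopes \<open>-tan(\<theta>/2)\<close>, \<open>sin \<theta>\<close> and \<open>-tan(\<theta>/2)\<close>, and shears preserve area.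
\<close>

lemma nn_integral_rotation:
  fixes f :: "complex \<Rightarrow> ennreal"
  assumes [measurable]: "f \<in> borel_measurable borel" and \<xi>: "cmod \<xi> = 1"
  shows "(\<integral>\<^sup>+z. f (\<xi> * z) \<partial>lborel) = (\<integral>\<^sup>+z. f z \<partial>lborel)"
proof (cases "Im \<xi> = 0")
  case True
  then have "\<xi> = of_real (Re \<xi>)" by (simp add: complex_eq_iff)
  moreover have "(Re \<xi>)\<^sup>2 = 1" using \<xi> True cmod_power2[of \<xi>] by simp
  ultimately show ?thesis using nn_integral_dilation[OF assms(1), of "Re \<xi>"] by fastforce
next
  case False
  define c s where "c = Re \<xi>" and "s = Im \<xi>"
  \<comment> \<open>This is \<open>-tan(\<theta>/2)\<close>.\<close>
  define t where "t = (c - 1) / s"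
  have s: "s \<noteq> 0" using False by (simp add: s_def)
  have cs: "c\<^sup>2 + s\<^sup>2 = 1" using \<xi> cmod_power2[of \<xi>] by (simp add: c_def s_def)
  have ts: "t * s = c - 1" using s by (simp add: t_def)
  have tc: "t * (1 + c) = - s"
  proof -
    have "t * (1 + c) * s = (t * s) * (1 + c)" by simp
    also have "\<dots> = (c - 1) * (1 + c)" unfolding ts ..
    also have "\<dots> = - s * s" using cs by (simp add: algebra_simps power2_eq_square)
    finally show ?thesis using mult_right_cancel[OF s] by blast
  qed
  let ?A = "\<lambda>z. z + of_real (t * Im z)" and ?B = "\<lambda>z. z + \<i> * of_real (s * Re z)"
  have rot: "\<xi> * z = ?A (?B (?A z))" for z
  proof -
    have "Im z + s * (Re z + t * Im z) = s * Re z + (1 + t * s) * Im z"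
      by (simp add: algebra_simps)
    then have 1: "Im z + s * (Re z + t * Im z) = s * Re z + c * Im z"
      unfolding ts by simp
    have "Re z + t * Im z + t * (s * Re z + c * Im z) = (1 + t * s) * Re z + t * (1 + c) * Im z"
      by (simp add: algebra_simps)
    then have 2: "Re z + t * Im z + t * (s * Re z + c * Im z) = c * Re z - s * Im z"
      unfolding tc ts by simp
    have "?B (?A z) = Complex (Re z + t * Im z) (Im z + s * (Re z + t * Im z))"
      by (simp add: complex_eq_iff)
    also have "\<dots> = Complex (Re z + t * Im z) (s * Re z + c * Im z)"
      unfolding 1 ..
    finally have "?A (?B (?A z)) = Complex (Re z + t * Im z + t * (s * Re z + c * Im z)) (s * Re z + c * Im z)"
      by (simp add: complex_eq_iff)
    also have "\<dots> = \<xi> * z"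
      unfolding 2 by (simp add: complex_eq_iff c_def s_def)
    finally show ?thesis ..
  qed
  have mA: "(\<lambda>z. g (?A z)) \<in> borel_measurable borel" if [measurable]: "g \<in> borel_measurable borel" for g :: "complex \<Rightarrow> ennreal"
    by measurable
  have mB: "(\<lambda>z. g (?B z)) \<in> borel_measurable borel" if [measurable]: "g \<in> borel_measurable borel" for g :: "complex \<Rightarrow> ennreal"
    by measurable
  have "(\<integral>\<^sup>+z. f (\<xi> * z) \<partial>lborel) = (\<integral>\<^sup>+z. (\<lambda>w. f (?A (?B w))) (?A z) \<partial>lborel)"
    unfolding rot by simp
  also have "\<dots> = (\<integral>\<^sup>+w. f (?A (?B w)) \<partial>lborel)"
    by (rule nn_integral_shear_Im) (rule mB[OF mA[OF assms(1)]])
  also have "\<dots> = (\<integral>\<^sup>+w. f (?A w) \<partial>lborel)"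
    by (rule nn_integral_shear_Re[OF mA[OF assms(1)]])
  also have "\<dots> = (\<integral>\<^sup>+w. f w \<partial>lborel)" by (rule nn_integral_shear_Im[OF assms(1)])
  finally show ?thesis .
qed

section \<open>Poisson averages over rotations\<close>

definition circ :: "real \<Rightarrow> complex" where
  "circ t = exp (2 * of_real pi * \<i> * of_real t)"

lemma norm_circ [simp]: "cmod (circ t) = 1"
  by (simp add: circ_def norm_exp_eq_Re)

lemma circ_cnj_cancel [simp]: "circ t * (cnj (circ t) * z) = z"
  by (simp add: complex_norm_square[symmetric] flip: mult.assoc)

lemma continuous_on_circ [continuous_intros]: "continuous_on S circ"
  unfolding circ_def by (intro continuous_intros)

text \<open>
  The Poisson kernel at the real point \<open>\<rho>\<close>, as a probability density in the parameter \<open>t \<in> [0, 1]\<close> of the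
  circle.
\<close>

definition poisson_density :: "real \<Rightarrow> real \<Rightarrow> real" where
  "poisson_density \<rho> t = poisson_kernel (of_real \<rho> * circ t) 1"

lemma poisson_density_nonneg: "0 \<le> \<rho> \<Longrightarrow> \<rho> < 1 \<Longrightarrow> 0 \<le> poisson_density \<rho> t"
  unfolding poisson_density_def by (rule poisson_kernel_nonneg) (simp add: norm_mult)

lemma poisson_density_continuous: "0 \<le> \<rho> \<Longrightarrow> \<rho> < 1 \<Longrightarrow> continuous_on S (poisson_density \<rho>)"
proof -
  assume \<rho>: "0 \<le> \<rho>" "\<rho> < 1"
  have "of_real \<rho> * circ t \<noteq> 1" for t
    using \<rho> norm_mult[of "of_real \<rho>" "circ t"] by (metis abs_of_nonneg less_irrefl mult.right_neutral norm_circ norm_of_real norm_one)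
  then show ?thesis
    unfolding poisson_density_def poisson_kernel_def by (intro continuous_intros) auto
qed

text \<open>
  This is Cauchy's integral formula at \<open>\<rho>\<close> for \<open>F(u)(1 - \<rho>\<^sup>2)/(1 - \<rho>u)\<close>, because
  \<open>|1 - \<rho>u|\<^sup>2 = (1 - \<rho>u)(u - \<rho>)/u\<close> on the unit circle.
\<close>

lemma poisson_average:
  assumes F: "F holomorphic_on cball 0 1" and \<rho>: "0 \<le> \<rho>" "\<rho> < 1"
  shows "((\<lambda>t. of_real (poisson_density \<rho> t) * F (circ t)) has_integral F (of_real \<rho>)) {0..1}"
proof -
  let ?G = "\<lambda>u. F u * of_real (1 - \<rho>\<^sup>2) / (1 - of_real \<rho> * u)"
  have ne: "1 - of_real \<rho> * u \<noteq> 0" if "cmod u \<le> 1" for u :: complex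
  proof
    assume "1 - of_real \<rho> * u = 0"
    then have "cmod (of_real \<rho> * u) = 1" by (metis eq_iff_diff_eq_0 norm_one)
    moreover have "cmod (of_real \<rho> * u) \<le> \<rho> * 1" using \<rho> that by (simp add: norm_mult mult_left_le)
    ultimately show False using \<rho> by simp
  qed
  have "?G holomorphic_on cball 0 1"
    using F ne by (intro holomorphic_intros) auto
  then have "((\<lambda>u. ?G u / (u - of_real \<rho>)) has_contour_integral (2 * of_real pi * \<i> * ?G (of_real \<rho>))) (circlepath 0 1)"
    using \<rho> by (intro Cauchy_integral_circlepath_simple) auto
  then have "((\<lambda>t. ?G (circ t) / (circ t - of_real \<rho>) * (2 * of_real pi * \<i> * circ t)) has_integral
      (2 * of_real pi * \<i> * ?G (of_real \<rho>))) {0..1}"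
    unfolding has_contour_integral vector_derivative_circlepath by (simp add: circlepath circ_def)
  then have "((\<lambda>t. 1 / (2 * of_real pi * \<i>) * (?G (circ t) / (circ t - of_real \<rho>) * (2 * of_real pi * \<i> * circ t))) has_integral
      1 / (2 * of_real pi * \<i>) * (2 * of_real pi * \<i> * ?G (of_real \<rho>))) {0..1}"
    by (rule has_integral_mult_right)
  moreover have "1 / (2 * of_real pi * \<i>) * (2 * of_real pi * \<i> * ?G (of_real \<rho>)) = F (of_real \<rho>)"
    using ne[of "of_real \<rho>"] \<rho> by (simp add: power2_eq_square)
  moreover have "1 / (2 * of_real pi * \<i>) * (?G (circ t) / (circ t - of_real \<rho>) * (2 * of_real pi * \<i> * circ t)) =
      of_real (poisson_density \<rho> t) * F (circ t)" for t
  proof -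
    have n0: "circ t \<noteq> 0" by (simp add: circ_def)
    have n1: "1 - of_real \<rho> * circ t \<noteq> 0" by (rule ne) simp
    have c: "circ t * cnj (circ t) = 1" by (simp add: complex_norm_square[symmetric])
    have n2: "circ t - of_real \<rho> \<noteq> 0"
      using \<rho> by (metis abs_of_nonneg eq_iff_diff_eq_0 less_irrefl norm_circ norm_of_real)
    have "of_real ((cmod (of_real \<rho> * circ t - 1))\<^sup>2) * circ t =
        (1 - of_real \<rho> * circ t) * ((1 - of_real \<rho> * cnj (circ t)) * circ t)"
      unfolding complex_norm_square by (simp add: algebra_simps)
    also have "(1 - of_real \<rho> * cnj (circ t)) * circ t = circ t - of_real \<rho>"
      using c by (simp add: algebra_simps)
    finally have "of_real ((cmod (of_real \<rho> * circ t - 1))\<^sup>2) = (1 - of_real \<rho> * circ t) * (circ t - of_real \<rho>) / circ t"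
      by (simp only: nonzero_eq_divide_eq[OF n0])
    then have "of_real (poisson_density \<rho> t) = of_real (1 - \<rho>\<^sup>2) * circ t / ((1 - of_real \<rho> * circ t) * (circ t - of_real \<rho>))"
      using \<rho> by (simp add: poisson_density_def poisson_kernel_def norm_mult)
    moreover have cancel: "1 / p * (f * R / a / b * (p * c)) = R * c / (a * b) * f" if "p \<noteq> 0" for p f R a b c :: complex
      using that by simp
    ultimately show ?thesis by (simp only:) (rule cancel, simp)
  qed
  ultimately show ?thesis by simp
qed

lemma Re_of_real_mult: "Re (of_real a * w) = a * Re w"
  by simp

lemma nn_integral_has_integral_Icc:
  assumes "continuous_on {0..1} f" "\<And>t. t \<in> {0..1} \<Longrightarrow> 0 \<le> f t" "(f has_integral I) {0..1::real}"
  shows "(\<integral>\<^sup>+t. indicator {0..1} t * ennreal (f t) \<partial>lborel) = ennreal I"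
proof -
  have "(\<integral>\<^sup>+t. ennreal (indicator {0..1} t *\<^sub>R f t) \<partial>lborel) = ennreal I"
  proof (rule nn_integral_has_integral_lborel)
    show "(\<lambda>t. indicator {0..1} t *\<^sub>R f t) \<in> borel_measurable borel"
      using assms(1) by (intro borel_measurable_continuous_on_indicator) auto
    show "0 \<le> indicator {0..1} t *\<^sub>R f t" for t using assms(2)[of t] by (auto simp: indicator_def)
    have "(\<lambda>t. indicator {0..1} t *\<^sub>R f t) = (\<lambda>t. if t \<in> {0..1} then f t else 0)" by (auto simp: indicator_def)
    then show "((\<lambda>t. indicator {0..1} t *\<^sub>R f t) has_integral I) UNIV"
      using assms(3) by (simp only: has_integral_restrict_UNIV)
  qed
  moreover have "ennreal (indicator {0..1} t *\<^sub>R f t) = indicator {0..1} t * ennreal (f t)" for t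
    by (auto simp: indicator_def)
  ultimately show ?thesis by simp
qed

text \<open>
  The semigroup property of the Poisson kernel. After conjugation the Herglotz kernel is holomorphic
  in the rotation \<open>u\<close>, so the average is its value at \<open>u = \<rho>\<close>.
\<close>

lemma poisson_kernel_average:
  assumes z: "z \<in> ball 0 1" and \<zeta>: "\<zeta> \<in> sphere 0 1" and \<rho>: "0 \<le> \<rho>" "\<rho> < 1"
  shows "(\<integral>\<^sup>+t. indicator {0..1} t * ennreal (poisson_density \<rho> t * poisson_kernel (cnj (circ t) * z) \<zeta>) \<partial>lborel) =
    ennreal (poisson_kernel (of_real \<rho> * z) \<zeta>)"
proof (rule nn_integral_has_integral_Icc)
  have zt: "cnj (circ t) * z \<in> ball 0 1" for t using z by (simp add: norm_mult)
  have rz: "of_real \<rho> * z \<in> ball 0 1"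
    using z \<rho> mult_left_le_one_le[of "cmod z" \<rho>] by (simp add: norm_mult)
  let ?F = "\<lambda>u. (cnj \<zeta> + u * cnj z) / (cnj \<zeta> - u * cnj z)"
  have ne: "cnj \<zeta> - u * cnj z \<noteq> 0" if "cmod u \<le> 1" for u
  proof
    assume "cnj \<zeta> - u * cnj z = 0"
    then have "cmod (u * cnj z) = 1" using \<zeta> by (metis complex_mod_cnj eq_iff_diff_eq_0 mem_sphere_0)
    moreover have "cmod (u * cnj z) \<le> 1 * cmod z" unfolding norm_mult complex_mod_cnj
      using that by (intro mult_right_mono) auto
    ultimately show False using z by simp
  qed
  have R: "Re (?F u) = poisson_kernel (cnj u * z) \<zeta>" if "cnj u * z \<in> ball 0 1" for u
    unfolding poisson_kernel_Re[OF that \<zeta>]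
    by (subst cnj.simps(1)[symmetric]) (simp add: complex_cnj_divide)
  have "((\<lambda>t. of_real (poisson_density \<rho> t) * ?F (circ t)) has_integral ?F (of_real \<rho>)) {0..1}"
    using ne by (intro poisson_average \<rho> holomorphic_intros) auto
  from has_integral_Re[OF this]
  show "((\<lambda>t. poisson_density \<rho> t * poisson_kernel (cnj (circ t) * z) \<zeta>) has_integral
      poisson_kernel (of_real \<rho> * z) \<zeta>) {0..1}"
    using R[OF zt] R[of "of_real \<rho>"] rz by (simp only: Re_of_real_mult complex_cnj_complex_of_real)
  show "0 \<le> poisson_density \<rho> t * poisson_kernel (cnj (circ t) * z) \<zeta>" for t
    using poisson_density_nonneg[OF \<rho>] poisson_kernel_nonneg[OF zt] by simp
  have "cnj (circ t) * z \<noteq> \<zeta>" for t using zt[of t] \<zeta> by auto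
  then show "continuous_on {0..1} (\<lambda>t. poisson_density \<rho> t * poisson_kernel (cnj (circ t) * z) \<zeta>)"
    unfolding poisson_kernel_def using \<rho>
    by (intro continuous_intros poisson_density_continuous) auto
qed

lemma holomorphic_on_disc_continuous: "holomorphic_on_disc f \<Longrightarrow> continuous_on (ball 0 1) f"
  unfolding holomorphic_on_disc_def has_complex_derivative_at_def
  by (intro continuous_at_imp_continuous_on ballI) (blast intro: has_derivative_continuous)

text \<open>
  Jensen's inequality for the Poisson average. The tangent of the form at the value of \<open>h\<close> at the centre
  \<open>\<rho>w\<close>, composed with \<open>h\<close>, is the real part of a holomorphic function of the rotation, so its average is
  its value at \<open>\<rho>\<close>; the form lies above its tangent.
\<close>

lemma qform_subharmonic:
  fixes h :: "complex \<Rightarrow> 'e::complex_inner_space"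
  assumes T: "positive_operator T" and h: "holomorphic_on_disc h"
    and w: "w \<in> ball 0 1" and \<rho>: "0 \<le> \<rho>" "\<rho> < 1"
  shows "ennreal (qform T (h (of_real \<rho> * w))) \<le>
    (\<integral>\<^sup>+t. indicator {0..1} t * ennreal (poisson_density \<rho> t * qform T (h (circ t * w))) \<partial>lborel)"
proof -
  have hc: "continuous_on (ball 0 1) h" by (rule holomorphic_on_disc_continuous[OF h])
  define x where "x = h (of_real \<rho> * w)"
  define F where "F u = cinner (blinfun_apply T (h (u * w))) x" for u
  have uw: "u * w \<in> ball 0 1" if "cmod u \<le> 1" for u
  proof -
    have "cmod (u * w) \<le> 1 * cmod w" unfolding norm_mult using that by (intro mult_right_mono) auto
    then show ?thesis using w by simp
  qed
  have lin: "blinfun_apply T (c *\<^sub>C v) = c *\<^sub>C blinfun_apply T v" for c v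
    using T by (auto simp: positive_operator_def complex_linear_def)
  have "F holomorphic_on cball 0 1"
    unfolding holomorphic_on_def
  proof
    fix u :: complex assume "u \<in> cball 0 1"
    then have "u * w \<in> ball 0 1" by (intro uw) simp
    then obtain v where "(h has_derivative (\<lambda>k. k *\<^sub>C v)) (at (u * w))"
      using h unfolding holomorphic_on_disc_def has_complex_derivative_at_def by blast
    then have "((\<lambda>u. h (u * w)) has_derivative (\<lambda>k. (k * w) *\<^sub>C v)) (at u)"
      using has_derivative_compose[of "\<lambda>u. u * w" "\<lambda>k. k * w" u UNIV h "\<lambda>k. k *\<^sub>C v"]
      by (simp add: bounded_linear_mult_left bounded_linear_imp_has_derivative)
    then have "(F has_derivative (\<lambda>k. cinner (blinfun_apply T ((k * w) *\<^sub>C v)) x)) (at u)"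
      unfolding F_def
      by (rule bounded_linear.has_derivative[OF
            bounded_linear_compose[OF cinner.bounded_linear_left blinfun.bounded_linear_right]])
    moreover have "(\<lambda>k. cinner (blinfun_apply T ((k * w) *\<^sub>C v)) x) = (*) (w * cinner (blinfun_apply T v) x)"
      by (auto simp: lin cinner_scaleC_left)
    ultimately have "(F has_field_derivative (w * cinner (blinfun_apply T v) x)) (at u)"
      by (simp add: has_field_derivative_def)
    then show "F field_differentiable at u within cball 0 1"
      using field_differentiable_at_within field_differentiable_def by blast
  qed
  from has_integral_Re[OF poisson_average[OF this \<rho>]]
  have F: "((\<lambda>t. poisson_density \<rho> t * Re (F (circ t))) has_integral qform T x) {0..1}"
    by (simp add: F_def x_def qform_def)
  have "((\<lambda>t. complex_of_real (poisson_density \<rho> t) * 1) has_integral 1) {0..1}"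
    by (rule poisson_average[where F = "\<lambda>_. 1"]) (auto simp: \<rho>)
  from has_integral_Re[OF this] have one: "(poisson_density \<rho> has_integral 1) {0..1}" by simp
  have lower: "((\<lambda>t. 2 * (poisson_density \<rho> t * Re (F (circ t))) - poisson_density \<rho> t * qform T x) has_integral
      2 * qform T x - 1 * qform T x) {0..1}"
    by (intro has_integral_diff has_integral_mult_right has_integral_mult_left F one)
  have cont: "continuous_on {0..1} (\<lambda>t. poisson_density \<rho> t * qform T (h (circ t * w)))"
    unfolding qform_def using \<rho> uw
    by (intro continuous_intros poisson_density_continuous cinner.continuous_on blinfun.continuous_on
        continuous_on_compose2[OF hc]) auto
  then obtain J where J: "((\<lambda>t. poisson_density \<rho> t * qform T (h (circ t * w))) has_integral J) {0..1}"
    using integrable_continuous_real[OF cont] by (auto simp: integrable_on_def)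
  have "2 * qform T x - 1 * qform T x \<le> J"
  proof (rule has_integral_le[OF lower J])
    fix t
    have "poisson_density \<rho> t * (2 * Re (F (circ t)) - qform T x) \<le> poisson_density \<rho> t * qform T (h (circ t * w))"
      unfolding F_def using poisson_density_nonneg[OF \<rho>] by (intro mult_left_mono qform_ge_tangent T)
    then show "2 * (poisson_density \<rho> t * Re (F (circ t))) - poisson_density \<rho> t * qform T x \<le>
        poisson_density \<rho> t * qform T (h (circ t * w))"
      by (simp add: algebra_simps)
  qed
  moreover have "(\<integral>\<^sup>+t. indicator {0..1} t * ennreal (poisson_density \<rho> t * qform T (h (circ t * w))) \<partial>lborel) = ennreal J"
    using poisson_density_nonneg[OF \<rho>] qform_nonneg[OF T]
    by (intro nn_integral_has_integral_Icc cont J) simp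
  ultimately show ?thesis by (simp add: x_def ennreal_leI)
qed

section \<open>The dilation inequality\<close>

lemma measurable_snd_circle: "snd \<in> (N \<Otimes>\<^sub>M M) \<rightarrow>\<^sub>M (borel :: complex measure)"
  if "sets M = sets circle_borel"
proof -
  have "(\<lambda>\<zeta>. \<zeta>) \<in> circle_borel \<rightarrow>\<^sub>M (borel :: complex measure)"
    unfolding circle_borel_def by (rule measurable_restrict_space1) simp
  then have "(\<lambda>\<zeta>. \<zeta>) \<in> M \<rightarrow>\<^sub>M (borel :: complex measure)"
    using measurable_cong_sets[OF that refl] by blast
  then show ?thesis by (rule measurable_compose[OF measurable_snd])
qed

context semi_spectral
begin

text \<open>
  For fixed \<open>x\<close>, the function \<open>z \<mapsto> q\<^sub>z(x)\<close> is a superposition of Poisson kernels, so Tonelli transfers the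
  semigroup property of the kernel to it.
\<close>

lemma qform_poisson_average:
  assumes z: "z \<in> ball 0 1" and \<rho>: "0 \<le> \<rho>" "\<rho> < 1"
  shows "(\<integral>\<^sup>+t. indicator {0..1} t * ennreal (poisson_density \<rho> t * qform (poisson_integral \<mu> (cnj (circ t) * z)) x) \<partial>lborel) =
    ennreal (qform (poisson_integral \<mu> (of_real \<rho> * z)) x)"
proof -
  let ?M = "scalar_measure \<mu> x"
  interpret M: finite_measure ?M by (rule finite_scalar_measure)
  interpret P: pair_sigma_finite lborel ?M ..
  have zt: "cnj (circ t) * z \<in> ball 0 1" for t using z by (simp add: norm_mult)
  have rz: "of_real \<rho> * z \<in> ball 0 1"
    using z \<rho> mult_left_le_one_le[of "cmod z" \<rho>] by (simp add: norm_mult)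
  let ?f = "\<lambda>t \<zeta>. indicator {0..1} t * ennreal (poisson_density \<rho> t * poisson_kernel (cnj (circ t) * z) \<zeta>)"
  have [measurable]: "snd \<in> (lborel \<Otimes>\<^sub>M ?M) \<rightarrow>\<^sub>M (borel :: complex measure)"
    by (rule measurable_snd_circle) simp
  have [measurable]: "poisson_density \<rho> \<in> borel_measurable borel"
    using \<rho> by (intro borel_measurable_continuous_onI poisson_density_continuous)
  have "(\<lambda>t. cnj (circ t)) \<in> lborel \<rightarrow>\<^sub>M borel"
    by (simp, intro borel_measurable_continuous_onI continuous_on_cnj continuous_on_circ)
  then have [measurable]: "(\<lambda>p. cnj (circ (fst p))) \<in> borel_measurable (lborel \<Otimes>\<^sub>M ?M)"
    by (rule measurable_compose[OF measurable_fst])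
  have meas: "(\<lambda>p. ?f (fst p) (snd p)) \<in> borel_measurable (lborel \<Otimes>\<^sub>M ?M)"
    unfolding poisson_kernel_def by measurable
  have "(\<integral>\<^sup>+t. indicator {0..1} t * ennreal (poisson_density \<rho> t * qform (poisson_integral \<mu> (cnj (circ t) * z)) x) \<partial>lborel) =
      (\<integral>\<^sup>+t. \<integral>\<^sup>+\<zeta>. ?f t \<zeta> \<partial>?M \<partial>lborel)"
  proof (rule nn_integral_cong)
    fix t
    have [measurable]: "poisson_kernel (cnj (circ t) * z) \<in> borel_measurable ?M"
      by (simp add: measurable_cong_sets[OF sets_scalar_measure refl])
    have "(\<integral>\<^sup>+\<zeta>. ?f t \<zeta> \<partial>?M) = (\<integral>\<^sup>+\<zeta>. (indicator {0..1} t * ennreal (poisson_density \<rho> t)) * ennreal (poisson_kernel (cnj (circ t) * z) \<zeta>) \<partial>?M)"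
      by (simp add: ennreal_mult poisson_density_nonneg[OF \<rho>] poisson_kernel_nonneg[OF zt] mult.assoc)
    also have "\<dots> = (indicator {0..1} t * ennreal (poisson_density \<rho> t)) * ennreal (qform (poisson_integral \<mu> (cnj (circ t) * z)) x)"
      unfolding poisson_integral_nn[OF zt] by (rule nn_integral_cmult) measurable
    also have "\<dots> = indicator {0..1} t * ennreal (poisson_density \<rho> t * qform (poisson_integral \<mu> (cnj (circ t) * z)) x)"
      by (simp add: ennreal_mult poisson_density_nonneg[OF \<rho>] qform_nonneg[OF positive_poisson_integral[OF zt]] mult.assoc)
    finally show "indicator {0..1} t * ennreal (poisson_density \<rho> t * qform (poisson_integral \<mu> (cnj (circ t) * z)) x) =
      (\<integral>\<^sup>+\<zeta>. ?f t \<zeta> \<partial>?M)" by simp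
  qed
  also have "\<dots> = (\<integral>\<^sup>+\<zeta>. \<integral>\<^sup>+t. ?f t \<zeta> \<partial>lborel \<partial>?M)"
    using P.Fubini'[of ?f] meas by (simp add: split_beta')
  also have "\<dots> = (\<integral>\<^sup>+\<zeta>. ennreal (poisson_kernel (of_real \<rho> * z) \<zeta>) \<partial>?M)"
    by (rule nn_integral_cong) (rule poisson_kernel_average[OF z _ \<rho>], simp)
  also have "\<dots> = ennreal (qform (poisson_integral \<mu> (of_real \<rho> * z)) x)"
    by (rule poisson_integral_nn[OF rz, symmetric])
  finally show ?thesis .
qed

text \<open>
  Averaging \<open>h\<close> over rotations produces one factor \<open>\<rho>\<close> of the dilation by \<open>\<rho>\<^sup>2\<close>. After exchanging the
  order of integration, the rotation is moved from \<open>h\<close> to the operator by a change of variable that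
  leaves the radial weight alone, and averaging the operator produces a dilation by \<open>\<rho>\<close> of \<open>P\<^sub>\<mu>\<close>.
\<close>

lemma dilation_inequality:
  fixes h :: "complex \<Rightarrow> 'e"
  assumes h: "holomorphic_on_disc h" and \<rho>: "0 \<le> \<rho>" "\<rho> < 1"
  shows "(\<integral>\<^sup>+z. indicator (ball 0 1) z *
        ennreal (qform (poisson_integral \<mu> z) (h (of_real (\<rho>\<^sup>2) * z)) * (1 - (cmod z)\<^sup>2) ^ k) \<partial>lborel) \<le>
    (\<integral>\<^sup>+z. indicator (ball 0 1) z *
        ennreal (qform (poisson_integral \<mu> (of_real \<rho> * z)) (h (of_real \<rho> * z)) * (1 - (cmod z)\<^sup>2) ^ k) \<partial>lborel)"
proof -
  have hc: "continuous_on (ball 0 1) h" by (rule holomorphic_on_disc_continuous[OF h])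
  let ?B = "ball 0 1 :: complex set"
  define \<omega> where "\<omega> z = (1 - (cmod z)\<^sup>2) ^ k" for z
  have \<omega>: "0 \<le> \<omega> z" if "z \<in> ?B" for z
    using that by (auto simp: \<omega>_def power_le_one_iff intro!: zero_le_power)
  have rz: "of_real \<rho> * z \<in> ?B" if "z \<in> ?B" for z :: complex
    using that \<rho> mult_left_le_one_le[of "cmod z" \<rho>] by (simp add: norm_mult)
  have rz': "\<bar>\<rho>\<bar> * cmod z < 1" if "cmod z < 1" for z
    using rz[of z] that by (simp add: norm_mult)
  have ct: "circ t * z \<in> ?B" "cnj (circ t) * z \<in> ?B" if "z \<in> ?B" for t z
    using that by (simp_all add: norm_mult)
  \<comment> \<open>The integrands before and after the rotation: \<open>f t (cnj (circ t) * z) = g t z\<close>.\<close>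
  define f where "f t z = indicator ({0..1} \<times> ?B) (t, z) *
    ennreal (poisson_density \<rho> t * qform (poisson_integral \<mu> z) (h (of_real \<rho> * (circ t * z))) * \<omega> z)" for t z
  define g where "g t z = indicator ({0..1} \<times> ?B) (t, z) *
    ennreal (poisson_density \<rho> t * qform (poisson_integral \<mu> (cnj (circ t) * z)) (h (of_real \<rho> * z)) * \<omega> z)" for t z
  have meas: "(\<lambda>p. indicator ({0..1} \<times> ?B) p * ennreal (\<Phi> (fst p) (snd p))) \<in> borel_measurable (lborel \<Otimes>\<^sub>M lborel)"
    if "continuous_on ({0..1} \<times> ?B) (\<lambda>p. \<Phi> (fst p) (snd p))" for \<Phi> :: "real \<Rightarrow> complex \<Rightarrow> real"
  proof -
    have "(\<lambda>p. indicator ({0..1} \<times> ?B) p *\<^sub>R \<Phi> (fst p) (snd p)) \<in> borel_measurable (borel :: (real \<times> complex) measure)"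
      using that by (intro borel_measurable_continuous_on_indicator) (auto intro!: borel_Times)
    then have "(\<lambda>p. ennreal (indicator ({0..1} \<times> ?B) p *\<^sub>R \<Phi> (fst p) (snd p))) \<in> borel_measurable (lborel \<Otimes>\<^sub>M lborel)"
      unfolding lborel_prod by simp
    also have "(\<lambda>p. ennreal (indicator ({0..1} \<times> ?B) p *\<^sub>R \<Phi> (fst p) (snd p))) =
        (\<lambda>p. indicator ({0..1} \<times> ?B) p * ennreal (\<Phi> (fst p) (snd p)))"
      by (auto simp: indicator_def)
    finally show ?thesis .
  qed
  have cw: "continuous_on S (\<lambda>p. \<omega> (snd p))" for S :: "(real \<times> complex) set"
    unfolding \<omega>_def by (intro continuous_intros)
  have cd: "continuous_on S (\<lambda>p. poisson_density \<rho> (fst p))" for S :: "(real \<times> complex) set"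
    by (rule continuous_on_compose2[OF poisson_density_continuous[OF \<rho>, of UNIV]]) (auto intro: continuous_intros)
  have cc: "continuous_on S (\<lambda>p. circ (fst p))" for S :: "(real \<times> complex) set"
    by (rule continuous_on_compose2[OF continuous_on_circ[of UNIV]]) (auto intro: continuous_intros)
  have fm: "(\<lambda>(t, z). f t z) \<in> borel_measurable (lborel \<Otimes>\<^sub>M lborel)"
    unfolding f_def split_beta' prod.collapse
  proof (rule meas)
    show "continuous_on ({0..1} \<times> ?B) (\<lambda>p. poisson_density \<rho> (fst p) *
        qform (poisson_integral \<mu> (snd p)) (h (of_real \<rho> * (circ (fst p) * snd p))) * \<omega> (snd p))"
      by (intro continuous_on_mult cd cw continuous_on_qform_poisson continuous_on_compose2[OF hc] cc
          continuous_intros) (auto simp del: mem_ball intro!: rz ct)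
  qed
  have gm: "(\<lambda>(t, z). g t z) \<in> borel_measurable (lborel \<Otimes>\<^sub>M lborel)"
    unfolding g_def split_beta' prod.collapse
  proof (rule meas)
    show "continuous_on ({0..1} \<times> ?B) (\<lambda>p. poisson_density \<rho> (fst p) *
        qform (poisson_integral \<mu> (cnj (circ (fst p)) * snd p)) (h (of_real \<rho> * snd p)) * \<omega> (snd p))"
      by (intro continuous_on_mult cd cw continuous_on_qform_poisson continuous_on_compose2[OF hc] cc
          continuous_on_cnj continuous_intros) (auto simp: norm_mult rz')
  qed
  have "(\<integral>\<^sup>+z. indicator ?B z * ennreal (qform (poisson_integral \<mu> z) (h (of_real (\<rho>\<^sup>2) * z)) * \<omega> z) \<partial>lborel) \<le>
      (\<integral>\<^sup>+z. \<integral>\<^sup>+t. f t z \<partial>lborel \<partial>lborel)"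
  proof (rule nn_integral_mono)
    fix z :: complex
    show "indicator ?B z * ennreal (qform (poisson_integral \<mu> z) (h (of_real (\<rho>\<^sup>2) * z)) * \<omega> z) \<le> (\<integral>\<^sup>+t. f t z \<partial>lborel)"
    proof (cases "z \<in> ?B")
      case False then show ?thesis by simp
    next
      case z: True
      let ?q = "\<lambda>t. poisson_density \<rho> t * qform (poisson_integral \<mu> z) (h (circ t * (of_real \<rho> * z)))"
      have q: "0 \<le> ?q t" for t
        using poisson_density_nonneg[OF \<rho>] qform_nonneg[OF positive_poisson_integral[OF z]] by simp
      have cq: "continuous_on {0..1} ?q"
        using z \<rho> by (intro continuous_on_mult poisson_density_continuous continuous_on_qform_poisson
          continuous_on_compose2[OF hc] continuous_intros) (auto simp del: mem_ball intro!: rz ct)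
      then have "(\<lambda>t. ennreal (indicator {0..1} t *\<^sub>R ?q t)) \<in> borel_measurable lborel"
        using borel_measurable_continuous_on_indicator[OF _ cq] by simp
      also have "(\<lambda>t. ennreal (indicator {0..1} t *\<^sub>R ?q t)) = (\<lambda>t. indicator {0..1} t * ennreal (?q t))"
        by (auto simp: indicator_def)
      finally have qm: "(\<lambda>t. indicator {0..1} t * ennreal (?q t)) \<in> borel_measurable lborel" .
      have "ennreal (qform (poisson_integral \<mu> z) (h (of_real (\<rho>\<^sup>2) * z))) \<le> (\<integral>\<^sup>+t. indicator {0..1} t * ennreal (?q t) \<partial>lborel)"
        using qform_subharmonic[OF positive_poisson_integral[OF z] h rz[OF z] \<rho>]
        by (simp add: power2_eq_square mult.assoc)
      then have "ennreal (qform (poisson_integral \<mu> z) (h (of_real (\<rho>\<^sup>2) * z))) * ennreal (\<omega> z) \<le>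
          (\<integral>\<^sup>+t. indicator {0..1} t * ennreal (?q t) \<partial>lborel) * ennreal (\<omega> z)"
        by (rule mult_right_mono) simp
      also have "\<dots> = (\<integral>\<^sup>+t. indicator {0..1} t * ennreal (?q t) * ennreal (\<omega> z) \<partial>lborel)"
        by (rule nn_integral_multc[symmetric, OF qm])
      also have "\<dots> = (\<integral>\<^sup>+t. f t z \<partial>lborel)"
        using z \<omega>[OF z] q by (intro nn_integral_cong)
          (auto simp: f_def indicator_def ennreal_mult' mult_ac simp del: mem_ball)
      finally show ?thesis
        using z \<omega>[OF z] qform_nonneg[OF positive_poisson_integral[OF z]]
        by (simp add: ennreal_mult del: mem_ball)
    qed
  qed
  also have "\<dots> = (\<integral>\<^sup>+t. \<integral>\<^sup>+z. f t z \<partial>lborel \<partial>lborel)"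
    by (rule lborel_pair.Fubini'[OF fm])
  also have "\<dots> = (\<integral>\<^sup>+t. \<integral>\<^sup>+z. g t z \<partial>lborel \<partial>lborel)"
  proof (rule nn_integral_cong)
    fix t :: real
    have "f t \<in> borel_measurable borel"
      using measurable_compose[OF measurable_Pair1' fm, of t] by simp
    then have "(\<integral>\<^sup>+z. f t z \<partial>lborel) = (\<integral>\<^sup>+z. f t (cnj (circ t) * z) \<partial>lborel)"
      by (rule nn_integral_rotation[symmetric]) simp
    also have "\<dots> = (\<integral>\<^sup>+z. g t z \<partial>lborel)"
      by (rule nn_integral_cong) (simp add: f_def g_def indicator_def \<omega>_def norm_mult)
    finally show "(\<integral>\<^sup>+z. f t z \<partial>lborel) = (\<integral>\<^sup>+z. g t z \<partial>lborel)" .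
  qed
  also have "\<dots> = (\<integral>\<^sup>+z. \<integral>\<^sup>+t. g t z \<partial>lborel \<partial>lborel)"
    by (rule lborel_pair.Fubini'[OF gm, symmetric])
  also have "\<dots> = (\<integral>\<^sup>+z. indicator ?B z *
        ennreal (qform (poisson_integral \<mu> (of_real \<rho> * z)) (h (of_real \<rho> * z)) * \<omega> z) \<partial>lborel)"
  proof (rule nn_integral_cong)
    fix z :: complex
    show "(\<integral>\<^sup>+t. g t z \<partial>lborel) = indicator ?B z *
        ennreal (qform (poisson_integral \<mu> (of_real \<rho> * z)) (h (of_real \<rho> * z)) * \<omega> z)"
    proof (cases "z \<in> ?B")
      case False then show ?thesis by (simp add: g_def indicator_def)
    next
      case z: True
      let ?q = "\<lambda>t. poisson_density \<rho> t * qform (poisson_integral \<mu> (cnj (circ t) * z)) (h (of_real \<rho> * z))"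
      have q: "0 \<le> ?q t" for t
        using poisson_density_nonneg[OF \<rho>] qform_nonneg[OF positive_poisson_integral[OF ct(2)[OF z]]] by simp
      have cq: "continuous_on {0..1} ?q"
        using z \<rho> by (intro continuous_on_mult poisson_density_continuous continuous_on_qform_poisson
          continuous_on_const continuous_on_cnj continuous_on_circ) (auto simp: norm_mult)
      then have "(\<lambda>t. ennreal (indicator {0..1} t *\<^sub>R ?q t)) \<in> borel_measurable lborel"
        using borel_measurable_continuous_on_indicator[OF _ cq] by simp
      also have "(\<lambda>t. ennreal (indicator {0..1} t *\<^sub>R ?q t)) = (\<lambda>t. indicator {0..1} t * ennreal (?q t))"
        by (auto simp: indicator_def)
      finally have qm: "(\<lambda>t. indicator {0..1} t * ennreal (?q t)) \<in> borel_measurable lborel" .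
      have "(\<integral>\<^sup>+t. g t z \<partial>lborel) = (\<integral>\<^sup>+t. indicator {0..1} t * ennreal (?q t) * ennreal (\<omega> z) \<partial>lborel)"
        using z \<omega>[OF z] q by (intro nn_integral_cong)
          (auto simp: g_def indicator_def ennreal_mult' mult_ac simp del: mem_ball)
      also have "\<dots> = (\<integral>\<^sup>+t. indicator {0..1} t * ennreal (?q t) \<partial>lborel) * ennreal (\<omega> z)"
        by (rule nn_integral_multc[OF qm])
      also have "\<dots> = ennreal (qform (poisson_integral \<mu> (of_real \<rho> * z)) (h (of_real \<rho> * z))) * ennreal (\<omega> z)"
        by (simp only: qform_poisson_average[OF z \<rho>])
      finally show ?thesis
        using z \<omega>[OF z] qform_nonneg[OF positive_poisson_integral[OF rz[OF z]]]
        by (simp add: ennreal_mult del: mem_ball)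
    qed
  qed
  finally show ?thesis by (simp only: \<omega>_def)
qed

end

section \<open>Power series on the disc\<close>

text \<open>
  Abel's argument: the terms are bounded at a radius strictly between \<open>s\<close> and \<open>1\<close>, so at radius \<open>s\<close>
  they are dominated by a geometric series.
\<close>

lemma power_series_absolutely_summable:
  fixes a :: "nat \<Rightarrow> 'e::complex_hilbert_space"
  assumes f: "has_power_series f a" and s: "0 \<le> s" "s < 1"
  shows "summable (\<lambda>j. norm (a j) * s ^ j)"
proof -
  define t where "t = (s + 1) / 2"
  have t: "s < t" "t < 1" "0 < t" using s by (auto simp: t_def)
  have "summable (\<lambda>j. of_real t ^ j *\<^sub>C a j)"
    using f t unfolding has_power_series_def by (intro sums_summable) (auto dest!: bspec[of _ _ "of_real t"])
  then have "Bseq (\<lambda>j. of_real t ^ j *\<^sub>C a j)"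
    by (intro convergent_imp_Bseq) (auto dest!: summable_LIMSEQ_zero simp: convergent_def)
  then obtain M where M: "\<And>j. norm (of_real t ^ j *\<^sub>C a j) \<le> M" by (auto simp: Bseq_def)
  show ?thesis
  proof (rule summable_comparison_test')
    show "summable (\<lambda>j. M * (s / t) ^ j)"
      using s t by (intro summable_mult summable_geometric) auto
    show "norm (norm (a j) * s ^ j) \<le> M * (s / t) ^ j" if "j \<ge> 0" for j
    proof -
      have "norm (a j) * s ^ j = (t ^ j * norm (a j)) * (s / t) ^ j"
        using t by (simp add: power_divide)
      also have "\<dots> \<le> M * (s / t) ^ j"
        using M[of j] s t by (intro mult_right_mono) (auto simp: norm_power)
      finally show ?thesis using s by simp
    qed
  qed
qed

definition diff_coeffs :: "(nat \<Rightarrow> 'e::real_vector) \<Rightarrow> nat \<Rightarrow> 'e" where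
  "diff_coeffs a j = real (Suc j) *\<^sub>R a (Suc j)"

lemma iterate_diff_coeffs:
  "(diff_coeffs ^^ n) a j = (fact (j + n) / fact j) *\<^sub>R a (j + n)"
proof (induction n arbitrary: j)
  case (Suc n)
  then show ?case by (simp add: diff_coeffs_def fact_reduce[of "Suc j"] del: of_nat_Suc)
qed simp

lemma summable_diff_coeffs:
  fixes a :: "nat \<Rightarrow> 'e::complex_hilbert_space"
  assumes "has_power_series f a" "0 \<le> s" "s < 1"
  shows "summable (\<lambda>j. norm (diff_coeffs a j) * s ^ j)"
proof -
  have sm: "summable (\<lambda>n. norm (a n) * x ^ n)" if "norm x < 1" for x :: real
  proof (rule summable_norm_cancel)
    show "summable (\<lambda>n. norm (norm (a n) * x ^ n))"
      using power_series_absolutely_summable[OF assms(1), of "\<bar>x\<bar>"] that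
      by (simp add: abs_mult power_abs)
  qed
  have "summable (\<lambda>n. diffs (\<lambda>n. norm (a n)) n * s ^ n)"
    by (rule termdiff_converges[OF _ sm]) (use assms in auto)
  then show ?thesis by (simp add: diffs_def diff_coeffs_def del: of_nat_Suc)
qed

text \<open>
  Termwise differentiation: the differentiated series converges uniformly on a disc around \<open>0\<close>
  that contains \<open>z\<close>.
\<close>

lemma power_series_has_derivative:
  fixes a :: "nat \<Rightarrow> 'e::complex_hilbert_space"
  assumes f: "has_power_series f a" and z: "z \<in> ball 0 1"
  shows "(\<lambda>j. z ^ j *\<^sub>C diff_coeffs a j) sums (\<Sum>j. z ^ j *\<^sub>C diff_coeffs a j)"
    and "has_complex_derivative_at f (\<Sum>j. z ^ j *\<^sub>C diff_coeffs a j) z"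
proof -
  define s where "s = (cmod z + 1) / 2"
  have s: "cmod z < s" "s < 1" "0 \<le> s" using z by (auto simp: s_def)
  let ?S = "ball (0::complex) s"
  have zS: "z \<in> ?S" using s by simp
  define D where "D i w = (of_nat i * w ^ (i - 1)) *\<^sub>C a i" for i and w :: complex
  have D_Suc: "D (Suc j) w = w ^ j *\<^sub>C diff_coeffs a j" for j w
    by (simp add: D_def diff_coeffs_def scaleC_of_real[symmetric] scaleC_scaleC mult.commute del: of_nat_Suc)
  have sumD: "summable (\<lambda>j. norm (diff_coeffs a j) * s ^ j)"
    using f s by (intro summable_diff_coeffs) auto
  define M where "M i = (case i of 0 \<Rightarrow> 0 | Suc j \<Rightarrow> norm (diff_coeffs a j) * s ^ j)" for i
  have M: "summable M"
    using sumD by (subst summable_Suc_iff[symmetric]) (simp add: M_def)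
  have DM: "norm (D i w) \<le> M i" if "w \<in> ?S" for i w
  proof (cases i)
    case 0 then show ?thesis by (simp add: D_def M_def)
  next
    case (Suc j)
    have "cmod w ^ j \<le> s ^ j" using that by (intro power_mono) auto
    then show ?thesis
      unfolding Suc D_Suc by (simp add: M_def norm_power mult.commute mult_right_mono)
  qed
  define G where "G w = (\<Sum>i. D i w)" for w
  have unif: "uniform_limit ?S (\<lambda>n w. \<Sum>i<n. D i w) G sequentially"
    unfolding G_def using DM M by (rule Weierstrass_m_test)
  have "\<exists>g. \<forall>w\<in>?S. (\<lambda>i. w ^ i *\<^sub>C a i) sums g w \<and> (g has_derivative (\<lambda>h. h *\<^sub>C G w)) (at w within ?S)"
  proof (rule has_derivative_series)
    show "convex ?S" by simp
    show "((\<lambda>w. w ^ i *\<^sub>C a i) has_derivative (\<lambda>h. h *\<^sub>C D i w)) (at w within ?S)" for i w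
    proof -
      have "((\<lambda>w. w ^ i) has_derivative (\<lambda>h. (of_nat i * w ^ (i - 1)) * h)) (at w within ?S)"
        unfolding has_field_derivative_def[symmetric] by (auto intro!: derivative_eq_intros)
      then have "((\<lambda>w. w ^ i *\<^sub>C a i) has_derivative (\<lambda>h. ((of_nat i * w ^ (i - 1)) * h) *\<^sub>C a i)) (at w within ?S)"
        by (rule bounded_linear.has_derivative[OF scaleC.bounded_linear_left])
      then show ?thesis by (simp add: D_def scaleC_scaleC mult.commute)
    qed
    show "z \<in> ?S" by (rule zS)
    show "(\<lambda>i. z ^ i *\<^sub>C a i) sums f z" using f z by (auto simp: has_power_series_def)
    show "\<forall>\<^sub>F n in sequentially. \<forall>w\<in>?S. \<forall>h. norm ((\<Sum>i<n. h *\<^sub>C D i w) - h *\<^sub>C G w) \<le> e * norm h"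
      if "e > 0" for e
      using uniform_limitD[OF unif that]
    proof eventually_elim
      case (elim n)
      show ?case
      proof (intro ballI allI)
        fix w h assume "w \<in> ?S"
        then have "norm ((\<Sum>i<n. D i w) - G w) \<le> e" using elim by (force simp: dist_norm)
        then have "norm (h *\<^sub>C ((\<Sum>i<n. D i w) - G w)) \<le> e * norm h"
          by (simp add: mult.commute[of e] mult_left_mono)
        then show "norm ((\<Sum>i<n. h *\<^sub>C D i w) - h *\<^sub>C G w) \<le> e * norm h"
          by (simp add: scaleC.diff_right scaleC.sum_right)
      qed
    qed
  qed
  then obtain g where g: "\<And>w. w \<in> ?S \<Longrightarrow> (\<lambda>i. w ^ i *\<^sub>C a i) sums g w"
    "\<And>w. w \<in> ?S \<Longrightarrow> (g has_derivative (\<lambda>h. h *\<^sub>C G w)) (at w within ?S)" by blast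
  have fg: "g w = f w" if "w \<in> ?S" for w
  proof -
    have "w \<in> ball 0 1" using that s by auto
    then have "(\<lambda>i. w ^ i *\<^sub>C a i) sums f w" using f unfolding has_power_series_def by blast
    with g(1)[OF that] show ?thesis by (rule sums_unique2)
  qed
  have "(g has_derivative (\<lambda>h. h *\<^sub>C G z)) (at z)"
    using g(2)[OF zS] unfolding at_within_open[OF zS open_ball] .
  then have der: "(f has_derivative (\<lambda>h. h *\<^sub>C G z)) (at z)"
    by (rule has_derivative_transform_within_open[OF _ open_ball zS]) (use fg in auto)
  have "summable (\<lambda>i. D i z)"
    by (rule summable_comparison_test'[OF M, of 0]) (rule DM[OF zS])
  then have "(\<lambda>j. D (Suc j) z) sums (G z - D 0 z)"
    using sums_Suc_iff[of "\<lambda>i. D i z" "G z - D 0 z"] summable_sums[of "\<lambda>i. D i z"]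
    by (simp add: G_def)
  then have "(\<lambda>j. z ^ j *\<^sub>C diff_coeffs a j) sums G z" unfolding D_Suc by (simp add: D_def)
  moreover from this have "(\<Sum>j. z ^ j *\<^sub>C diff_coeffs a j) = G z" by (rule sums_unique[symmetric])
  ultimately show "(\<lambda>j. z ^ j *\<^sub>C diff_coeffs a j) sums (\<Sum>j. z ^ j *\<^sub>C diff_coeffs a j)"
    "has_complex_derivative_at f (\<Sum>j. z ^ j *\<^sub>C diff_coeffs a j) z"
    using der by (simp_all add: has_complex_derivative_at_def)
qed

lemma complex_derivative_eqI:
  assumes "has_complex_derivative_at f v z"
  shows "complex_derivative f z = v"
  unfolding complex_derivative_def
proof (rule the_equality)
  show "has_complex_derivative_at f v z" by (rule assms)
  fix w assume "has_complex_derivative_at f w z"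
  then have "(\<lambda>h. h *\<^sub>C w) = (\<lambda>h. h *\<^sub>C v)"
    using assms has_derivative_unique unfolding has_complex_derivative_at_def by blast
  then show "w = v" by (metis scaleC_one)
qed

lemma has_power_series_derivative:
  fixes a :: "nat \<Rightarrow> 'e::complex_hilbert_space"
  assumes "has_power_series f a"
  shows "has_power_series (complex_derivative f) (diff_coeffs a)"
  unfolding has_power_series_def
proof
  fix z :: complex assume z: "z \<in> ball 0 1"
  show "(\<lambda>j. z ^ j *\<^sub>C diff_coeffs a j) sums complex_derivative f z"
    unfolding complex_derivative_eqI[OF power_series_has_derivative(2)[OF assms z]]
    by (rule power_series_has_derivative(1)[OF assms z])
qed

lemma has_power_series_iterated_derivative:
  fixes a :: "nat \<Rightarrow> 'e::complex_hilbert_space"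
  assumes "has_power_series f a"
  shows "has_power_series ((complex_derivative ^^ n) f) ((diff_coeffs ^^ n) a)"
  by (induction n) (auto intro: assms has_power_series_derivative)

lemma has_power_series_holomorphic:
  fixes a :: "nat \<Rightarrow> 'e::complex_hilbert_space"
  assumes "has_power_series f a"
  shows "holomorphic_on_disc f"
  unfolding holomorphic_on_disc_def using power_series_has_derivative(2)[OF assms] by blast

text \<open>
  The coefficients are read off from the iterated derivatives at \<open>0\<close>.
\<close>

lemma has_power_series_unique:
  fixes a :: "nat \<Rightarrow> 'e::complex_hilbert_space"
  assumes a: "has_power_series f a" and b: "has_power_series f b"
  shows "a = b"
proof
  fix n
  have 0: "g 0 = c 0" if "has_power_series g c" for g and c :: "nat \<Rightarrow> 'e"
  proof -
    have "(\<lambda>j. 0 ^ j *\<^sub>C c j) sums g 0" using that by (auto simp: has_power_series_def)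
    moreover have "(\<lambda>j. 0 ^ j *\<^sub>C c j) sums (0 ^ 0 *\<^sub>C c 0)"
      using sums_finite[of "{0}" "\<lambda>j. 0 ^ j *\<^sub>C c j"] by (simp add: zero_power)
    ultimately show ?thesis using sums_unique2 by fastforce
  qed
  have "(diff_coeffs ^^ n) a 0 = (diff_coeffs ^^ n) b 0"
    using 0[OF has_power_series_iterated_derivative[OF a]] 0[OF has_power_series_iterated_derivative[OF b]] by metis
  then show "a n = b n" by (simp add: iterate_diff_coeffs)
qed

lemma has_power_series_add:
  "has_power_series f a \<Longrightarrow> has_power_series g b \<Longrightarrow> has_power_series (\<lambda>z. f z + g z) (\<lambda>j. a j + b j)"
  unfolding has_power_series_def by (simp add: scaleC_add_right sums_add)

lemma has_power_series_diff:
  "has_power_series f a \<Longrightarrow> has_power_series g b \<Longrightarrow> has_power_series (\<lambda>z. f z - g z) (\<lambda>j. a j - b j)"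
  unfolding has_power_series_def by (simp add: scaleC.diff_right sums_diff)

lemma has_power_series_dilation:
  assumes "has_power_series f a" "0 \<le> r" "r \<le> 1"
  shows "has_power_series (dilation r f) (\<lambda>j. r ^ j *\<^sub>R a j)"
  unfolding has_power_series_def
proof
  fix z :: complex assume z: "z \<in> ball 0 1"
  then have "of_real r * z \<in> ball 0 1"
    using assms mult_left_le_one_le[of "cmod z" r] by (simp add: norm_mult)
  then have "(\<lambda>j. (of_real r * z) ^ j *\<^sub>C a j) sums dilation r f z"
    using assms(1) by (auto simp: has_power_series_def dilation_def)
  moreover have "(of_real r * z) ^ j *\<^sub>C a j = z ^ j *\<^sub>C (r ^ j *\<^sub>R a j)" for j
    by (simp add: power_mult_distrib scaleC_scaleC scaleC_of_real[symmetric] mult.commute)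
  ultimately show "(\<lambda>j. z ^ j *\<^sub>C (r ^ j *\<^sub>R a j)) sums dilation r f z" by simp
qed

lemma has_power_series_polynomial:
  "has_power_series (\<lambda>z. \<Sum>k\<le>N. z ^ k *\<^sub>C a k) (\<lambda>k. if k \<le> N then a k else 0)"
  unfolding has_power_series_def
proof
  fix z :: complex
  have "(\<lambda>k. z ^ k *\<^sub>C (if k \<le> N then a k else 0)) sums (\<Sum>k\<le>N. z ^ k *\<^sub>C (if k \<le> N then a k else 0))"
    by (rule sums_finite) (auto simp: scaleC.zero_right)
  then show "(\<lambda>k. z ^ k *\<^sub>C (if k \<le> N then a k else 0)) sums (\<Sum>k\<le>N. z ^ k *\<^sub>C a k)" by simp
qed

lemma power_series_sum_unique:
  "has_power_series f a \<Longrightarrow> z \<in> ball 0 1 \<Longrightarrow> (\<lambda>j. z ^ j *\<^sub>C a j) sums s \<Longrightarrow> f z = s"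
  by (metis has_power_series_def sums_unique2)

lemma iterated_derivative_add:
  fixes a b :: "nat \<Rightarrow> 'e::complex_hilbert_space"
  assumes f: "has_power_series f a" and g: "has_power_series g b" and z: "z \<in> ball 0 1"
  shows "(complex_derivative ^^ n) (\<lambda>z. f z + g z) z = (complex_derivative ^^ n) f z + (complex_derivative ^^ n) g z"
proof (rule power_series_sum_unique[OF has_power_series_iterated_derivative[OF has_power_series_add[OF f g]] z])
  have "(\<lambda>j. z ^ j *\<^sub>C ((diff_coeffs ^^ n) a j + (diff_coeffs ^^ n) b j)) sums
      ((complex_derivative ^^ n) f z + (complex_derivative ^^ n) g z)"
    using has_power_series_add[OF has_power_series_iterated_derivative[OF f] has_power_series_iterated_derivative[OF g]] z
    unfolding has_power_series_def by blast
  then show "(\<lambda>j. z ^ j *\<^sub>C (diff_coeffs ^^ n) (\<lambda>j. a j + b j) j) sums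
      ((complex_derivative ^^ n) f z + (complex_derivative ^^ n) g z)"
    by (simp add: iterate_diff_coeffs scaleR_add_right)
qed

lemma iterated_derivative_diff:
  fixes a b :: "nat \<Rightarrow> 'e::complex_hilbert_space"
  assumes f: "has_power_series f a" and g: "has_power_series g b" and z: "z \<in> ball 0 1"
  shows "(complex_derivative ^^ n) (\<lambda>z. f z - g z) z = (complex_derivative ^^ n) f z - (complex_derivative ^^ n) g z"
proof (rule power_series_sum_unique[OF has_power_series_iterated_derivative[OF has_power_series_diff[OF f g]] z])
  have "(\<lambda>j. z ^ j *\<^sub>C ((diff_coeffs ^^ n) a j - (diff_coeffs ^^ n) b j)) sums
      ((complex_derivative ^^ n) f z - (complex_derivative ^^ n) g z)"
    using has_power_series_diff[OF has_power_series_iterated_derivative[OF f] has_power_series_iterated_derivative[OF g]] z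
    unfolding has_power_series_def by blast
  then show "(\<lambda>j. z ^ j *\<^sub>C (diff_coeffs ^^ n) (\<lambda>j. a j - b j) j) sums
      ((complex_derivative ^^ n) f z - (complex_derivative ^^ n) g z)"
    by (simp add: iterate_diff_coeffs scaleR_diff_right)
qed

lemma iterated_derivative_dilation:
  fixes a :: "nat \<Rightarrow> 'e::complex_hilbert_space"
  assumes f: "has_power_series f a" and r: "0 \<le> r" "r \<le> 1" and z: "z \<in> ball 0 1"
  shows "(complex_derivative ^^ n) (dilation r f) z = r ^ n *\<^sub>R (complex_derivative ^^ n) f (of_real r * z)"
proof (rule power_series_sum_unique[OF has_power_series_iterated_derivative[OF has_power_series_dilation[OF f r]] z])
  have "(\<lambda>j. z ^ j *\<^sub>C (r ^ j *\<^sub>R (diff_coeffs ^^ n) a j)) sums (complex_derivative ^^ n) f (of_real r * z)"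
    using has_power_series_dilation[OF has_power_series_iterated_derivative[OF f] r] z
    unfolding has_power_series_def dilation_def by blast
  then have "(\<lambda>j. r ^ n *\<^sub>R (z ^ j *\<^sub>C (r ^ j *\<^sub>R (diff_coeffs ^^ n) a j))) sums
      (r ^ n *\<^sub>R (complex_derivative ^^ n) f (of_real r * z))"
    by (rule sums_scaleR_right)
  then show "(\<lambda>j. z ^ j *\<^sub>C (diff_coeffs ^^ n) (\<lambda>j. r ^ j *\<^sub>R a j) j) sums
      (r ^ n *\<^sub>R (complex_derivative ^^ n) f (of_real r * z))"
    by (simp add: iterate_diff_coeffs scaleC_scaleR power_add mult_ac)
qed

text \<open>
  The majorant does not depend on \<open>z\<close>, and tends to \<open>0\<close> with the order of the remainder (\<open>iterated_derivative_tail_tendsto\<close>);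
  this is the uniform convergence of the derivatives of Taylor polynomials on compact discs.
\<close>

lemma iterated_derivative_tail_le:
  fixes a :: "nat \<Rightarrow> 'e::complex_hilbert_space"
  assumes g: "has_power_series g (\<lambda>j. if j \<le> N then 0 else a j)" and f: "has_power_series f a"
    and s: "0 \<le> s" "s < 1" and z: "cmod z \<le> s"
  shows "norm ((complex_derivative ^^ n) g z) \<le> (\<Sum>j. if j + n \<le> N then 0 else norm ((diff_coeffs ^^ n) a j) * s ^ j)"
proof -
  let ?c = "\<lambda>j. if j + n \<le> N then 0 else norm ((diff_coeffs ^^ n) a j) * s ^ j"
  have zb: "z \<in> ball 0 1" using s z by simp
  have sums: "(\<lambda>j. z ^ j *\<^sub>C (diff_coeffs ^^ n) (\<lambda>j. if j \<le> N then 0 else a j) j) sums (complex_derivative ^^ n) g z"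
    using has_power_series_iterated_derivative[OF g] zb by (auto simp: has_power_series_def)
  have le: "norm (z ^ j *\<^sub>C (diff_coeffs ^^ n) (\<lambda>j. if j \<le> N then 0 else a j) j) \<le> ?c j" for j
  proof (cases "j + n \<le> N")
    case True then show ?thesis by (simp add: iterate_diff_coeffs scaleC.zero_right)
  next
    case False
    then have "norm (z ^ j *\<^sub>C (diff_coeffs ^^ n) (\<lambda>j. if j \<le> N then 0 else a j) j) =
        norm ((diff_coeffs ^^ n) a j) * cmod z ^ j"
      by (simp add: iterate_diff_coeffs norm_power)
    also have "\<dots> \<le> norm ((diff_coeffs ^^ n) a j) * s ^ j"
      using z by (intro mult_left_mono power_mono) auto
    finally show ?thesis using False by simp
  qed
  have "summable (\<lambda>j. norm ((diff_coeffs ^^ n) a j) * s ^ j)"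
    using power_series_absolutely_summable[OF has_power_series_iterated_derivative[OF f] s] .
  then have sc: "summable ?c"
    using s by (rule_tac summable_comparison_test'[where N = 0]) auto
  then show ?thesis
    unfolding sums_unique[OF sums] by (intro norm_suminf_le le)
qed

lemma iterated_derivative_tail_tendsto:
  fixes a :: "nat \<Rightarrow> 'e::complex_hilbert_space"
  assumes f: "has_power_series f a" and s: "0 \<le> s" "s < 1"
  shows "(\<lambda>N. \<Sum>j. if j + n \<le> N then 0 else norm ((diff_coeffs ^^ n) a j) * s ^ j) \<longlonglongrightarrow> 0"
proof -
  have "(\<lambda>N. \<Sum>j. if j + n \<le> N then 0 else norm ((diff_coeffs ^^ n) a j) * s ^ j) \<longlonglongrightarrow> (\<Sum>j::nat. 0::real)"
  proof (rule tannerys_theorem[THEN conjunct2, THEN conjunct2])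
    show "summable (\<lambda>j. norm ((diff_coeffs ^^ n) a j) * s ^ j)"
      using power_series_absolutely_summable[OF has_power_series_iterated_derivative[OF f] s] .
    show "(\<lambda>N. if j + n \<le> N then 0 else norm ((diff_coeffs ^^ n) a j) * s ^ j) \<longlonglongrightarrow> 0" for j
      by (rule tendsto_eventually) (auto simp: eventually_sequentially)
    show "eventually (\<lambda>(j, N). norm (if j + n \<le> N then 0 else norm ((diff_coeffs ^^ n) a j) * s ^ j) \<le>
        norm ((diff_coeffs ^^ n) a j) * s ^ j) (at_top \<times>\<^sub>F sequentially)"
      using s by (intro always_eventually) auto
  qed auto
  then show ?thesis by simp
qed

section \<open>The Hardy norm\<close>

lemma hardy_norm_sq_eq:
  fixes a :: "nat \<Rightarrow> 'e::complex_hilbert_space"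
  assumes "has_power_series f a"
  shows "hardy_norm_sq f = (\<Sum>j. (norm (a j))\<^sup>2)"
proof -
  have "(THE a. has_power_series f a) = a"
    using assms has_power_series_unique by (intro the_equality) blast+
  then show ?thesis by (simp add: hardy_norm_sq_def)
qed

lemma norm_add_sq_le: "(norm (x + y))\<^sup>2 \<le> 2 * (norm x)\<^sup>2 + 2 * (norm (y::'a::real_normed_vector))\<^sup>2"
proof -
  have "(norm (x + y))\<^sup>2 \<le> (norm x + norm y)\<^sup>2" by (intro power_mono norm_triangle_ineq) auto
  also have "\<dots> \<le> 2 * (norm x)\<^sup>2 + 2 * (norm y)\<^sup>2"
    using sum_squares_bound[of "norm x" "norm y"] by (simp add: power2_sum)
  finally show ?thesis .
qed

lemma hardy_add_le:
  fixes a b :: "nat \<Rightarrow> 'e::complex_hilbert_space"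
  assumes f: "has_power_series f a" and g: "has_power_series g b"
    and a: "summable (\<lambda>j. (norm (a j))\<^sup>2)" and b: "summable (\<lambda>j. (norm (b j))\<^sup>2)"
  shows "summable (\<lambda>j. (norm (a j + b j))\<^sup>2)"
    and "hardy_norm_sq (\<lambda>z. f z + g z) \<le> 2 * hardy_norm_sq f + 2 * hardy_norm_sq g"
proof -
  have s: "summable (\<lambda>j. 2 * (norm (a j))\<^sup>2 + 2 * (norm (b j))\<^sup>2)"
    by (rule summable_add[OF summable_mult[OF a] summable_mult[OF b]])
  show sab: "summable (\<lambda>j. (norm (a j + b j))\<^sup>2)"
    by (rule summable_comparison_test'[OF s, of 0]) (use norm_add_sq_le in auto)
  have "(\<Sum>j. (norm (a j + b j))\<^sup>2) \<le> (\<Sum>j. 2 * (norm (a j))\<^sup>2 + 2 * (norm (b j))\<^sup>2)"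
    by (intro suminf_le norm_add_sq_le sab s)
  also have "\<dots> = 2 * hardy_norm_sq f + 2 * hardy_norm_sq g"
    unfolding hardy_norm_sq_eq[OF f] hardy_norm_sq_eq[OF g]
    by (simp only: suminf_add[symmetric] summable_mult a b suminf_mult)
  finally show "hardy_norm_sq (\<lambda>z. f z + g z) \<le> 2 * hardy_norm_sq f + 2 * hardy_norm_sq g"
    unfolding hardy_norm_sq_eq[OF has_power_series_add[OF f g]] .
qed

text \<open>
  Dominated convergence for coefficient multipliers bounded by \<open>1\<close>. It serves both for
  \<open>f\<^sub>r - f\<close>, with multipliers \<open>r\<^sup>j - 1\<close>, and for dilated Taylor remainders, with multipliers \<open>0\<close> and \<open>-r\<^sup>j\<close>.
\<close>

lemma hardy_multiplier_tendsto_0: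
  fixes a :: "nat \<Rightarrow> 'e::complex_hilbert_space"
  assumes a: "summable (\<lambda>j. (norm (a j))\<^sup>2)" and F: "F \<noteq> bot"
    and lim: "\<And>j. ((\<lambda>x. c x j) \<longlongrightarrow> 0) F" and bound: "eventually (\<lambda>x. \<forall>j. \<bar>c x j\<bar> \<le> 1) F"
    and f: "eventually (\<lambda>x. has_power_series (f x) (\<lambda>j. c x j *\<^sub>R a j)) F"
  shows "((\<lambda>x. hardy_norm_sq (f x)) \<longlongrightarrow> 0) F"
proof -
  have "((\<lambda>x. \<Sum>j. (norm (c x j *\<^sub>R a j))\<^sup>2) \<longlongrightarrow> (\<Sum>j::nat. 0::real)) F"
  proof (rule tannerys_theorem[THEN conjunct2, THEN conjunct2])
    show "((\<lambda>x. (norm (c x j *\<^sub>R a j))\<^sup>2) \<longlongrightarrow> 0) F" for j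
    proof -
      have "((\<lambda>x. (norm (c x j *\<^sub>R a j))\<^sup>2) \<longlongrightarrow> (norm (0 *\<^sub>R a j))\<^sup>2) F"
        by (intro tendsto_intros lim)
      then show ?thesis by simp
    qed
    have ev: "eventually (\<lambda>x. \<forall>j. norm ((norm (c x j *\<^sub>R a j))\<^sup>2) \<le> (norm (a j))\<^sup>2) F"
      using bound
    proof eventually_elim
      case (elim x)
      then show ?case by (auto simp: power_mult_distrib abs_square_le_1 intro!: mult_left_le_one_le)
    qed
    show "eventually (\<lambda>(j, x). norm ((norm (c x j *\<^sub>R a j))\<^sup>2) \<le> (norm (a j))\<^sup>2) (at_top \<times>\<^sub>F F)"
      by (rule eventually_mono[OF eventually_prodI[OF eventually_True ev]]) auto
  qed (use a F in auto)
  then have "((\<lambda>x. \<Sum>j. (norm (c x j *\<^sub>R a j))\<^sup>2) \<longlongrightarrow> 0) F" by simp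
  then show ?thesis
    by (rule Lim_transform_eventually) (use f in eventually_elim, simp add: hardy_norm_sq_eq)
qed

section \<open>Energies with Poisson weights\<close>

lemma of_real_mult_in_ball:
  "0 \<le> r \<Longrightarrow> r \<le> 1 \<Longrightarrow> z \<in> ball 0 1 \<Longrightarrow> of_real r * z \<in> ball (0::complex) 1"
  using mult_left_le_one_le[of "cmod z" r] by (simp add: norm_mult)

context semi_spectral
begin

text \<open>
  The Dirichlet integral of order \<open>k + 1\<close> without its normalizing constant, as a function of the
  derivative of that order.
\<close>

definition energy :: "nat \<Rightarrow> (complex \<Rightarrow> 'e) \<Rightarrow> ennreal" where
  "energy k h = (\<integral>\<^sup>+z. indicator (ball 0 1) z *
     ennreal (qform (poisson_integral \<mu> z) (h z) * (1 - (cmod z)\<^sup>2) ^ k) \<partial>lborel)"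

lemma energy_measurable:
  assumes "continuous_on (ball 0 1) h"
  shows "(\<lambda>z. indicator (ball 0 1) z *
     ennreal (qform (poisson_integral \<mu> z) (h z) * (1 - (cmod z)\<^sup>2) ^ k)) \<in> borel_measurable borel"
proof -
  let ?F = "\<lambda>z. qform (poisson_integral \<mu> z) (h z) * (1 - (cmod z)\<^sup>2) ^ k"
  have "continuous_on (ball 0 1) ?F"
    using assms by (intro continuous_on_mult continuous_on_qform_poisson continuous_intros) auto
  then have "(\<lambda>z. ennreal (indicator (ball 0 1) z *\<^sub>R ?F z)) \<in> borel_measurable borel"
    using borel_measurable_continuous_on_indicator[of "ball 0 1" ?F] by simp
  also have "(\<lambda>z. ennreal (indicator (ball 0 1) z *\<^sub>R ?F z)) = (\<lambda>z. indicator (ball 0 1) z * ennreal (?F z))"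
    by (auto simp: indicator_def)
  finally show ?thesis .
qed

lemma weight_nonneg: "z \<in> ball 0 1 \<Longrightarrow> 0 \<le> (1 - (cmod z)\<^sup>2) ^ k"
  by (intro zero_le_power) (simp add: power_le_one_iff)

lemma qform_poisson_nonneg: "z \<in> ball 0 1 \<Longrightarrow> 0 \<le> qform (poisson_integral \<mu> z) x"
  by (rule qform_nonneg[OF positive_poisson_integral])

lemma energy_cong: "(\<And>z. z \<in> ball 0 1 \<Longrightarrow> g z = h z) \<Longrightarrow> energy k g = energy k h"
  unfolding energy_def by (intro nn_integral_cong) (auto simp: indicator_def)

lemma energy_scaleR:
  assumes "continuous_on (ball 0 1) h"
  shows "energy k (\<lambda>z. c *\<^sub>R h z) = ennreal (c\<^sup>2) * energy k h"
proof -
  have "energy k (\<lambda>z. c *\<^sub>R h z) = (\<integral>\<^sup>+z. ennreal (c\<^sup>2) * (indicator (ball 0 1) z *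
     ennreal (qform (poisson_integral \<mu> z) (h z) * (1 - (cmod z)\<^sup>2) ^ k)) \<partial>lborel)"
    unfolding energy_def
    by (intro nn_integral_cong) (auto simp: qform_scaleR ennreal_mult' mult_ac indicator_def)
  also have "\<dots> = ennreal (c\<^sup>2) * energy k h"
    unfolding energy_def using energy_measurable[OF assms] by (intro nn_integral_cmult) simp
  finally show ?thesis .
qed

lemma energy_parallelogram:
  assumes g: "continuous_on (ball 0 1) g" and h: "continuous_on (ball 0 1) h"
  shows "energy k (\<lambda>z. g z + h z) + energy k (\<lambda>z. g z - h z) = 2 * energy k g + 2 * energy k h"
proof -
  let ?I = "\<lambda>h z. indicator (ball 0 1) z * ennreal (qform (poisson_integral \<mu> z) (h z) * (1 - (cmod z)\<^sup>2) ^ k)"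
  have m: "?I u \<in> borel_measurable lborel" if "continuous_on (ball 0 1) u" for u
    using energy_measurable[OF that] by simp
  have "energy k (\<lambda>z. g z + h z) + energy k (\<lambda>z. g z - h z) =
      (\<integral>\<^sup>+z. ?I (\<lambda>z. g z + h z) z + ?I (\<lambda>z. g z - h z) z \<partial>lborel)"
    unfolding energy_def
    by (rule nn_integral_add[symmetric]; rule m; intro continuous_intros g h)
  also have "\<dots> = (\<integral>\<^sup>+z. 2 * ?I g z + 2 * ?I h z \<partial>lborel)"
  proof (rule nn_integral_cong)
    fix z
    show "?I (\<lambda>z. g z + h z) z + ?I (\<lambda>z. g z - h z) z = 2 * ?I g z + 2 * ?I h z"
    proof (cases "z \<in> ball 0 1")
      case True
      let ?w = "(1 - (cmod z)\<^sup>2) ^ k" and ?q = "qform (poisson_integral \<mu> z)"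
      have "ennreal (?q (g z + h z) * ?w) + ennreal (?q (g z - h z) * ?w) =
          ennreal ((?q (g z + h z) + ?q (g z - h z)) * ?w)"
        using weight_nonneg[OF True] qform_poisson_nonneg[OF True] by (simp add: distrib_right)
      also have "\<dots> = ennreal (2 * (?q (g z) * ?w) + 2 * (?q (h z) * ?w))"
        unfolding qform_parallelogram[OF poisson_integral(1)[OF True]] by (simp add: algebra_simps)
      also have "\<dots> = ennreal 2 * ennreal (?q (g z) * ?w) + ennreal 2 * ennreal (?q (h z) * ?w)"
        using weight_nonneg[OF True, of k] qform_poisson_nonneg[OF True] by (simp add: ennreal_mult)
      finally show ?thesis using True by simp
    qed simp
  qed
  also have "\<dots> = 2 * energy k g + 2 * energy k h"
    unfolding energy_def using m[OF g] m[OF h] by (simp add: nn_integral_add nn_integral_cmult)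
  finally show ?thesis .
qed

lemma energy_dilation_aux:
  assumes h: "holomorphic_on_disc h" and r: "0 < r" "r < 1"
  shows "energy k (\<lambda>z. h (of_real r * z)) \<le> (\<integral>\<^sup>+z. indicator (ball 0 1) z *
     ennreal (qform (poisson_integral \<mu> (of_real (sqrt r) * z)) (h (of_real (sqrt r) * z)) * (1 - (cmod z)\<^sup>2) ^ k) \<partial>lborel)"
  using dilation_inequality[OF h, of "sqrt r" k] r
  unfolding energy_def by simp

text \<open>
  Substituting \<open>w = \<surd>r z\<close> on the right of the dilation inequality costs the Jacobian \<open>1/r\<close>; the radial
  weight only grows when \<open>z\<close> moves towards the centre.
\<close>

lemma energy_dilation_le:
  assumes h: "holomorphic_on_disc h" and r: "0 < r" "r < 1"
  shows "ennreal r * energy k (\<lambda>z. h (of_real r * z)) \<le> energy k h"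
proof -
  let ?F = "\<lambda>z. indicator (ball 0 1) z * ennreal (qform (poisson_integral \<mu> z) (h z) * (1 - (cmod z)\<^sup>2) ^ k)"
  have "energy k (\<lambda>z. h (of_real r * z)) \<le> (\<integral>\<^sup>+z. ?F (of_real (sqrt r) * z) \<partial>lborel)"
  proof (rule order_trans[OF energy_dilation_aux[OF h r] nn_integral_mono])
    fix z :: complex
    show "indicator (ball 0 1) z *
     ennreal (qform (poisson_integral \<mu> (of_real (sqrt r) * z)) (h (of_real (sqrt r) * z)) * (1 - (cmod z)\<^sup>2) ^ k) \<le>
     ?F (of_real (sqrt r) * z)"
    proof (cases "z \<in> ball 0 1")
      case True
      have le: "cmod (of_real (sqrt r) * z) \<le> cmod z"
        using r by (simp add: norm_mult mult_left_le_one_le)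
      then have b: "of_real (sqrt r) * z \<in> ball 0 1" using True by simp
      have "(1 - (cmod z)\<^sup>2) ^ k \<le> (1 - (cmod (of_real (sqrt r) * z))\<^sup>2) ^ k"
        using le True by (intro power_mono) (auto simp: power_le_one_iff intro: power_mono)
      then show ?thesis
        using True b by (simp add: ennreal_leI mult_left_mono qform_poisson_nonneg del: mem_ball)
    qed simp
  qed
  then have "ennreal r * energy k (\<lambda>z. h (of_real r * z)) \<le> ennreal ((sqrt r)\<^sup>2) * (\<integral>\<^sup>+z. ?F (of_real (sqrt r) * z) \<partial>lborel)"
    using r by (simp add: mult_left_mono)
  also have "\<dots> = energy k h"
    unfolding energy_def
    by (rule nn_integral_dilation[symmetric, OF energy_measurable[OF holomorphic_on_disc_continuous[OF h]]])
      (use r in auto)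
  finally show ?thesis .
qed

text \<open>
  After the dilation inequality the operator is evaluated only at radius at most \<open>\<surd>r\<close>, where it is bounded in
  norm. Near the circle the norm of \<open>P\<^sub>\<mu>(z)\<close> may grow like \<open>1/(1 - |z|)\<close>, which need not be integrable, so
  even for polynomials the finiteness of the energy is not obvious without this step.
\<close>

lemma energy_dilation_bounded:
  assumes h: "holomorphic_on_disc h" and r: "0 < r" "r < 1"
    and M: "\<And>w. cmod w \<le> sqrt r \<Longrightarrow> norm (h w) \<le> M"
  shows "energy k (\<lambda>z. h (of_real r * z)) \<le>
    ennreal (2 / (1 - sqrt r) * norm (\<mu> (sphere 0 1)) * M\<^sup>2) * emeasure lborel (ball 0 1 :: complex set)"
proof -
  let ?C = "2 / (1 - sqrt r) * norm (\<mu> (sphere 0 1)) * M\<^sup>2"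
  have sr: "0 < sqrt r" "sqrt r < 1" using r by auto
  have "energy k (\<lambda>z. h (of_real r * z)) \<le> (\<integral>\<^sup>+z. ennreal ?C * indicator (ball 0 1 :: complex set) z \<partial>lborel)"
  proof (rule order_trans[OF energy_dilation_aux[OF h r] nn_integral_mono])
    fix z :: complex
    show "indicator (ball 0 1) z *
     ennreal (qform (poisson_integral \<mu> (of_real (sqrt r) * z)) (h (of_real (sqrt r) * z)) * (1 - (cmod z)\<^sup>2) ^ k) \<le>
     ennreal ?C * indicator (ball 0 1) z"
    proof (cases "z \<in> ball 0 1")
      case True
      let ?w = "of_real (sqrt r) * z"
      have w: "cmod ?w \<le> sqrt r" using True sr by (simp add: norm_mult mult_left_le)
      then have b: "?w \<in> ball 0 1" using le_less_trans[OF w sr(2)] by (simp only: mem_ball_0)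
      have "qform (poisson_integral \<mu> ?w) (h ?w) \<le> norm (poisson_integral \<mu> ?w) * (norm (h ?w))\<^sup>2"
        using qform_le_norm[of "poisson_integral \<mu> ?w" "h ?w"] by linarith
      also have "\<dots> \<le> (2 / (1 - cmod ?w) * norm (\<mu> (sphere 0 1))) * M\<^sup>2"
      proof -
        have "0 \<le> 2 / (1 - cmod ?w) * norm (\<mu> (sphere 0 1))"
          using b by (intro mult_nonneg_nonneg divide_nonneg_nonneg) auto
        then show ?thesis
          using norm_poisson_integral_le[OF b] M[OF w] by (intro mult_mono power_mono) auto
      qed
      also have "\<dots> \<le> ?C"
        using w sr le_less_trans[OF w sr(2)] by (intro mult_right_mono divide_left_mono mult_pos_pos) auto
      finally have q: "qform (poisson_integral \<mu> ?w) (h ?w) \<le> ?C" .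
      have "(1 - (cmod z)\<^sup>2) ^ k \<le> 1" using True by (intro power_le_one) (auto simp: power_le_one_iff)
      then have "qform (poisson_integral \<mu> ?w) (h ?w) * (1 - (cmod z)\<^sup>2) ^ k \<le> ?C * 1"
        using q weight_nonneg[OF True] qform_poisson_nonneg[OF b, of "h ?w"] by (intro mult_mono) auto
      then show ?thesis using True by (simp add: ennreal_leI)
    qed simp
  qed
  also have "\<dots> = ennreal ?C * emeasure lborel (ball 0 1 :: complex set)"
    by (rule nn_integral_cmult_indicator) simp
  finally show ?thesis .
qed

text \<open>
  Pointwise convergence without loss of energy is convergence in energy. The energies of \<open>G\<^sub>i + g\<close> and
  \<open>G\<^sub>i - g\<close> add up to at most four times that of \<open>g\<close>, by the parallelogram identity, while by Fatou the
  lower limit of the former is at least the energy of \<open>2g\<close>, which is four times that of \<open>g\<close>.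
\<close>

lemma energy_tendsto_0:
  assumes G: "\<And>i::nat. continuous_on (ball 0 1) (G i)" and g: "continuous_on (ball 0 1) g"
    and le: "\<And>i. energy k (G i) \<le> energy k g" and fin: "energy k g < \<infinity>"
    and lim: "\<And>z. z \<in> ball 0 1 \<Longrightarrow> (\<lambda>i. G i z) \<longlonglongrightarrow> g z"
  shows "(\<lambda>i. energy k (\<lambda>z. G i z - g z)) \<longlonglongrightarrow> 0"
proof -
  let ?I = "\<lambda>h z. indicator (ball 0 1) z * ennreal (qform (poisson_integral \<mu> z) (h z) * (1 - (cmod z)\<^sup>2) ^ k)"
  obtain A where A: "energy k g = ennreal A" "0 \<le> A"
    using fin by (cases "energy k g") auto
  have sum_le: "energy k (\<lambda>z. G i z + g z) + energy k (\<lambda>z. G i z - g z) \<le> ennreal (4 * A)" for i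
  proof -
    have "energy k (\<lambda>z. G i z + g z) + energy k (\<lambda>z. G i z - g z) = 2 * energy k (G i) + 2 * energy k g"
      by (rule energy_parallelogram[OF G g])
    also have "\<dots> \<le> 2 * ennreal A + 2 * ennreal A"
      using le[of i] A by (intro add_mono mult_left_mono) auto
    also have "\<dots> = ennreal (4 * A)"
    proof -
      have "2 * ennreal A = ennreal (2 * A)" using A(2) by (simp add: ennreal_mult)
      then show ?thesis using A(2) by (simp flip: ennreal_plus)
    qed
    finally show ?thesis .
  qed
  have "ennreal (4 * A) = energy k (\<lambda>z. 2 *\<^sub>R g z)"
    unfolding energy_scaleR[OF g] A(1) using A(2) by (simp add: ennreal_mult)
  also have "\<dots> = (\<integral>\<^sup>+z. liminf (\<lambda>i. ?I (\<lambda>z. G i z + g z) z) \<partial>lborel)"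
    unfolding energy_def
  proof (rule nn_integral_cong)
    fix z
    show "?I (\<lambda>z. 2 *\<^sub>R g z) z = liminf (\<lambda>i. ?I (\<lambda>z. G i z + g z) z)"
    proof (cases "z \<in> ball 0 1")
      case True
      have "(\<lambda>i. G i z + g z) \<longlonglongrightarrow> 2 *\<^sub>R g z"
        using tendsto_add[OF lim[OF True] tendsto_const[of "g z"]] by (simp add: scaleR_2)
      then have "(\<lambda>i. qform (poisson_integral \<mu> z) (G i z + g z) * (1 - (cmod z)\<^sup>2) ^ k) \<longlonglongrightarrow>
          qform (poisson_integral \<mu> z) (2 *\<^sub>R g z) * (1 - (cmod z)\<^sup>2) ^ k"
        unfolding qform_def
        by (intro tendsto_mult tendsto_const tendsto_Re cinner.tendsto blinfun.tendsto)
      from lim_imp_Liminf[OF sequentially_bot tendsto_ennrealI[OF this]]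
      show ?thesis using True by simp
    qed (simp add: Liminf_const)
  qed
  also have "\<dots> \<le> liminf (\<lambda>i. energy k (\<lambda>z. G i z + g z))"
    unfolding energy_def
  proof (rule nn_integral_liminf)
    fix i
    have "continuous_on (ball 0 1) (\<lambda>z. G i z + g z)" by (intro continuous_intros G g)
    from energy_measurable[OF this] show "?I (\<lambda>z. G i z + g z) \<in> borel_measurable lborel" by simp
  qed
  finally have fatou: "ennreal (4 * A) \<le> liminf (\<lambda>i. energy k (\<lambda>z. G i z + g z))" .
  show ?thesis
  proof (rule order_tendstoI)
    fix e :: ennreal assume e: "0 < e"
    show "eventually (\<lambda>i. energy k (\<lambda>z. G i z - g z) < e) sequentially"
    proof (cases "A = 0")
      case True
      have "energy k (\<lambda>z. G i z - g z) \<le> 0" for i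
        using sum_le[of i] True by (simp add: add_eq_0_iff_both_eq_0)
      then show ?thesis using e by (simp add: le_zero_eq)
    next
      case False
      then have A0: "0 < A" using A(2) by simp
      obtain d where d: "0 < d" "ennreal d \<le> e" "d \<le> A"
      proof (cases e)
        case (real x)
        then show ?thesis using e A0 by (intro that[of "min x A"]) auto
      next
        case top
        then show ?thesis using A0 by (intro that[of A]) auto
      qed
      have "ennreal (4 * A - d) < ennreal (4 * A)" using d A0 by (simp add: ennreal_less_iff)
      then have "ennreal (4 * A - d) < liminf (\<lambda>i. energy k (\<lambda>z. G i z + g z))" using fatou by (rule less_le_trans)
      from less_LiminfD[OF this] show ?thesis
      proof eventually_elim
        case (elim i)
        obtain x where x: "energy k (\<lambda>z. G i z + g z) = ennreal x" "0 \<le> x"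
          using sum_le[of i] by (cases "energy k (\<lambda>z. G i z + g z)") (auto simp: top_unique)
        obtain y where y: "energy k (\<lambda>z. G i z - g z) = ennreal y" "0 \<le> y"
          using sum_le[of i] by (cases "energy k (\<lambda>z. G i z - g z)") (auto simp: top_unique)
        have "x + y \<le> 4 * A" using sum_le[of i] x y A(2) by (simp flip: ennreal_plus)
        moreover have "4 * A - d < x" using elim x d A0 by (simp add: ennreal_less_iff)
        ultimately have "y < d" by simp
        then have "ennreal y < ennreal d" using y(2) by (simp add: ennreal_less_iff)
        then show ?case using y d(2) by simp
      qed
    qed
  qed simp
qed

section \<open>The weighted Dirichlet integrals\<close>

definition dirichlet_const :: "nat \<Rightarrow> ennreal" where
  "dirichlet_const n = ennreal (1 / (fact n * fact (n - 1))) * ennreal (1 / pi)"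

lemma dirichlet_const_less_top: "dirichlet_const n < top"
  by (simp add: dirichlet_const_def ennreal_mult_less_top)

lemma continuous_on_derivative:
  "has_power_series f a \<Longrightarrow> continuous_on (ball 0 1) ((complex_derivative ^^ n) f)" for a :: "nat \<Rightarrow> 'e"
  by (rule holomorphic_on_disc_continuous[OF has_power_series_holomorphic[OF has_power_series_iterated_derivative]])

lemma weighted_dirichlet_eq:
  fixes a :: "nat \<Rightarrow> 'e"
  assumes f: "has_power_series f a"
  shows "weighted_dirichlet \<mu> n f = dirichlet_const n * energy (n - 1) ((complex_derivative ^^ n) f)"
proof -
  let ?F = "\<lambda>z. ennreal (qform (poisson_integral \<mu> z) ((complex_derivative ^^ n) f z) * (1 - (cmod z)\<^sup>2) ^ (n - 1))"
  have m: "?F \<in> borel_measurable (restrict_space lborel (ball 0 1))"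
    using energy_measurable[OF continuous_on_derivative[OF f], of n "n - 1"]
    by (subst borel_measurable_restrict_space_iff_ennreal) (simp_all add: mult.commute)
  have "(\<integral>\<^sup>+z. ?F z \<partial>disc_area) = ennreal (1 / pi) * (\<integral>\<^sup>+z. ?F z \<partial>restrict_space lborel (ball 0 1))"
    unfolding disc_area_def by (rule nn_integral_scale_measure[OF m])
  also have "(\<integral>\<^sup>+z. ?F z \<partial>restrict_space lborel (ball 0 1)) = energy (n - 1) ((complex_derivative ^^ n) f)"
    unfolding energy_def by (subst nn_integral_restrict_space) (auto simp: mult.commute)
  finally show ?thesis
    by (simp add: weighted_dirichlet_def dirichlet_const_def qform_def mult.assoc)
qed

lemma holomorphic_derivative:
  "has_power_series f a \<Longrightarrow> holomorphic_on_disc ((complex_derivative ^^ n) f)" for a :: "nat \<Rightarrow> 'e"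
  by (rule has_power_series_holomorphic[OF has_power_series_iterated_derivative])

lemma energy_derivative_dilation:
  fixes a :: "nat \<Rightarrow> 'e"
  assumes f: "has_power_series f a" and r: "0 < r" "r < 1"
  shows "energy k ((complex_derivative ^^ n) (dilation r f)) =
    ennreal (r ^ (2 * n)) * energy k (\<lambda>z. (complex_derivative ^^ n) f (of_real r * z))"
proof -
  have hr: "continuous_on (ball 0 1) (\<lambda>z. (complex_derivative ^^ n) f (of_real r * z))"
    using r by (intro continuous_on_compose2[OF continuous_on_derivative[OF f]] continuous_intros)
      (auto simp del: mem_ball intro!: of_real_mult_in_ball)
  have "energy k ((complex_derivative ^^ n) (dilation r f)) =
      energy k (\<lambda>z. r ^ n *\<^sub>R (complex_derivative ^^ n) f (of_real r * z))"
    using r by (intro energy_cong iterated_derivative_dilation[OF f]) auto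
  also have "\<dots> = ennreal ((r ^ n)\<^sup>2) * energy k (\<lambda>z. (complex_derivative ^^ n) f (of_real r * z))"
    by (rule energy_scaleR[OF hr])
  also have "(r ^ n)\<^sup>2 = r ^ (2 * n)" by (simp add: power_mult[symmetric] mult.commute)
  finally show ?thesis .
qed

text \<open>
  The chain rule contributes \<open>r\<^sup>2\<^sup>n\<close>, which absorbs the Jacobian \<open>1/r\<close> of the dilation as soon as \<open>n \<ge> 1\<close>.
  That the constant is \<open>1\<close> matters for the Fatou argument.
\<close>

lemma energy_derivative_dilation_le:
  fixes a :: "nat \<Rightarrow> 'e"
  assumes f: "has_power_series f a" and r: "0 < r" "r < 1" and n: "1 \<le> n"
  shows "energy k ((complex_derivative ^^ n) (dilation r f)) \<le> energy k ((complex_derivative ^^ n) f)"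
proof -
  let ?h = "(complex_derivative ^^ n) f"
  have "ennreal (r ^ (2 * n)) * energy k (\<lambda>z. ?h (of_real r * z)) \<le> ennreal r * energy k (\<lambda>z. ?h (of_real r * z))"
    using power_decreasing[of 1 "2 * n" r] r n by (intro mult_right_mono ennreal_leI) auto
  also have "\<dots> \<le> energy k ?h" by (rule energy_dilation_le[OF holomorphic_derivative[OF f] r])
  finally show ?thesis unfolding energy_derivative_dilation[OF f r] .
qed

lemma dirichlet_dilation_bounded:
  fixes a :: "nat \<Rightarrow> 'e"
  assumes f: "has_power_series f a" and r: "0 < r" "r < 1"
    and M: "\<And>w. cmod w \<le> sqrt r \<Longrightarrow> norm ((complex_derivative ^^ n) f w) \<le> M"
  shows "weighted_dirichlet \<mu> n (dilation r f) \<le> dirichlet_const n *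
    (ennreal (2 / (1 - sqrt r) * norm (\<mu> (sphere 0 1)) * M\<^sup>2) * emeasure lborel (ball 0 1 :: complex set))"
proof -
  let ?h = "(complex_derivative ^^ n) f"
  have fr: "has_power_series (dilation r f) (\<lambda>j. r ^ j *\<^sub>R a j)"
    using r by (intro has_power_series_dilation[OF f]) auto
  have "ennreal (r ^ (2 * n)) * energy (n - 1) (\<lambda>z. ?h (of_real r * z)) \<le> 1 * energy (n - 1) (\<lambda>z. ?h (of_real r * z))"
    using r by (intro mult_right_mono) (auto simp: power_le_one)
  also have "\<dots> \<le> ennreal (2 / (1 - sqrt r) * norm (\<mu> (sphere 0 1)) * M\<^sup>2) * emeasure lborel (ball 0 1 :: complex set)"
    using energy_dilation_bounded[OF holomorphic_derivative[OF f] r M] by simp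
  finally show ?thesis
    unfolding weighted_dirichlet_eq[OF fr] energy_derivative_dilation[OF f r] by (rule mult_left_mono) simp
qed

lemma dirichlet_dilation_finite:
  fixes a :: "nat \<Rightarrow> 'e"
  assumes f: "has_power_series f a" and r: "0 < r" "r < 1"
  shows "weighted_dirichlet \<mu> n (dilation r f) < \<infinity>"
proof -
  have "compact ((complex_derivative ^^ n) f ` cball 0 (sqrt r))"
    using r by (intro compact_continuous_image continuous_on_subset[OF continuous_on_derivative[OF f]])
      (auto simp: cball_subset_ball_iff)
  then have "bounded ((complex_derivative ^^ n) f ` cball 0 (sqrt r))"
    by (rule compact_imp_bounded)
  then obtain M where "\<forall>x\<in>(complex_derivative ^^ n) f ` cball 0 (sqrt r). norm x \<le> M"
    unfolding bounded_iff ..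
  then have M: "norm ((complex_derivative ^^ n) f w) \<le> M" if "w \<in> cball 0 (sqrt r)" for w
    using that by blast
  have "weighted_dirichlet \<mu> n (dilation r f) \<le> dirichlet_const n *
    (ennreal (2 / (1 - sqrt r) * norm (\<mu> (sphere 0 1)) * M\<^sup>2) * emeasure lborel (ball 0 1 :: complex set))"
    by (rule dirichlet_dilation_bounded[OF f r]) (rule M, simp)
  also have "\<dots> < \<infinity>"
    using dirichlet_const_less_top[of n] emeasure_lborel_ball_finite[of "0::complex" 1]
    by (simp add: ennreal_mult_less_top)
  finally show ?thesis .
qed

lemma dirichlet_parallelogram:
  fixes a b :: "nat \<Rightarrow> 'e"
  assumes f: "has_power_series f a" and g: "has_power_series g b"
  shows "weighted_dirichlet \<mu> n (\<lambda>z. f z + g z) + weighted_dirichlet \<mu> n (\<lambda>z. f z - g z) =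
    2 * weighted_dirichlet \<mu> n f + 2 * weighted_dirichlet \<mu> n g"
proof -
  let ?d = "complex_derivative ^^ n"
  have "energy (n - 1) (?d (\<lambda>z. f z + g z)) + energy (n - 1) (?d (\<lambda>z. f z - g z)) =
      energy (n - 1) (\<lambda>z. ?d f z + ?d g z) + energy (n - 1) (\<lambda>z. ?d f z - ?d g z)"
    by (intro arg_cong2[where f = "(+)"] energy_cong iterated_derivative_add[OF f g] iterated_derivative_diff[OF f g])
  also have "\<dots> = 2 * energy (n - 1) (?d f) + 2 * energy (n - 1) (?d g)"
    by (intro energy_parallelogram continuous_on_derivative[OF f] continuous_on_derivative[OF g])
  finally have "dirichlet_const n * (energy (n - 1) (?d (\<lambda>z. f z + g z)) + energy (n - 1) (?d (\<lambda>z. f z - g z))) =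
      dirichlet_const n * (2 * energy (n - 1) (?d f) + 2 * energy (n - 1) (?d g))"
    by (rule arg_cong)
  then show ?thesis
    unfolding weighted_dirichlet_eq[OF f] weighted_dirichlet_eq[OF g]
      weighted_dirichlet_eq[OF has_power_series_add[OF f g]] weighted_dirichlet_eq[OF has_power_series_diff[OF f g]]
    by (simp only: distrib_left mult.left_commute[of _ 2])
qed

lemma dirichlet_add_le:
  fixes a b :: "nat \<Rightarrow> 'e"
  assumes "has_power_series f a" "has_power_series g b"
  shows "weighted_dirichlet \<mu> n (\<lambda>z. f z + g z) \<le> 2 * weighted_dirichlet \<mu> n f + 2 * weighted_dirichlet \<mu> n g"
  unfolding dirichlet_parallelogram[OF assms, symmetric] by simp

lemma dirichlet_diff_le:
  fixes a b :: "nat \<Rightarrow> 'e"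
  assumes "has_power_series f a" "has_power_series g b"
  shows "weighted_dirichlet \<mu> n (\<lambda>z. f z - g z) \<le> 2 * weighted_dirichlet \<mu> n f + 2 * weighted_dirichlet \<mu> n g"
  unfolding dirichlet_parallelogram[OF assms, symmetric] by simp

lemma dirichlet_dilation_tendsto:
  fixes a :: "nat \<Rightarrow> 'e"
  assumes f: "has_power_series f a" and fin: "weighted_dirichlet \<mu> n f < \<infinity>" and n: "1 \<le> n"
  shows "((\<lambda>r. weighted_dirichlet \<mu> n (\<lambda>z. dilation r f z - f z)) \<longlongrightarrow> 0) (at_left 1)"
proof (rule tendsto_at_left_sequentially[of 0])
  fix S :: "nat \<Rightarrow> real"
  assume S: "\<And>i. S i < 1" "\<And>i. 0 < S i" "S \<longlonglongrightarrow> 1"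
  let ?d = "complex_derivative ^^ n"
  let ?E = "energy (n - 1)"
  have fr: "has_power_series (dilation (S i) f) (\<lambda>j. S i ^ j *\<^sub>R a j)" for i
    using S(1)[of i] S(2)[of i] by (intro has_power_series_dilation[OF f]) auto
  have c0: "dirichlet_const n \<noteq> 0"
    by (simp add: dirichlet_const_def)
  have "?E (?d f) < \<infinity>"
    using fin c0 unfolding weighted_dirichlet_eq[OF f] by (auto simp: ennreal_mult_less_top)
  then have "(\<lambda>i. ?E (\<lambda>z. ?d (dilation (S i) f) z - ?d f z)) \<longlonglongrightarrow> 0"
  proof (intro energy_tendsto_0 continuous_on_derivative[OF f] continuous_on_derivative[OF fr])
    show "?E (?d (dilation (S i) f)) \<le> ?E (?d f)" for i
      by (rule energy_derivative_dilation_le[OF f S(2,1) n])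
    fix z :: complex assume z: "z \<in> ball 0 1"
    have "isCont (?d f) z"
      using continuous_on_derivative[OF f, of n] z by (simp add: continuous_on_eq_continuous_at)
    moreover have "(\<lambda>i. of_real (S i) * z) \<longlonglongrightarrow> of_real 1 * z"
      by (intro tendsto_intros S(3))
    then have "(\<lambda>i. of_real (S i) * z) \<longlonglongrightarrow> z" by simp
    ultimately have "(\<lambda>i. ?d f (of_real (S i) * z)) \<longlonglongrightarrow> ?d f z"
      by (rule isCont_tendsto_compose)
    then have "(\<lambda>i. S i ^ n *\<^sub>R ?d f (of_real (S i) * z)) \<longlonglongrightarrow> 1 ^ n *\<^sub>R ?d f z"
      by (intro tendsto_intros S(3))
    then show "(\<lambda>i. ?d (dilation (S i) f) z) \<longlonglongrightarrow> ?d f z"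
      using S(1,2) by (simp add: iterated_derivative_dilation[OF f _ _ z] less_imp_le)
  qed
  then have "(\<lambda>i. dirichlet_const n * ?E (\<lambda>z. ?d (dilation (S i) f) z - ?d f z)) \<longlonglongrightarrow> dirichlet_const n * 0"
    by (intro ennreal_tendsto_cmult dirichlet_const_less_top)
  moreover have "weighted_dirichlet \<mu> n (\<lambda>z. dilation (S i) f z - f z) =
      dirichlet_const n * ?E (\<lambda>z. ?d (dilation (S i) f) z - ?d f z)" for i
    unfolding weighted_dirichlet_eq[OF has_power_series_diff[OF fr f]]
    by (intro arg_cong2[where f = "(*)"] refl energy_cong iterated_derivative_diff[OF fr f])
  ultimately show "(\<lambda>i. weighted_dirichlet \<mu> n (\<lambda>z. dilation (S i) f z - f z)) \<longlonglongrightarrow> 0" by simp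
qed simp

text \<open>
  The dilated Taylor polynomials converge to the dilation: the derivatives of the undilated remainders
  tend to \<open>0\<close> uniformly on the disc of radius \<open>\<surd>r\<close>.
\<close>

lemma dirichlet_taylor_tendsto:
  fixes a :: "nat \<Rightarrow> 'e"
  assumes f: "has_power_series f a" and r: "0 < r" "r < 1"
  shows "(\<lambda>N. weighted_dirichlet \<mu> n (dilation r (\<lambda>z. (\<Sum>k\<le>N. z ^ k *\<^sub>C a k) - f z))) \<longlonglongrightarrow> 0"
proof -
  let ?V = "emeasure lborel (ball 0 1 :: complex set)"
  define M where "M N = (\<Sum>j. if j + n \<le> N then 0 else norm ((diff_coeffs ^^ n) (\<lambda>j. - a j) j) * sqrt r ^ j)" for N
  have nf: "has_power_series (\<lambda>z. - f z) (\<lambda>j. - a j)"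
    using f by (simp add: has_power_series_def scaleC.minus_right sums_minus)
  have sr: "0 \<le> sqrt r" "sqrt r < 1" using r by auto
  have tail: "has_power_series (\<lambda>z. (\<Sum>k\<le>N. z ^ k *\<^sub>C a k) - f z) (\<lambda>j. if j \<le> N then 0 else - a j)" for N
  proof -
    have "(\<lambda>j. (if j \<le> N then a j else 0) - a j) = (\<lambda>j. if j \<le> N then 0 else - a j)" by auto
    then show ?thesis using has_power_series_diff[OF has_power_series_polynomial[of a N] f] by simp
  qed
  have "M \<longlonglongrightarrow> 0"
    unfolding M_def by (rule iterated_derivative_tail_tendsto[OF nf sr])
  then have "(\<lambda>N. 2 / (1 - sqrt r) * norm (\<mu> (sphere 0 1)) * (M N)\<^sup>2) \<longlonglongrightarrow> 2 / (1 - sqrt r) * norm (\<mu> (sphere 0 1)) * 0\<^sup>2"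
    by (intro tendsto_intros)
  then have "(\<lambda>N. dirichlet_const n * (?V * ennreal (2 / (1 - sqrt r) * norm (\<mu> (sphere 0 1)) * (M N)\<^sup>2)))
      \<longlonglongrightarrow> dirichlet_const n * (?V * ennreal (2 / (1 - sqrt r) * norm (\<mu> (sphere 0 1)) * 0\<^sup>2))"
    using emeasure_lborel_ball_finite[of "0::complex" 1]
    by (intro ennreal_tendsto_cmult dirichlet_const_less_top tendsto_ennrealI) auto
  then have lim: "(\<lambda>N. dirichlet_const n * (ennreal (2 / (1 - sqrt r) * norm (\<mu> (sphere 0 1)) * (M N)\<^sup>2) * ?V)) \<longlonglongrightarrow> 0"
    by (simp add: mult.commute[of ?V])
  show ?thesis
  proof (rule tendsto_sandwich[OF _ _ tendsto_const lim])
    show "\<forall>\<^sub>F N in sequentially. weighted_dirichlet \<mu> n (dilation r (\<lambda>z. (\<Sum>k\<le>N. z ^ k *\<^sub>C a k) - f z)) \<le>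
        dirichlet_const n * (ennreal (2 / (1 - sqrt r) * norm (\<mu> (sphere 0 1)) * (M N)\<^sup>2) * ?V)"
      by (intro always_eventually allI dirichlet_dilation_bounded[OF tail r])
        (auto simp: M_def intro: iterated_derivative_tail_le[OF tail nf sr])
  qed simp
qed

end

section \<open>Dilations and polynomials in the intersection space\<close>

lemma H_spaceD:
  assumes "f \<in> H_space m \<mu>"
  shows "\<exists>a. has_power_series f a \<and> summable (\<lambda>j. (norm (a j))\<^sup>2) \<and>
    (\<forall>j\<in>{1..m - 1}. weighted_dirichlet (\<mu> j) j f < \<infinity>)"
  using assms unfolding H_space_def hardy_space_def dirichlet_space_def by blast

lemma H_spaceI:
  fixes a :: "nat \<Rightarrow> 'e::complex_hilbert_space"
  assumes "has_power_series f a" "summable (\<lambda>j. (norm (a j))\<^sup>2)"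
    "\<And>j. j \<in> {1..m - 1} \<Longrightarrow> weighted_dirichlet (\<mu> j) j f < \<infinity>"
  shows "f \<in> H_space m \<mu>"
  unfolding H_space_def hardy_space_def dirichlet_space_def
  using assms has_power_series_holomorphic[OF assms(1)] by blast

text \<open>
  The square root in the norm is postponed, since limits and the parallelogram estimates concern the squares.
\<close>

definition H_norm_sq ::
    "nat \<Rightarrow> (nat \<Rightarrow> complex set \<Rightarrow> ('e::complex_inner_space \<Rightarrow>\<^sub>L 'e)) \<Rightarrow> (complex \<Rightarrow> 'e) \<Rightarrow> real" where
  "H_norm_sq m \<mu> f = hardy_norm_sq f + (\<Sum>j = 1..m - 1. enn2real (weighted_dirichlet (\<mu> j) j f))"

lemma H_norm_eq: "H_norm m \<mu> f = sqrt (H_norm_sq m \<mu> f)"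
  by (simp add: H_norm_def H_norm_sq_def)

lemma tendsto_H_norm_sq:
  assumes "((\<lambda>x. hardy_norm_sq (f x)) \<longlongrightarrow> 0) F"
    and "\<And>j. j \<in> {1..m - 1} \<Longrightarrow> ((\<lambda>x. weighted_dirichlet (\<mu> j) j (f x)) \<longlongrightarrow> 0) F"
  shows "((\<lambda>x. H_norm_sq m \<mu> (f x)) \<longlongrightarrow> 0) F"
proof -
  have "((\<lambda>x. enn2real (weighted_dirichlet (\<mu> j) j (f x))) \<longlongrightarrow> 0) F" if "j \<in> {1..m - 1}" for j
    using assms(2)[OF that] by (intro tendsto_enn2real) auto
  then have "((\<lambda>x. H_norm_sq m \<mu> (f x)) \<longlongrightarrow> 0 + (\<Sum>j = 1..m - 1. 0)) F"
    unfolding H_norm_sq_def by (intro tendsto_add tendsto_sum assms(1))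
  then show ?thesis by simp
qed

locale semi_spectral_tuple =
  fixes m :: nat and \<mu> :: "nat \<Rightarrow> complex set \<Rightarrow> ('e::complex_hilbert_space \<Rightarrow>\<^sub>L 'e)"
  assumes semi_spectral: "\<And>j. j \<in> {1..m - 1} \<Longrightarrow> semi_spectral (\<mu> j)"
begin

lemma H_norm_sq_add_le:
  assumes "u \<in> H_space m \<mu>" "v \<in> H_space m \<mu>"
  shows "H_norm_sq m \<mu> (\<lambda>z. u z + v z) \<le> 2 * H_norm_sq m \<mu> u + 2 * H_norm_sq m \<mu> v"
proof -
  obtain a where u: "has_power_series u a" "summable (\<lambda>j. (norm (a j))\<^sup>2)"
    "\<And>j. j \<in> {1..m - 1} \<Longrightarrow> weighted_dirichlet (\<mu> j) j u < \<infinity>" using H_spaceD[OF assms(1)] by blast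
  obtain b where v: "has_power_series v b" "summable (\<lambda>j. (norm (b j))\<^sup>2)"
    "\<And>j. j \<in> {1..m - 1} \<Longrightarrow> weighted_dirichlet (\<mu> j) j v < \<infinity>" using H_spaceD[OF assms(2)] by blast
  have "enn2real (weighted_dirichlet (\<mu> j) j (\<lambda>z. u z + v z)) \<le>
      2 * enn2real (weighted_dirichlet (\<mu> j) j u) + 2 * enn2real (weighted_dirichlet (\<mu> j) j v)"
    if j: "j \<in> {1..m - 1}" for j
  proof -
    obtain x where x: "weighted_dirichlet (\<mu> j) j u = ennreal x" "0 \<le> x"
      using u(3)[OF j] by (cases "weighted_dirichlet (\<mu> j) j u") auto
    obtain y where y: "weighted_dirichlet (\<mu> j) j v = ennreal y" "0 \<le> y"
      using v(3)[OF j] by (cases "weighted_dirichlet (\<mu> j) j v") auto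
    have "weighted_dirichlet (\<mu> j) j (\<lambda>z. u z + v z) \<le> ennreal 2 * ennreal x + ennreal 2 * ennreal y"
      using semi_spectral.dirichlet_add_le[OF semi_spectral[OF j] u(1) v(1), of j] x y by simp
    also have "\<dots> = ennreal (2 * x + 2 * y)" using x(2) y(2) by (simp add: ennreal_mult)
    finally show ?thesis using x y by (simp add: enn2real_leI)
  qed
  then have "(\<Sum>j = 1..m - 1. enn2real (weighted_dirichlet (\<mu> j) j (\<lambda>z. u z + v z))) \<le>
      (\<Sum>j = 1..m - 1. 2 * enn2real (weighted_dirichlet (\<mu> j) j u) + 2 * enn2real (weighted_dirichlet (\<mu> j) j v))"
    by (intro sum_mono) auto
  then show ?thesis
    using hardy_add_le(2)[OF u(1) v(1) u(2) v(2)]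
    by (simp add: H_norm_sq_def sum.distrib sum_distrib_left)
qed

lemma H_space_diff:
  assumes "u \<in> H_space m \<mu>" "v \<in> H_space m \<mu>"
  shows "(\<lambda>z. u z - v z) \<in> H_space m \<mu>"
proof -
  obtain a where u: "has_power_series u a" "summable (\<lambda>j. (norm (a j))\<^sup>2)"
    "\<And>j. j \<in> {1..m - 1} \<Longrightarrow> weighted_dirichlet (\<mu> j) j u < \<infinity>" using H_spaceD[OF assms(1)] by blast
  obtain b where v: "has_power_series v b" "summable (\<lambda>j. (norm (b j))\<^sup>2)"
    "\<And>j. j \<in> {1..m - 1} \<Longrightarrow> weighted_dirichlet (\<mu> j) j v < \<infinity>" using H_spaceD[OF assms(2)] by blast
  have s: "summable (\<lambda>j. 2 * (norm (a j))\<^sup>2 + 2 * (norm (b j))\<^sup>2)"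
    by (rule summable_add[OF summable_mult[OF u(2)] summable_mult[OF v(2)]])
  show ?thesis
  proof (rule H_spaceI[OF has_power_series_diff[OF u(1) v(1)]])
    show "summable (\<lambda>j. (norm (a j - b j))\<^sup>2)"
      by (rule summable_comparison_test'[OF s, of 0]) (use norm_add_sq_le[of "a _" "- b _"] in auto)
    fix j assume j: "j \<in> {1..m - 1}"
    have "weighted_dirichlet (\<mu> j) j (\<lambda>z. u z - v z) \<le>
        2 * weighted_dirichlet (\<mu> j) j u + 2 * weighted_dirichlet (\<mu> j) j v"
      by (rule semi_spectral.dirichlet_diff_le[OF semi_spectral[OF j] u(1) v(1)])
    also have "\<dots> < \<infinity>" using u(3)[OF j] v(3)[OF j] by (simp add: ennreal_mult_less_top)
    finally show "weighted_dirichlet (\<mu> j) j (\<lambda>z. u z - v z) < \<infinity>" .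
  qed
qed

lemma dilation_in_H_space:
  assumes f: "f \<in> H_space m \<mu>" and r: "0 < r" "r < 1"
  shows "dilation r f \<in> H_space m \<mu>"
proof -
  obtain a where a: "has_power_series f a" "summable (\<lambda>j. (norm (a j))\<^sup>2)" using H_spaceD[OF f] by blast
  have "norm (r ^ j *\<^sub>R a j) \<le> norm (a j)" for j
    using r by (simp add: mult_left_le_one_le power_le_one)
  then have "summable (\<lambda>j. (norm (r ^ j *\<^sub>R a j))\<^sup>2)"
    by (intro summable_comparison_test'[OF a(2), of 0]) (simp add: power_mono del: norm_scaleR)
  then show ?thesis
    using r a(1) semi_spectral
    by (intro H_spaceI[OF has_power_series_dilation[OF a(1)]] semi_spectral.dirichlet_dilation_finite[OF semi_spectral a(1) r]) auto
qed

lemma dilation_converges: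
  assumes f: "f \<in> H_space m \<mu>"
  shows "((\<lambda>r. H_norm_sq m \<mu> (\<lambda>z. dilation r f z - f z)) \<longlongrightarrow> 0) (at_left 1)"
proof (rule tendsto_H_norm_sq)
  obtain a where a: "has_power_series f a" "summable (\<lambda>j. (norm (a j))\<^sup>2)"
    "\<And>j. j \<in> {1..m - 1} \<Longrightarrow> weighted_dirichlet (\<mu> j) j f < \<infinity>" using H_spaceD[OF f] by blast
  have ev: "eventually (\<lambda>r. 0 < r \<and> r < (1::real)) (at_left 1)"
    using eventually_at_left_real[of 0 "1::real"] by simp
  show "((\<lambda>r. hardy_norm_sq (\<lambda>z. dilation r f z - f z)) \<longlongrightarrow> 0) (at_left 1)"
  proof (rule hardy_multiplier_tendsto_0[OF a(2), where c = "\<lambda>r j. r ^ j - 1"])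
    show "((\<lambda>r::real. r ^ j - 1) \<longlongrightarrow> 0) (at_left 1)" for j
    proof -
      have "((\<lambda>r::real. r ^ j - 1) \<longlongrightarrow> 1 ^ j - 1) (at_left 1)" by (intro tendsto_intros)
      then show ?thesis by simp
    qed
    show "\<forall>\<^sub>F r in at_left 1. \<forall>j. \<bar>r ^ j - 1\<bar> \<le> (1::real)"
      using ev by eventually_elim (auto simp: abs_le_iff power_le_one)
    show "\<forall>\<^sub>F r in at_left 1. has_power_series (\<lambda>z. dilation r f z - f z) (\<lambda>j. (r ^ j - 1) *\<^sub>R a j)"
      using ev
    proof eventually_elim
      case (elim r)
      then show ?case
        using has_power_series_diff[OF has_power_series_dilation[OF a(1), of r] a(1)]
        by (simp add: scaleR_diff_left)
    qed
  qed simp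
  show "((\<lambda>r. weighted_dirichlet (\<mu> j) j (\<lambda>z. dilation r f z - f z)) \<longlongrightarrow> 0) (at_left 1)" if "j \<in> {1..m - 1}" for j
    using that by (intro semi_spectral.dirichlet_dilation_tendsto[OF semi_spectral a(1) a(3)]) auto
qed

lemma dilated_polynomial:
  "dilation r (\<lambda>z. \<Sum>k\<le>N. z ^ k *\<^sub>C a k) = (\<lambda>z. \<Sum>k\<le>N. z ^ k *\<^sub>C (r ^ k *\<^sub>R a k))" for a :: "nat \<Rightarrow> 'e"
proof
  fix z :: complex
  have "(of_real r * z) ^ k *\<^sub>C a k = z ^ k *\<^sub>C (r ^ k *\<^sub>R a k)" for k
    by (simp add: power_mult_distrib scaleC_scaleC scaleC_of_real[symmetric] mult.commute)
  then show "dilation r (\<lambda>z. \<Sum>k\<le>N. z ^ k *\<^sub>C a k) z = (\<Sum>k\<le>N. z ^ k *\<^sub>C (r ^ k *\<^sub>R a k))"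
    by (simp add: dilation_def)
qed

text \<open>
  Every polynomial is the dilation by \<open>1/2\<close> of another polynomial, and dilations of power series on the
  disc have finite Dirichlet integrals.
\<close>

lemma polynomial_in_H_space: "vector_polynomials \<subseteq> H_space m \<mu>"
proof
  fix p :: "complex \<Rightarrow> 'e" assume "p \<in> vector_polynomials"
  then obtain N a where p: "p = (\<lambda>z. \<Sum>k\<le>N. z ^ k *\<^sub>C a k)" by (auto simp: vector_polynomials_def)
  define b where "b k = 2 ^ k *\<^sub>R a k" for k
  have p': "p = dilation (1/2) (\<lambda>z. \<Sum>k\<le>N. z ^ k *\<^sub>C b k)"
    unfolding dilated_polynomial p b_def by (simp add: power_mult_distrib[symmetric])
  show "p \<in> H_space m \<mu>"
  proof (rule H_spaceI)
    show "has_power_series p (\<lambda>k. if k \<le> N then a k else 0)"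
      unfolding p by (rule has_power_series_polynomial)
    show "summable (\<lambda>j. (norm (if j \<le> N then a j else 0))\<^sup>2)"
      by (rule summable_finite[of "{..N}"]) auto
    show "weighted_dirichlet (\<mu> j) j p < \<infinity>" if "j \<in> {1..m - 1}" for j
      unfolding p' by (rule semi_spectral.dirichlet_dilation_finite[OF semi_spectral[OF that] has_power_series_polynomial]) auto
  qed
qed

lemma taylor_dilation_converges:
  assumes f: "has_power_series f a" "summable (\<lambda>j. (norm (a j))\<^sup>2)" and r: "0 < r" "r < 1"
  shows "(\<lambda>N. H_norm_sq m \<mu> (dilation r (\<lambda>z. (\<Sum>k\<le>N. z ^ k *\<^sub>C a k) - f z))) \<longlonglongrightarrow> 0"
proof (rule tendsto_H_norm_sq)
  show "(\<lambda>N. weighted_dirichlet (\<mu> j) j (dilation r (\<lambda>z. (\<Sum>k\<le>N. z ^ k *\<^sub>C a k) - f z))) \<longlonglongrightarrow> 0"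
    if "j \<in> {1..m - 1}" for j
    by (rule semi_spectral.dirichlet_taylor_tendsto[OF semi_spectral[OF that] f(1) r])
  show "(\<lambda>N. hardy_norm_sq (dilation r (\<lambda>z. (\<Sum>k\<le>N. z ^ k *\<^sub>C a k) - f z))) \<longlonglongrightarrow> 0"
  proof (rule hardy_multiplier_tendsto_0[OF f(2), where c = "\<lambda>N j. if j \<le> N then 0 else - (r ^ j)"])
    show "(\<lambda>N. if j \<le> N then 0 else - (r ^ j)) \<longlonglongrightarrow> 0" for j
      by (rule tendsto_eventually) (auto simp: eventually_sequentially)
    show "\<forall>\<^sub>F N in sequentially. \<forall>j. \<bar>if j \<le> N then 0 else - (r ^ j)\<bar> \<le> 1"
      using r by (intro always_eventually) (auto simp: power_le_one)
    show "\<forall>\<^sub>F N in sequentially. has_power_series (dilation r (\<lambda>z. (\<Sum>k\<le>N. z ^ k *\<^sub>C a k) - f z))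
        (\<lambda>j. (if j \<le> N then 0 else - (r ^ j)) *\<^sub>R a j)"
    proof (intro always_eventually allI)
      fix N
      have "(\<lambda>j. r ^ j *\<^sub>R ((if j \<le> N then a j else 0) - a j)) = (\<lambda>j. (if j \<le> N then 0 else - (r ^ j)) *\<^sub>R a j)"
        by (auto simp: fun_eq_iff)
      then show "has_power_series (dilation r (\<lambda>z. (\<Sum>k\<le>N. z ^ k *\<^sub>C a k) - f z))
        (\<lambda>j. (if j \<le> N then 0 else - (r ^ j)) *\<^sub>R a j)"
        using has_power_series_dilation[OF has_power_series_diff[OF has_power_series_polynomial[of a N] f(1)], of r] r by simp
    qed
  qed simp
qed

text \<open>
  Dilate first, then truncate: \<open>p - f = (p - f\<^sub>r) + (f\<^sub>r - f)\<close>, where \<open>p\<close> is a dilated Taylor polynomial.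
\<close>

lemma polynomials_dense:
  assumes f: "f \<in> H_space m \<mu>" and \<epsilon>: "0 < \<epsilon>"
  shows "\<exists>p\<in>vector_polynomials. H_norm m \<mu> (\<lambda>z. p z - f z) < \<epsilon>"
proof -
  obtain a where a: "has_power_series f a" "summable (\<lambda>j. (norm (a j))\<^sup>2)"
    using H_spaceD[OF f] by blast
  have "eventually (\<lambda>r. H_norm_sq m \<mu> (\<lambda>z. dilation r f z - f z) < \<epsilon>\<^sup>2 / 4) (at_left 1)"
    using dilation_converges[OF f] \<epsilon> by (intro order_tendstoD) auto
  moreover have "eventually (\<lambda>r. 0 < r \<and> r < (1::real)) (at_left 1)"
    using eventually_at_left_real[of 0 "1::real"] by simp
  ultimately have "eventually (\<lambda>r. H_norm_sq m \<mu> (\<lambda>z. dilation r f z - f z) < \<epsilon>\<^sup>2 / 4 \<and> 0 < r \<and> r < 1) (at_left 1)"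
    by (rule eventually_conj)
  then obtain r where r: "H_norm_sq m \<mu> (\<lambda>z. dilation r f z - f z) < \<epsilon>\<^sup>2 / 4" "0 < r" "r < 1"
    using eventually_happens'[of "at_left (1::real)"] by auto
  have "eventually (\<lambda>N. H_norm_sq m \<mu> (dilation r (\<lambda>z. (\<Sum>k\<le>N. z ^ k *\<^sub>C a k) - f z)) < \<epsilon>\<^sup>2 / 4) sequentially"
    using taylor_dilation_converges[OF a r(2,3)] \<epsilon> by (intro order_tendstoD) auto
  then obtain N where N: "H_norm_sq m \<mu> (dilation r (\<lambda>z. (\<Sum>k\<le>N. z ^ k *\<^sub>C a k) - f z)) < \<epsilon>\<^sup>2 / 4"
    using eventually_happens'[OF sequentially_bot] by blast
  define p where "p = dilation r (\<lambda>z. \<Sum>k\<le>N. z ^ k *\<^sub>C a k)"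
  have p: "p \<in> vector_polynomials"
    unfolding p_def dilated_polynomial vector_polynomials_def
    by (intro CollectI exI[of _ N] exI[of _ "\<lambda>k. r ^ k *\<^sub>R a k"] refl)
  have "dilation r (\<lambda>z. (\<Sum>k\<le>N. z ^ k *\<^sub>C a k) - f z) = (\<lambda>z. p z - dilation r f z)"
    by (simp add: p_def dilation_def fun_eq_iff)
  then have "H_norm_sq m \<mu> (\<lambda>z. (p z - dilation r f z) + (dilation r f z - f z)) < 2 * (\<epsilon>\<^sup>2 / 4) + 2 * (\<epsilon>\<^sup>2 / 4)"
    using H_norm_sq_add_le[OF H_space_diff[OF subsetD[OF polynomial_in_H_space p] dilation_in_H_space[OF f r(2,3)]]
        H_space_diff[OF dilation_in_H_space[OF f r(2,3)] f]] N r(1) by simp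
  then have "H_norm_sq m \<mu> (\<lambda>z. p z - f z) < \<epsilon>\<^sup>2" by simp
  then have "H_norm m \<mu> (\<lambda>z. p z - f z) < sqrt (\<epsilon>\<^sup>2)"
    unfolding H_norm_eq by (rule real_sqrt_less_mono)
  then show ?thesis using p \<epsilon> by (intro bexI[of _ p]) auto
qed

end

theorem proposition4p2:
  fixes m :: nat
    and \<mu> :: "nat \<Rightarrow> complex set \<Rightarrow> ('e::complex_hilbert_space \<Rightarrow>\<^sub>L 'e)"
  assumes "separable_space (euclidean :: 'e topology)"
    and "m \<ge> 2"
    and "\<And>j. j \<in> {1..m - 1} \<Longrightarrow> semi_spectral_measure (\<mu> j)"
  shows "(\<forall>f\<in>H_space m \<mu>.
            (\<forall>r\<in>{0<..<1}. dilation r f \<in> H_space m \<mu>) \<and>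
            ((\<lambda>r. H_norm m \<mu> (\<lambda>z. dilation r f z - f z)) \<longlongrightarrow> 0) (at_left 1)) \<and>
         (vector_polynomials \<subseteq> H_space m \<mu> \<and>
          (\<forall>f\<in>H_space m \<mu>. \<forall>\<epsilon>>0. \<exists>p\<in>vector_polynomials. H_norm m \<mu> (\<lambda>z. p z - f z) < \<epsilon>))"
proof -
  interpret semi_spectral_tuple m \<mu>
    using assms(3) by (intro semi_spectral_tuple.intro semi_spectral.intro)
  have "((\<lambda>r. H_norm m \<mu> (\<lambda>z. dilation r f z - f z)) \<longlongrightarrow> 0) (at_left 1)" if "f \<in> H_space m \<mu>" for f
    unfolding H_norm_eq using tendsto_real_sqrt[OF dilation_converges[OF that]] by simp
  then show ?thesis
    using dilation_in_H_space polynomial_in_H_space polynomials_dense by auto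
qed

end
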